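(* Let $X$ be a simplicial set and let $h\colon X\to \mathrm{R}$ be a height function such that $X$ is subdivided according to $h$. With coefficients in a field, the Reeb complexes $\mathcal{G}_q$ ($q\ge0$) of $h$ recover the homology of $X$: for every $n$, \[ \mathrm{H}_nX\cong\bigoplus_{p+q=n}\mathrm{H}_p\mathcal{G}_q . \]
   Context: Homology is taken with coefficients in a fixed field $k$. Simplicial real line: $\mathrm{R}=\mathrm{N}(\mathbb{R},\leq)$, the nerve of the poset $(\mathbb{R},\le)$; an $n$-simplex is a non-decreasing sequence $\bar a=(a_0,\dots,a_n)$ of real numbers, equivalently a simplicial map $\bar a\colon\Delta^n\to \mathrm{R}$. A height function on a simplicial set $X$ is a simplicial map $h\colon X\to \mathrm{R}$; the real numbers in $h(X_0)$ are its height levels. Section spaces: for $\bar a\in \mathrm{R}_p$, let $\mathcal{S}_h[\bar a]$ be the simplicial set whose $q$-simplices are the simplicial maps $\rho\colon\Delta^p\times\Delta^q\to X$ with $h\circ\rho=\bar a\circ \mathrm{pr}_0$, where $\mathrm{pr}_0$ is the projection to $\Delta^p$; put $(\mathcal{S}_h)_p=\coprod_{\bar a\in \mathrm{R}_p}\mathcal{S}_h[\bar a]$. Precomposition with $\delta^i\times\mathrm{id}$ and $\sigma^j\times\mathrm{id}$ (coface and codegeneracy maps in the $\Delta^p$ factor) gives horizontal face and degeneracy maps $d_i^h\colon(\mathcal{S}_h)_p\to(\mathcal{S}_h)_{p-1}$, $s_j^h\colon(\mathcal{S}_h)_p\to(\mathcal{S}_h)_{p+1}$. Subdivided: $X$ is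 subdivided according to $h$ if $\mathcal{S}_h[a,b]=\emptyset$ whenever there is a height level $c$ with $a<c<b$. Reeb complex: $p\mapsto \mathrm{H}_q((\mathcal{S}_h)_p)$ is a simplicial vector space, and $\mathcal{G}_q$ is the chain complex with $(\mathcal{G}_q)_p=\mathrm{H}_q((\mathcal{S}_h)_p)$ modulo the span of degenerate elements (images of the $\mathrm{H}_qs^h_j$), with differential induced by $\sum_i(-1)^i\mathrm{H}_qd_i^h$; explicitly $(\mathcal{G}_q)_p\cong\bigoplus \mathrm{H}_q\mathcal{S}_h[\bar a]$ over strictly increasing $\bar a=(a_0,\dots,a_p)$. *)

theory Defs
  imports "HOL-Algebra.AbelCoset" "Jordan_Normal_Form.VS_Connect"
begin

section \<open>Simplicial sets\<close>

text \<open>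
  A monotone map \<open>[m] \<rightarrow> [n]\<close> is encoded by the list of its \<open>m + 1\<close> values. With this encoding
  \<open>op_comp a \<theta>\<close> is \<open>a \<circ> \<theta>\<close>, where \<open>a\<close> is again a list of values, possibly in another poset.
\<close>

definition ops :: "nat \<Rightarrow> nat \<Rightarrow> nat list set" where
  "ops m n = {\<theta>. length \<theta> = Suc m \<and> sorted \<theta> \<and> set \<theta> \<subseteq> {..n}}"

definition op_id :: "nat \<Rightarrow> nat list" where
  "op_id n = [0..<Suc n]"

definition op_comp :: "'a list \<Rightarrow> nat list \<Rightarrow> 'a list" where
  "op_comp a \<theta> = map (\<lambda>i. a ! i) \<theta>"

text \<open>\<open>coface n i\<close> is \<open>\<delta>\<^sup>i : [n] \<rightarrow> [n + 1]\<close> (\<open>i \<le> n + 1\<close>) and \<open>codegen n j\<close> is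
  \<open>\<sigma>\<^sup>j : [n + 1] \<rightarrow> [n]\<close> (\<open>j \<le> n\<close>).\<close>

definition coface :: "nat \<Rightarrow> nat \<Rightarrow> nat list" where
  "coface n i = map (\<lambda>k. if k < i then k else Suc k) [0..<Suc n]"

definition codegen :: "nat \<Rightarrow> nat \<Rightarrow> nat list" where
  "codegen n j = map (\<lambda>k. if k \<le> j then k else k - 1) [0..<Suc (Suc n)]"

text \<open>\<open>act X n x \<theta>\<close> is the value at \<open>x \<in> X\<^sub>n\<close> of the structure map \<open>X\<^sub>n \<rightarrow> X\<^sub>m\<close> belonging to
  \<open>\<theta> : [m] \<rightarrow> [n]\<close>. The dimension \<open>n\<close> is an argument because the sets \<open>X\<^sub>n\<close> may overlap.\<close>

record 'x sset =
  simplices :: "nat \<Rightarrow> 'x set"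
  act :: "nat \<Rightarrow> 'x \<Rightarrow> nat list \<Rightarrow> 'x"

definition simplicial_set :: "'x sset \<Rightarrow> bool" where
  "simplicial_set X \<longleftrightarrow>
    (\<forall>m n. \<forall>\<theta>\<in>ops m n. \<forall>x\<in>simplices X n. act X n x \<theta> \<in> simplices X m) \<and>
    (\<forall>n. \<forall>x\<in>simplices X n. act X n x (op_id n) = x) \<and>
    (\<forall>l m n. \<forall>\<theta>\<in>ops m n. \<forall>\<phi>\<in>ops l m. \<forall>x\<in>simplices X n.
       act X m (act X n x \<theta>) \<phi> = act X n x (op_comp \<theta> \<phi>))"

text \<open>Each component is taken to be extensional, so that a simplicial map has exactly one
  representative and sets of simplicial maps can serve as sets of simplices.\<close>

definition simplicial_maps :: "'x sset \<Rightarrow> 'y sset \<Rightarrow> (nat \<Rightarrow> 'x \<Rightarrow> 'y) set" where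
  "simplicial_maps X Y =
    {f. (\<forall>n. f n \<in> simplices X n \<rightarrow>\<^sub>E simplices Y n) \<and>
        (\<forall>m n. \<forall>\<theta>\<in>ops m n. \<forall>x\<in>simplices X n. f m (act X n x \<theta>) = act Y n (f n x) \<theta>)}"

definition nerve :: "'a::linorder set \<Rightarrow> 'a list sset" where
  "nerve A = \<lparr>simplices = (\<lambda>n. {a. length a = Suc n \<and> sorted a \<and> set a \<subseteq> A}),
              act = (\<lambda>n. op_comp)\<rparr>"

definition std_simplex :: "nat \<Rightarrow> nat list sset" where
  "std_simplex p = nerve {..p}"

definition real_line :: "real list sset" where
  "real_line = nerve UNIV"

definition sset_prod :: "'x sset \<Rightarrow> 'y sset \<Rightarrow> ('x \<times> 'y) sset" where
  "sset_prod X Y =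
    \<lparr>simplices = (\<lambda>n. simplices X n \<times> simplices Y n),
     act = (\<lambda>n (x, y) \<theta>. (act X n x \<theta>, act Y n y \<theta>))\<rparr>"

definition sset_coprod :: "'i set \<Rightarrow> ('i \<Rightarrow> 'x sset) \<Rightarrow> ('i \<times> 'x) sset" where
  "sset_coprod I F =
    \<lparr>simplices = (\<lambda>n. SIGMA i:I. simplices (F i) n),
     act = (\<lambda>n (i, x) \<theta>. (i, act (F i) n x \<theta>))\<rparr>"


section \<open>Height functions and section spaces\<close>

definition height_function :: "'x sset \<Rightarrow> (nat \<Rightarrow> 'x \<Rightarrow> real list) \<Rightarrow> bool" where
  "height_function X h \<longleftrightarrow> h \<in> simplicial_maps X real_line"

definition height_levels :: "'x sset \<Rightarrow> (nat \<Rightarrow> 'x \<Rightarrow> real list) \<Rightarrow> real set" where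
  "height_levels X h = {c. [c] \<in> h 0 ` simplices X 0}"

type_synonym 'x prism = "nat \<Rightarrow> nat list \<times> nat list \<Rightarrow> 'x"

abbreviation prism_dom :: "nat \<Rightarrow> nat \<Rightarrow> (nat list \<times> nat list) sset" where
  "prism_dom p q \<equiv> sset_prod (std_simplex p) (std_simplex q)"

text \<open>\<open>precomp p' q' \<alpha> \<beta> \<rho>\<close> is \<open>\<rho> \<circ> (\<alpha> \<times> \<beta>)\<close> for \<open>\<alpha> : [p'] \<rightarrow> [p]\<close>, \<open>\<beta> : [q'] \<rightarrow> [q]\<close> and
  \<open>\<rho> : \<Delta>\<^sup>p \<times> \<Delta>\<^sup>q \<rightarrow> X\<close>.\<close>

definition precomp :: "nat \<Rightarrow> nat \<Rightarrow> nat list \<Rightarrow> nat list \<Rightarrow> 'x prism \<Rightarrow> 'x prism" where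
  "precomp p' q' \<alpha> \<beta> \<rho> =
    (\<lambda>n. \<lambda>(\<theta>, \<phi>)\<in>simplices (prism_dom p' q') n. \<rho> n (op_comp \<alpha> \<theta>, op_comp \<beta> \<phi>))"

definition section_space ::
    "'x sset \<Rightarrow> (nat \<Rightarrow> 'x \<Rightarrow> real list) \<Rightarrow> real list \<Rightarrow> 'x prism sset" where
  "section_space X h a = (let p = length a - 1 in
    \<lparr>simplices = (\<lambda>q. {\<rho> \<in> simplicial_maps (prism_dom p q) X.
        \<forall>n. \<forall>(\<theta>, \<phi>)\<in>simplices (prism_dom p q) n. h n (\<rho> n (\<theta>, \<phi>)) = op_comp a \<theta>}),
     act = (\<lambda>q \<rho> \<beta>. precomp p (length \<beta> - 1) (op_id p) \<beta> \<rho>)\<rparr>)"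

text \<open>The simplicial set \<open>(\<S>\<^sub>h)\<^sub>p\<close>, and the map \<open>(\<S>\<^sub>h)\<^sub>p \<rightarrow> (\<S>\<^sub>h)\<^sub>p\<^sub>'\<close> given by a monotone map
  \<open>\<alpha> : [p'] \<rightarrow> [p]\<close>.\<close>

definition sections ::
    "'x sset \<Rightarrow> (nat \<Rightarrow> 'x \<Rightarrow> real list) \<Rightarrow> nat \<Rightarrow> (real list \<times> 'x prism) sset" where
  "sections X h p = sset_coprod (simplices real_line p) (section_space X h)"

definition hor_op :: "nat list \<Rightarrow> nat \<Rightarrow> real list \<times> 'x prism \<Rightarrow> real list \<times> 'x prism" where
  "hor_op \<alpha> = (\<lambda>q (a, \<rho>). (op_comp a \<alpha>, precomp (length \<alpha> - 1) q \<alpha> (op_id q) \<rho>))"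

definition subdivided :: "'x sset \<Rightarrow> (nat \<Rightarrow> 'x \<Rightarrow> real list) \<Rightarrow> bool" where
  "subdivided X h \<longleftrightarrow>
    (\<forall>a b. (\<exists>c\<in>height_levels X h. a < c \<and> c < b) \<longrightarrow>
       (\<forall>q. simplices (section_space X h [a, b]) q = {}))"


section \<open>Vector spaces and chain complexes\<close>

text \<open>Vector spaces are modules over \<open>class_ring :: 'k ring\<close> for \<open>'k::field\<close>. The ring
  multiplication and unit in the record of a module carry no meaning.\<close>

definition free_mod :: "'x set \<Rightarrow> ('k::field, 'x \<Rightarrow> 'k) module" where
  "free_mod S =
    \<lparr>carrier = {c. finite {x. c x \<noteq> 0} \<and> {x. c x \<noteq> 0} \<subseteq> S},
     mult = undefined, one = undefined,
     zero = (\<lambda>_. 0),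
     add = (\<lambda>c d x. c x + d x),
     smult = (\<lambda>r c x. r * c x)\<rparr>"

definition pushforward :: "('x \<Rightarrow> 'y) \<Rightarrow> ('x \<Rightarrow> 'k::field) \<Rightarrow> 'y \<Rightarrow> 'k" where
  "pushforward f c = (\<lambda>y. \<Sum>x | c x \<noteq> 0 \<and> f x = y. c x)"

text \<open>The quotient by a submodule \<open>N\<close>. The union in \<open>smult\<close> and in \<open>quot_map\<close> is over
  representatives of one coset and is itself a single coset whenever the operation descends.\<close>

definition quot_mod :: "('k, 'v) module \<Rightarrow> 'v set \<Rightarrow> ('k, 'v set) module" where
  "quot_mod M N =
    \<lparr>carrier = a_rcosets\<^bsub>M\<^esub> N,
     mult = undefined, one = undefined,
     zero = N,
     add = set_add M,
     smult = (\<lambda>r A. \<Union>v\<in>A. N +>\<^bsub>M\<^esub> (r \<odot>\<^bsub>M\<^esub> v))\<rparr>"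

definition quot_map :: "('k, 'w) module \<Rightarrow> 'w set \<Rightarrow> ('v \<Rightarrow> 'w) \<Rightarrow> 'v set \<Rightarrow> 'w set" where
  "quot_map M N f A = (\<Union>v\<in>A. N +>\<^bsub>M\<^esub> f v)"

definition dir_sum :: "'i set \<Rightarrow> ('i \<Rightarrow> ('k, 'v) module) \<Rightarrow> ('k, 'i \<Rightarrow> 'v) module" where
  "dir_sum I M =
    \<lparr>carrier = {f \<in> (\<Pi>\<^sub>E i\<in>I. carrier (M i)). finite {i \<in> I. f i \<noteq> \<zero>\<^bsub>M i\<^esub>}},
     mult = undefined, one = undefined,
     zero = (\<lambda>i\<in>I. \<zero>\<^bsub>M i\<^esub>),
     add = (\<lambda>f g. \<lambda>i\<in>I. f i \<oplus>\<^bsub>M i\<^esub> g i),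
     smult = (\<lambda>r f. \<lambda>i\<in>I. r \<odot>\<^bsub>M i\<^esub> f i)\<rparr>"

definition mod_iso :: "'k ring \<Rightarrow> ('k, 'v) module \<Rightarrow> ('k, 'w) module \<Rightarrow> bool" where
  "mod_iso K M N \<longleftrightarrow>
    (\<exists>f \<in> LinearCombinations.module_hom K M N. bij_betw f (carrier M) (carrier N))"

text \<open>\<open>bd C n\<close> is the differential \<open>C\<^sub>n\<^sub>+\<^sub>1 \<rightarrow> C\<^sub>n\<close>; complexes vanish in negative degrees.\<close>

record ('k, 'v) ch_complex =
  ch :: "nat \<Rightarrow> ('k, 'v) module"
  bd :: "nat \<Rightarrow> 'v \<Rightarrow> 'v"

fun cycles :: "('k, 'v) ch_complex \<Rightarrow> nat \<Rightarrow> 'v set" where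
  "cycles C 0 = carrier (ch C 0)"
| "cycles C (Suc n) = {c \<in> carrier (ch C (Suc n)). bd C n c = \<zero>\<^bsub>ch C n\<^esub>}"

definition boundaries :: "('k, 'v) ch_complex \<Rightarrow> nat \<Rightarrow> 'v set" where
  "boundaries C n = bd C n ` carrier (ch C (Suc n))"

definition homology :: "('k, 'v) ch_complex \<Rightarrow> nat \<Rightarrow> ('k, 'v set) module" where
  "homology C n = quot_mod ((ch C n)\<lparr>carrier := cycles C n\<rparr>) (boundaries C n)"

definition alt_sum ::
    "('k::field, 'w) module \<Rightarrow> (nat \<Rightarrow> 'v \<Rightarrow> 'w) \<Rightarrow> nat \<Rightarrow> 'v \<Rightarrow> 'w" where
  "alt_sum M d n v = (\<Oplus>\<^bsub>M\<^esub>i\<in>{..n}. ((-1) ^ i) \<odot>\<^bsub>M\<^esub> d i v)"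

definition chains :: "'x sset \<Rightarrow> ('k::field, 'x \<Rightarrow> 'k) ch_complex" where
  "chains X =
    \<lparr>ch = (\<lambda>n. free_mod (simplices X n)),
     bd = (\<lambda>n. alt_sum (free_mod (simplices X n))
        (\<lambda>i. pushforward (\<lambda>x. act X (Suc n) x (coface n i))) (Suc n))\<rparr>"

abbreviation sset_homology :: "'x sset \<Rightarrow> nat \<Rightarrow> ('k::field, ('x \<Rightarrow> 'k) set) module" where
  "sset_homology X n \<equiv> homology (chains X) n"

definition homology_map ::
    "'y sset \<Rightarrow> (nat \<Rightarrow> 'x \<Rightarrow> 'y) \<Rightarrow> nat \<Rightarrow> ('x \<Rightarrow> 'k::field) set \<Rightarrow> ('y \<Rightarrow> 'k) set" where
  "homology_map Y f q =
    quot_map (ch (chains Y) q) (boundaries (chains Y) q) (pushforward (f q))"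


section \<open>The Reeb complexes\<close>

definition degenerate_span ::
    "'x sset \<Rightarrow> (nat \<Rightarrow> 'x \<Rightarrow> real list) \<Rightarrow> nat \<Rightarrow> nat \<Rightarrow>
      (real list \<times> 'x prism \<Rightarrow> 'k::field) set set" where
  "degenerate_span X h q p =
    LinearCombinations.module.span class_ring (sset_homology (sections X h p) q)
      (\<Union>j<p. homology_map (sections X h p) (hor_op (codegen (p - 1) j)) q `
                carrier (sset_homology (sections X h (p - 1)) q))"

definition reeb_complex ::
    "'x sset \<Rightarrow> (nat \<Rightarrow> 'x \<Rightarrow> real list) \<Rightarrow> nat \<Rightarrow>
      ('k::field, (real list \<times> 'x prism \<Rightarrow> 'k) set set) ch_complex" where
  "reeb_complex X h q =
    \<lparr>ch = (\<lambda>p. quot_mod (sset_homology (sections X h p) q) (degenerate_span X h q p)),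
     bd = (\<lambda>p. quot_map (sset_homology (sections X h p) q) (degenerate_span X h q p)
        (alt_sum (sset_homology (sections X h p) q)
          (\<lambda>i. homology_map (sections X h p) (hor_op (coface p i)) q) (Suc p)))\<rparr>"

end

theory Submission
  imports Defs "HOL-Library.Poly_Mapping"
begin

text \<open>
  Every simplex of a subdivided \<open>X\<close> meets at most two height levels, so sequences with three distinct
  entries carry no sections. If \<open>a\<close> has a repeated entry, the identity of \<open>\<S>\<^sub>h[a]\<close> is homotopic to a
  degeneracy of a face, so all classes over \<open>a\<close> are degenerate. Hence \<open>\<G>\<^sub>q\<close> lives in degrees \<open>0\<close> and \<open>1\<close>, with
  terms the homology of the level simplices of \<open>X\<close> and of the sections over pairs \<open>a\<^sub>0 < a\<^sub>1\<close>.

  The prism operator maps the \<open>q\<close>-chains of the latter to the \<open>(q + 1)\<close>-chains of \<open>X\<close> modulo level chains. It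
  is a quasi-isomorphism by acyclic models: a simplex meeting two levels is a map from a join of two
  simplices, a section over two levels is a map from \<open>[1] \<times> [q]\<close>, and the cone of the prism operator on such
  posets over \<open>[1]\<close> has a contraction, given by adding the least element. The resulting long exact
  sequence of \<open>X\<close> modulo level chains has the connecting map \<open>d\<^sub>0 - d\<^sub>1\<close>, the differential of
  \<open>\<G>\<^sub>q\<close>, and it splits into short exact sequences of vector spaces.
\<close>

section \<open>Free vector spaces\<close>

text \<open>The obstacle is naturality. Prepending the least element contracts the cone attached to
  one model, but a morphism of models need not preserve least elements, so these contractions do not
  fit together on X. They are applied only to the universal cell of each model, corrected by the
  contraction already chosen in lower degrees; pushing the result along cells gives a contraction
  that is natural by construction. The combinatorics is done on lists of vertices, where boundary
  and prism have a recursion on the head of the list, and is carried to X by evaluating simplices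
  and sections on such lists. The prism operator anticommutes with the boundary up to its two ends.
  Each end lies in a single level, so the prism becomes the off-diagonal entry of a cone once level
  chains are divided out; restoring the ends produces the connecting map. All homology spaces are
  brought to the form of a space of chains modulo an explicit subspace. The filtration of the cycles
  of X is: boundaries, cycles homologous to level cycles, all cycles. A linear complement of the
  middle term, available over a field, splits it.\<close>

abbreviation sing :: "'x \<Rightarrow> ('x \<Rightarrow>\<^sub>0 'k::field)" where
  "sing x \<equiv> Poly_Mapping.single x 1"

definition pscale :: "'k::field \<Rightarrow> ('x \<Rightarrow>\<^sub>0 'k) \<Rightarrow> ('x \<Rightarrow>\<^sub>0 'k)" where
  "pscale r = Poly_Mapping.map ((*) r)"

text \<open>Boundaries, prisms, pushforwards and contractions are all linear extensions from a
  basis, so identities between them are checked on basis elements through \<open>lift_lift\<close>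
  and \<open>lift_cong\<close>, the latter only on the support.\<close>

definition lift :: "('x \<Rightarrow> ('y \<Rightarrow>\<^sub>0 'k)) \<Rightarrow> ('x \<Rightarrow>\<^sub>0 'k::field) \<Rightarrow> ('y \<Rightarrow>\<^sub>0 'k)" where
  "lift f p = (\<Sum>x\<in>Poly_Mapping.keys p. pscale (Poly_Mapping.lookup p x) (f x))"

lemma lookup_pscale [simp]: "Poly_Mapping.lookup (pscale r p) x = r * Poly_Mapping.lookup p x"
  by (simp add: pscale_def Poly_Mapping.map.rep_eq when_def)

interpretation pm: vector_space "pscale :: 'k::field \<Rightarrow> ('x \<Rightarrow>\<^sub>0 'k) \<Rightarrow> ('x \<Rightarrow>\<^sub>0 'k)"
  by unfold_locales (auto intro!: poly_mapping_eqI simp: lookup_add algebra_simps)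

lemma keys_pscale: "Poly_Mapping.keys (pscale r p) \<subseteq> Poly_Mapping.keys p"
  by (auto simp: in_keys_iff)

lemma lift_superset:
  assumes "finite A" "Poly_Mapping.keys p \<subseteq> A"
  shows "lift f p = (\<Sum>x\<in>A. pscale (Poly_Mapping.lookup p x) (f x))"
  unfolding lift_def using assms by (intro sum.mono_neutral_left) (auto simp: in_keys_iff)

lemma lift_add: "lift f (p + q) = lift f p + lift f q"
proof -
  let ?A = "Poly_Mapping.keys p \<union> Poly_Mapping.keys q"
  have "Poly_Mapping.keys (p + q) \<subseteq> ?A" by (rule Poly_Mapping.keys_add)
  then show ?thesis
    by (simp add: lift_superset[of ?A] lookup_add pm.scale_left_distrib sum.distrib)
qed

lemma lift_scale: "lift f (pscale r p) = pscale r (lift f p)"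
proof -
  have "lift f (pscale r p)
      = (\<Sum>x\<in>Poly_Mapping.keys p. pscale (Poly_Mapping.lookup (pscale r p) x) (f x))"
    by (rule lift_superset) (auto simp: in_keys_iff)
  then show ?thesis by (simp add: lift_def pm.scale_sum_right)
qed

lemma lift_linear: "Vector_Spaces.linear pscale pscale (lift f)"
  by unfold_locales (simp_all add: lift_add lift_scale)

interpretation lift: Vector_Spaces.linear pscale pscale "lift f"
  for f :: "'x \<Rightarrow> ('y \<Rightarrow>\<^sub>0 'k::field)"
  by (rule lift_linear)

lemmas lift_zero [simp] = lift.zero
lemmas lift_uminus = lift.neg
lemmas lift_diff = lift.diff
lemmas lift_sum = lift.sum

lemma lift_sing [simp]: "lift f (sing x) = f x"
  by (simp add: lift_def)

lemma lift_sing_id [simp]: "lift sing p = p"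
proof -
  have "Poly_Mapping.lookup (lift sing p) y = Poly_Mapping.lookup p y" for y
  proof -
    have "Poly_Mapping.lookup (lift sing p) y
        = (\<Sum>x\<in>Poly_Mapping.keys p. if x = y then Poly_Mapping.lookup p y else 0)"
      unfolding lift_def lookup_sum
      by (intro sum.cong) (auto simp: lookup_single when_def)
    then show ?thesis by (auto simp: in_keys_iff)
  qed
  then show ?thesis by (intro poly_mapping_eqI)
qed

lemma lift_cong: "(\<And>x. x \<in> Poly_Mapping.keys p \<Longrightarrow> f x = g x) \<Longrightarrow> lift f p = lift g p"
  by (simp add: lift_def)

lemma lift_lift: "lift f (lift g p) = lift (\<lambda>x. lift f (g x)) p"
  unfolding lift_def[of g] lift_sum lift_scale by (simp only: lift_def)

lemma lift_fun_add: "lift (\<lambda>x. f x + g x) p = lift f p + lift g p"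
  by (simp add: lift_def pm.scale_right_distrib sum.distrib)

lemma lift_fun_diff: "lift (\<lambda>x. f x - g x) p = lift f p - lift g p"
  by (simp add: lift_def pm.scale_right_diff_distrib sum_subtractf)

lemma lift_fun_zero [simp]: "lift (\<lambda>x. 0) p = 0"
  by (simp add: lift_def)

lemma lift_fun_scale: "lift (\<lambda>x. pscale r (f x)) p = pscale r (lift f p)"
  by (simp add: lift_def pm.scale_sum_right mult.commute)

lemma lift_fun_sum: "lift (\<lambda>x. \<Sum>i\<in>I. f i x) p = (\<Sum>i\<in>I. lift (f i) p)"
  by (induction I rule: infinite_finite_induct) (auto simp: lift_fun_add)

lemma keys_lift: "Poly_Mapping.keys (lift f p) \<subseteq> (\<Union>x\<in>Poly_Mapping.keys p. Poly_Mapping.keys (f x))"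
proof
  fix y assume "y \<in> Poly_Mapping.keys (lift f p)"
  then have "(\<Sum>x\<in>Poly_Mapping.keys p. Poly_Mapping.lookup p x * Poly_Mapping.lookup (f x) y) \<noteq> 0"
    by (simp add: in_keys_iff lift_def lookup_sum)
  then obtain x where "x \<in> Poly_Mapping.keys p" "Poly_Mapping.lookup p x * Poly_Mapping.lookup (f x) y \<noteq> 0"
    by (meson sum.neutral)
  then show "y \<in> (\<Union>x\<in>Poly_Mapping.keys p. Poly_Mapping.keys (f x))"
    by (auto simp: in_keys_iff)
qed

lemma in_keys_lift:
  assumes "y \<in> Poly_Mapping.keys (lift f p)"
  obtains x where "x \<in> Poly_Mapping.keys p" "y \<in> Poly_Mapping.keys (f x)"
  using assms keys_lift[of f p] by blast

lemma keys_lift_subset: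
  assumes "\<And>x. x \<in> Poly_Mapping.keys p \<Longrightarrow> Poly_Mapping.keys (f x) \<subseteq> A"
  shows "Poly_Mapping.keys (lift f p) \<subseteq> A"
  using keys_lift[of f p] assms by blast

lemma keys_sum_subset:
  assumes "\<And>i. i \<in> I \<Longrightarrow> Poly_Mapping.keys (f i) \<subseteq> A"
  shows "Poly_Mapping.keys (\<Sum>i\<in>I. f i) \<subseteq> A"
  using assms
proof (induction I rule: infinite_finite_induct)
  case (insert i I)
  then show ?case using Poly_Mapping.keys_add[of "f i" "sum f I"] by (simp, blast)
qed auto

lemma keys_add_subset:
  "Poly_Mapping.keys p \<subseteq> A \<Longrightarrow> Poly_Mapping.keys q \<subseteq> A \<Longrightarrow> Poly_Mapping.keys (p + q) \<subseteq> A"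
  using Poly_Mapping.keys_add[of p q] by blast

lemma keys_diff_subset:
  fixes p q :: "'x \<Rightarrow>\<^sub>0 'k::field"
  shows "Poly_Mapping.keys p \<subseteq> A \<Longrightarrow> Poly_Mapping.keys q \<subseteq> A \<Longrightarrow> Poly_Mapping.keys (p - q) \<subseteq> A"
  using Poly_Mapping.keys_diff[of p q] by blast

lemma keys_pscale_subset:
  "Poly_Mapping.keys p \<subseteq> A \<Longrightarrow> Poly_Mapping.keys (pscale r p) \<subseteq> A"
  using keys_pscale[of r p] by blast

abbreviation chain_set :: "'x set \<Rightarrow> ('x \<Rightarrow>\<^sub>0 'k::field) set" where
  "chain_set S \<equiv> {p. Poly_Mapping.keys p \<subseteq> S}"

lemma subspace_chain_set: "pm.subspace (chain_set S)"
  unfolding pm.subspace_def by (simp add: keys_add_subset keys_pscale_subset)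


section \<open>The prism operator on lists\<close>

definition rmn :: "nat \<Rightarrow> 'v list \<Rightarrow> 'v list" where
  "rmn i l = take i l @ drop (Suc i) l"

text \<open>The augmented boundary: a list with one entry goes to the empty list. The augmentation
  gives the head recursion \<open>bdl_Cons\<close> without a special case; \<open>embT\<close> and
  \<open>embQ\<close> later discard the empty list.\<close>

definition bdl :: "'v list \<Rightarrow> ('v list \<Rightarrow>\<^sub>0 'k::field)" where
  "bdl l = (\<Sum>i<length l. pscale ((-1) ^ i) (sing (rmn i l)))"

abbreviation consl :: "'v \<Rightarrow> ('v list \<Rightarrow>\<^sub>0 'k::field) \<Rightarrow> ('v list \<Rightarrow>\<^sub>0 'k)" where
  "consl x \<equiv> lift (\<lambda>w. sing (x # w))"

lemma bdl_Nil [simp]: "bdl [] = 0"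
  by (simp add: bdl_def)

text \<open>The boundary of a cone: deleting the apex leaves \<open>l\<close>, every other deletion
  keeps the apex and is shifted by one place, hence the sign.\<close>

lemma bdl_Cons [simp]: "bdl (x # l) = sing l - consl x (bdl l)"
proof -
  have "bdl (x # l) = sing l + (\<Sum>i<length l. pscale ((-1) ^ Suc i) (sing (x # rmn i l)))"
    unfolding bdl_def length_Cons sum.lessThan_Suc_shift by (simp add: rmn_def)
  also have "(\<Sum>i<length l. pscale ((-1) ^ Suc i) (sing (x # rmn i l))) = - consl x (bdl l)"
    by (simp add: bdl_def lift_sum lift_scale sum_negf)
  finally show ?thesis by simp
qed

lemma keys_bdl: "Poly_Mapping.keys (bdl l :: 'v list \<Rightarrow>\<^sub>0 'k::field) \<subseteq> (\<lambda>i. rmn i l) ` {..<length l}"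
  unfolding bdl_def by (intro keys_sum_subset keys_pscale_subset) auto

lemma bdl_map: "bdl (map f l) = lift (\<lambda>w. sing (map f w)) (bdl l)"
  by (induction l) (simp_all add: lift_diff lift_lift)

text \<open>Prepending a fixed vertex is a contracting homotopy of the augmented complex.\<close>

lemma bdl_consl: "lift bdl (consl x p) = p - consl x (lift bdl p)"
proof -
  have "lift bdl (consl x p) = lift (\<lambda>w. sing w - consl x (bdl w)) p"
    by (simp add: lift_lift)
  then show ?thesis by (simp only: lift_fun_diff lift_lift[symmetric] lift_sing_id)
qed

lemma bdl_bdl: "lift bdl (bdl l) = 0"
  by (induction l) (simp_all add: lift_diff bdl_consl)

abbreviation upper :: "('a \<times> 'b) list \<Rightarrow> (nat \<times> 'b) list" where
  "upper \<equiv> map (\<lambda>(a, b). (Suc 0, b))"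

abbreviation lower :: "('a \<times> 'b) list \<Rightarrow> (nat \<times> 'a) list" where
  "lower \<equiv> map (\<lambda>(a, b). (0, a))"

text \<open>The recursion produces the usual triangulation of a prism, the alternating sum over
  \<open>k\<close> of \<open>lower (take (Suc k) u) @ upper (drop k u)\<close>: the first summand is
  \<open>k = 0\<close>, all others share the vertex \<open>(0, a)\<close>. A pair holds the lower
  and the upper image of one vertex, so the two ends may be different maps.\<close>

fun prisml :: "('a \<times> 'a) list \<Rightarrow> ((nat \<times> 'a) list \<Rightarrow>\<^sub>0 'k::field)" where
  "prisml [] = 0"
| "prisml ((a, b) # u) = sing ((0, a) # (Suc 0, b) # upper u) - consl (0, a) (prisml u)"

lemma keys_prism:
  "Poly_Mapping.keys (prisml u :: _ \<Rightarrow>\<^sub>0 'k::field)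
    \<subseteq> (\<lambda>k. lower (take (Suc k) u) @ upper (drop k u)) ` {..<length u}"
proof (induction u rule: prisml.induct)
  case (2 a b u)
  show ?case unfolding prisml.simps
  proof (intro keys_diff_subset)
    show "Poly_Mapping.keys (sing ((0, a) # (Suc 0, b) # upper u) :: _ \<Rightarrow>\<^sub>0 'k)
      \<subseteq> (\<lambda>k. lower (take (Suc k) ((a, b) # u)) @ upper (drop k ((a, b) # u))) ` {..<length ((a, b) # u)}"
      by (auto intro!: image_eqI[of _ _ 0])
    show "Poly_Mapping.keys (consl (0, a) (prisml u) :: _ \<Rightarrow>\<^sub>0 'k)
      \<subseteq> (\<lambda>k. lower (take (Suc k) ((a, b) # u)) @ upper (drop k ((a, b) # u))) ` {..<length ((a, b) # u)}"
    proof (rule keys_lift_subset)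
      fix w assume "w \<in> Poly_Mapping.keys (prisml u :: _ \<Rightarrow>\<^sub>0 'k)"
      then obtain k where "k < length u" "w = lower (take (Suc k) u) @ upper (drop k u)"
        using 2 by auto
      then show "Poly_Mapping.keys (sing ((0, a) # w) :: _ \<Rightarrow>\<^sub>0 'k)
        \<subseteq> (\<lambda>k. lower (take (Suc k) ((a, b) # u)) @ upper (drop k ((a, b) # u))) ` {..<length ((a, b) # u)}"
        by (auto intro!: image_eqI[of _ _ "Suc k"])
    qed
  qed
qed simp

lemma prism_map:
  "prisml (map (\<lambda>(a, b). (f a, g b)) u)
    = lift (\<lambda>w. sing (map (\<lambda>(e, v). (e, if e = 0 then f v else g v)) w)) (prisml u)"
  by (induction u rule: prisml.induct)
    (simp_all add: lift_diff lift_lift comp_def split_def)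

lemma prism_consl:
  "lift prisml (consl (a, b) p)
    = lift (\<lambda>w. sing ((0, a) # (Suc 0, b) # upper w)) p - consl (0, a) (lift prisml p)"
proof -
  have "lift prisml (consl (a, b) p)
      = lift (\<lambda>w. sing ((0, a) # (Suc 0, b) # upper w) - consl (0, a) (prisml w)) p"
    by (simp add: lift_lift)
  then show ?thesis by (simp only: lift_fun_diff lift_lift[symmetric])
qed

text \<open>In the induction the vertex \<open>(0, a)\<close> is coned off; the upper end of the
  shorter prism then cancels against the inner face \<open>(0, a) # upper u\<close> of the first
  summand.\<close>

lemma prism_bdl:
  "lift bdl (prisml u) + lift prisml (bdl u)
    = (sing (upper u) - sing (lower u) :: (nat \<times> 'a) list \<Rightarrow>\<^sub>0 'k::field)"
proof (induction u rule: prisml.induct)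
  case (2 a b u)
  have eq: "lift (\<lambda>w. sing ((0, a) # (Suc 0, b) # upper w)) (bdl u)
      = (consl (0, a) (consl (Suc 0, b) (bdl (upper u))) :: _ \<Rightarrow>\<^sub>0 'k)"
    by (simp add: lift_lift bdl_map)
  have "lift bdl (prisml ((a, b) # u)) + lift prisml (bdl ((a, b) # u))
    = sing (upper ((a, b) # u)) - consl (0, a) (sing (upper u))
      + consl (0, a) (lift bdl (prisml u) + lift prisml (bdl u) :: _ \<Rightarrow>\<^sub>0 'k)"
    by (simp add: lift_diff bdl_consl prism_consl eq lift_add)
  also have "\<dots> = sing (upper ((a, b) # u)) - sing (lower ((a, b) # u))"
    unfolding 2 by (simp add: lift_diff)
  finally show ?case .
qed simp


section \<open>Cells and their contraction\<close>

text \<open>Basis of the cone of the prism operator. \<open>TC u\<close> has degree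
  \<open>length u\<close>, one more than the dimension of the base of the prism, and
  \<open>QC l\<close> has degree \<open>length l - 2\<close>, one less than the dimension of the
  simplex; so boundary and prism both lower the degree by one.\<close>

datatype cell = TC "(nat \<times> nat) list" | QC "(nat \<times> nat) list"

definition mixed :: "(nat \<times> 'a) list \<Rightarrow> bool" where
  "mixed l \<longleftrightarrow> 0 \<in> fst ` set l \<and> Suc 0 \<in> fst ` set l"

text \<open>Passage to the quotient by lists in a single level. The empty list created by the
  augmentation is among the unmixed ones and disappears as well.\<close>

abbreviation embQ :: "((nat \<times> nat) list \<Rightarrow>\<^sub>0 'k::field) \<Rightarrow> (cell \<Rightarrow>\<^sub>0 'k)" where
  "embQ \<equiv> lift (\<lambda>l. if mixed l then sing (QC l) else 0)"

abbreviation embT :: "((nat \<times> nat) list \<Rightarrow>\<^sub>0 'k::field) \<Rightarrow> (cell \<Rightarrow>\<^sub>0 'k)" where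
  "embT \<equiv> lift (\<lambda>u. if u = [] then 0 else sing (TC u))"

text \<open>A cone usually carries a sign on one summand. Here \<open>prism_bdl\<close> already
  states anticommutation up to \<open>upper u\<close> and \<open>lower u\<close>, which are unmixed
  and vanish in the quotient.\<close>

fun bdc :: "cell \<Rightarrow> (cell \<Rightarrow>\<^sub>0 'k::field)" where
  "bdc (TC u) = embT (bdl u) + embQ (prisml u)"
| "bdc (QC l) = embQ (bdl l)"

lemma mixed_rmn: "mixed (rmn i l) \<Longrightarrow> mixed l"
  unfolding mixed_def rmn_def by (auto dest: in_set_takeD in_set_dropD)

text \<open>Deleting an entry cannot make a list mixed: single-level lists are closed under the
  boundary.\<close>

lemma embQ_bdl_unmixed: "\<not> mixed l \<Longrightarrow> embQ (bdl l) = 0"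
  by (subst lift_cong[where g = "\<lambda>_. 0"]) (use keys_bdl mixed_rmn in \<open>fastforce+\<close>)

lemma bdc_embQ: "lift bdc (embQ p) = embQ (lift bdl p)"
  unfolding lift_lift by (rule lift_cong) (simp add: embQ_bdl_unmixed)

lemma bdc_embT: "lift bdc (embT p) = embT (lift bdl p) + embQ (lift prisml p)"
  unfolding lift_lift lift_fun_add[symmetric] by (rule lift_cong) simp

lemma bdc_bdc: "lift bdc (bdc c) = 0"
proof (cases c)
  case (TC u)
  have "embQ (lift prisml (bdl u)) + embQ (lift bdl (prisml u)) = embQ (sing (upper u) - sing (lower u))"
    by (simp only: lift_add[symmetric] prism_bdl[symmetric] add.commute)
  also have "\<dots> = 0"
    unfolding lift_diff lift_sing by (auto simp: mixed_def)
  finally show ?thesis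
    by (simp add: TC lift_add bdc_embQ bdc_embT bdl_bdl add.assoc)
next
  case (QC l)
  then show ?thesis by (simp add: bdc_embQ bdl_bdl)
qed

text \<open>Prepending \<open>(0, 0)\<close> to a list leaves an error exactly when
  \<open>(0, a)\<close> is its only entry in level 0: deleting \<open>(0, a)\<close> from the
  enlarged list gives \<open>(0, 0) # (Suc 0, b) # l\<close>, whereas deleting it from the original
  list gives an unmixed one, that is zero. The second summand has this error in its boundary. For a
  list of two entries that summand leaves \<open>[(0, 0), (Suc 0, 0)]\<close>, which is the boundary
  of \<open>TC [(0, 0)]\<close>.\<close>

fun contr :: "cell \<Rightarrow> (cell \<Rightarrow>\<^sub>0 'k::field)" where
  "contr (TC u) = sing (TC ((0, 0) # u))"
| "contr (QC ((0, a) # (Suc 0, b) # l)) = sing (QC ((0, 0) # (0, a) # (Suc 0, b) # l))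
    - sing (QC ((0, 0) # (Suc 0, 0) # (Suc 0, b) # l)) + (if l = [] then sing (TC [(0, 0)]) else 0)"
| "contr (QC l) = sing (QC ((0, 0) # l))"

lemma keys_bdl_length: "w \<in> Poly_Mapping.keys (bdl l :: _ \<Rightarrow>\<^sub>0 'k::field) \<Longrightarrow> Suc (length w) = length l"
  using keys_bdl[of l] by (fastforce simp: rmn_def)

text \<open>All summands of a prism start in level 0. With one more vertex of level 0 in front they
  have two, so \<open>contr\<close> merely prepends \<open>(0, 0)\<close>.\<close>

lemma contr_consl_prism:
  "lift contr (embQ (consl (0, a) (prisml v)))
    = (embQ (consl (0, 0) (consl (0, a) (prisml v))) :: cell \<Rightarrow>\<^sub>0 'k::field)"
proof -
  have *: "lift contr (embQ (sing ((0, a) # w))) = (embQ (sing ((0, 0) # (0, a) # w)) :: cell \<Rightarrow>\<^sub>0 'k)"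
    if w: "w \<in> Poly_Mapping.keys (prisml v :: _ \<Rightarrow>\<^sub>0 'k)" for w
  proof -
    obtain a' w' where "w = (0, a') # w'"
      using w keys_prism[of v] by (cases v) (fastforce simp: split_def)+
    then show ?thesis by (simp add: mixed_def)
  qed
  have "(lift contr (embQ (consl (0, a) (prisml v))) :: cell \<Rightarrow>\<^sub>0 'k)
      = lift (\<lambda>w. lift contr (embQ (sing ((0, a) # w)))) (prisml v)"
    by (simp only: lift_lift)
  also have "\<dots> = lift (\<lambda>w. embQ (sing ((0, 0) # (0, a) # w))) (prisml v)"
    by (rule lift_cong) (rule *)
  also have "\<dots> = embQ (consl (0, 0) (consl (0, a) (prisml v)))"
    by (simp only: lift_lift lift_sing)
  finally show ?thesis .
qed

lemma contr_TC:
  assumes "u \<noteq> []"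
  shows "lift bdc (contr (TC u)) + lift contr (bdc (TC u)) = (sing (TC u) :: cell \<Rightarrow>\<^sub>0 'k::field)"
proof -
  obtain a b v where u: "u = (a, b) # v" using assms by (cases u) auto
  \<comment> \<open>If \<open>u\<close> is a single pair, its boundary contains the empty list;
    \<open>embT\<close> kills it before \<open>(0, 0)\<close> is prepended but not afterwards.
    \<open>E\<close> is this discrepancy; it cancels the \<open>TC [(0, 0)]\<close> that
    \<open>contr\<close> adds on the prism.\<close>
  define E :: "cell \<Rightarrow>\<^sub>0 'k" where "E = lift (\<lambda>w. if w = [] then sing (TC [(0, 0)]) else 0) (bdl u)"
  have E: "E = (if v = [] then sing (TC [(0, 0)]) else 0)"
  proof (cases v)
    case Nil
    then show ?thesis by (simp add: E_def u)
  next
    case (Cons x v')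
    have "E = lift (\<lambda>_. 0) (bdl u)" unfolding E_def
      by (rule lift_cong) (use keys_bdl_length[of _ u] Cons u in fastforce)
    then show ?thesis by (simp add: Cons)
  qed
  have T: "embT (consl (0, 0) (bdl u)) = lift contr (embT (bdl u)) + E"
    unfolding E_def lift_lift lift_fun_add[symmetric] by (rule lift_cong) simp
  \<comment> \<open>Only the first summand of the prism has a single entry in level 0. The list in
    its correction is the leading term of the prism over \<open>(0, 0) # u\<close>, with the
    opposite sign.\<close>
  have Q: "lift contr (embQ (prisml u))
      = embQ (consl (0, 0) (prisml u)) - sing (QC ((0, 0) # (Suc 0, 0) # upper u)) + E"
    unfolding u prisml.simps lift_diff contr_consl_prism E
    by (simp add: mixed_def)
  show ?thesis
    using assms by (simp add: lift_add lift_diff T Q) (simp add: mixed_def)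
qed

lemma contr_QC:
  assumes "l \<noteq> []" "fst (hd l) = 0" "mixed l" "sorted (map fst l)" "fst ` set l \<subseteq> {0, 1}"
  shows "lift bdc (contr (QC l)) + lift contr (bdc (QC l)) = (sing (QC l) :: cell \<Rightarrow>\<^sub>0 'k::field)"
proof -
  obtain a x r where l: "l = (0, a) # x # r"
    using assms by (cases l; cases "tl l") (auto simp: mixed_def)
  \<comment> \<open>Tags increase along \<open>l\<close>, so the second entry shows whether
    \<open>(0, a)\<close> is the only one in level 0.\<close>
  consider a' where "x = (0, a')" | b where "x = (Suc 0, b)"
    using assms(5) l by (cases x) auto
  then show ?thesis
  proof cases
    case x: 1
    have mr: "Suc 0 \<in> fst ` set r" using assms(3) l x by (auto simp: mixed_def)
    then have mx: "mixed ((0, c) # r)" for c by (auto simp: mixed_def)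
    have "r \<noteq> []" using mr by auto
    then obtain e y r' where r: "r = (e, y) # r'" by (cases r) auto
    have e: "e = 0 \<or> e = Suc 0" using assms(5) l r by auto
    \<comment> \<open>The corrections in \<open>contr\<close> do not depend on the value of the
      single entry in level 0, so they cancel between these two faces.\<close>
    have C: "contr (QC ((0, a') # r)) - contr (QC ((0, a) # r))
        = (sing (QC ((0, 0) # (0, a') # r)) - sing (QC ((0, 0) # (0, a) # r)) :: cell \<Rightarrow>\<^sub>0 'k)"
      using e unfolding r by auto
    have K: "lift contr (embQ (consl (0, a) (consl (0, a') (bdl r))))
        = (embQ (consl (0, 0) (consl (0, a) (consl (0, a') (bdl r)))) :: cell \<Rightarrow>\<^sub>0 'k)"
      unfolding lift_lift by (rule lift_cong) (simp add: mixed_def)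
    have mx0: "mixed ((0, 0) # (0, c) # r)" for c using mr by (auto simp: mixed_def)
    have "lift contr (bdc (QC l)) = (embQ (consl (0, 0) (bdl l)) :: cell \<Rightarrow>\<^sub>0 'k)"
      using C by (simp add: l x lift_diff lift_add K mx mx0 algebra_simps)
    then show ?thesis
      using assms(3) by (simp add: l x lift_diff del: bdl_Cons) (simp add: lift_diff)
  next
    case x: 2
    show ?thesis
    proof (cases r)
      case Nil
      then show ?thesis by (simp add: l x mixed_def lift_diff lift_add)
    next
      case (Cons y r')
      obtain c where y: "y = (Suc 0, c)"
        using assms(4,5) by (cases y) (auto simp: l x Cons)
      define B where "B = (bdl r :: _ \<Rightarrow>\<^sub>0 'k)"
      \<comment> \<open>The faces that keep \<open>(0, a)\<close> and \<open>(Suc 0, b)\<close>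
        still have one entry in level 0. Each of them carries the correction, with the
        \<open>TC\<close> term when nothing else is left in the face.\<close>
      have K: "lift contr (embQ (consl (0, a) (consl (Suc 0, b) B)))
        = embQ (consl (0, 0) (consl (0, a) (consl (Suc 0, b) B)))
          - embQ (consl (0, 0) (consl (Suc 0, 0) (consl (Suc 0, b) B)))
          + lift (\<lambda>w. if w = [] then sing (TC [(0, 0)]) else 0) B"
        unfolding lift_lift lift_fun_add[symmetric] lift_fun_diff[symmetric]
        by (rule lift_cong) (simp add: mixed_def)
      have E: "lift (\<lambda>w. if w = [] then sing (TC [(0, 0)]) else 0) B
          = (if r' = [] then sing (TC [(0, 0)]) else 0)"
      proof (cases "r' = []")
        case True
        then show ?thesis by (simp add: B_def Cons)
      next
        case False
        have "lift (\<lambda>w. if w = [] then sing (TC [(0, 0)]) else 0) B = lift (\<lambda>_. 0) B"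
          by (rule lift_cong) (use keys_bdl_length[of _ r] Cons False B_def in fastforce)
        then show ?thesis using False by simp
      qed
      have b: "(bdl l :: _ \<Rightarrow>\<^sub>0 'k) = sing ((Suc 0, b) # r) - sing ((0, a) # r) + consl (0, a) (consl (Suc 0, b) B)"
        by (simp add: l x B_def lift_diff)
      have m: "mixed ((0, a') # r)" "\<not> mixed ((Suc 0, a') # r)" for a'
        using assms(4) by (auto simp: mixed_def Cons y l x)
      have "lift contr (bdc (QC l)) = lift contr (embQ (consl (0, a) (consl (Suc 0, b) B)))
          - contr (QC ((0, a) # r))"
        by (simp add: b lift_diff lift_add m)
      moreover have "(contr (QC ((0, a) # r)) :: _ \<Rightarrow>\<^sub>0 'k) = sing (QC ((0, 0) # (0, a) # r))
          - sing (QC ((0, 0) # (Suc 0, 0) # r)) + (if r' = [] then sing (TC [(0, 0)]) else 0)"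
        by (simp add: Cons y)
      ultimately have 1: "lift contr (bdc (QC l))
        = embQ (consl (0, 0) (consl (0, a) (consl (Suc 0, b) B)))
          - embQ (consl (0, 0) (consl (Suc 0, 0) (consl (Suc 0, b) B)))
          - sing (QC ((0, 0) # (0, a) # r)) + sing (QC ((0, 0) # (Suc 0, 0) # r))"
        by (simp add: K E)
      have "(contr (QC l) :: _ \<Rightarrow>\<^sub>0 'k) = sing (QC ((0, 0) # l)) - sing (QC ((0, 0) # (Suc 0, 0) # (Suc 0, b) # r))"
        by (simp add: l x Cons)
      then have "lift bdc (contr (QC l) :: _ \<Rightarrow>\<^sub>0 'k)
          = embQ (bdl ((0, 0) # l)) - embQ (bdl ((0, 0) # (Suc 0, 0) # (Suc 0, b) # r))"
        by (simp add: lift_diff del: bdl_Cons)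
      moreover have "embQ (bdl ((0, 0) # l)) = sing (QC l) - sing (QC ((0, 0) # (Suc 0, b) # r))
          + sing (QC ((0, 0) # (0, a) # r)) - embQ (consl (0, 0) (consl (0, a) (consl (Suc 0, b) B)))"
        unfolding bdl_Cons[of _ l] b using assms(3)
        by (simp add: lift_diff lift_add) (simp add: mixed_def Cons y)
      moreover have "(embQ (bdl ((0, 0) # (Suc 0, 0) # (Suc 0, b) # r)) :: _ \<Rightarrow>\<^sub>0 'k)
        = sing (QC ((0, 0) # (Suc 0, 0) # r)) - sing (QC ((0, 0) # (Suc 0, b) # r))
          - embQ (consl (0, 0) (consl (Suc 0, 0) (consl (Suc 0, b) B)))"
        unfolding bdl_Cons B_def[symmetric] using m
        by (simp add: lift_diff) (auto simp: mixed_def Cons y)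
      ultimately show ?thesis using 1 by (simp only:) (simp add: algebra_simps)
    qed
  qed
qed


section \<open>Models and the natural contraction\<close>

text \<open>\<open>TM q\<close> stands for the poset \<open>[1] \<times> [q]\<close> and \<open>QM i j\<close> for the join of \<open>[i]\<close> and \<open>[j]\<close>, both
  as posets over \<open>[1]\<close>; an element is written as a pair of its image in \<open>[1]\<close> and its position. A cell
  of a model \<open>m\<close> is a morphism to \<open>m\<close> from another model: \<open>TC u\<close> lists the images of the pairs
  \<open>((0, k), (1, k))\<close>, and \<open>QC l\<close> lists the images of all elements.\<close>

datatype model = TM nat | QM nat nat

fun nodes :: "model \<Rightarrow> (nat \<times> nat) set" where
  "nodes (TM q) = {(e, v). (e = 0 \<or> e = Suc 0) \<and> v \<le> q}"
| "nodes (QM i j) = {(e, v). (e = 0 \<and> v \<le> i) \<or> (e = Suc 0 \<and> v \<le> j)}"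

fun mle :: "model \<Rightarrow> nat \<times> nat \<Rightarrow> nat \<times> nat \<Rightarrow> bool" where
  "mle (TM q) x y \<longleftrightarrow> fst x \<le> fst y \<and> snd x \<le> snd y"
| "mle (QM i j) x y \<longleftrightarrow> fst x < fst y \<or> fst x = fst y \<and> snd x \<le> snd y"

text \<open>Degree of the universal cell \<open>iota m\<close> in the cone; the construction of the
  contraction descends along it.\<close>

fun deg :: "model \<Rightarrow> nat" where
  "deg (TM q) = Suc q"
| "deg (QM i j) = i + j"

definition chainm :: "model \<Rightarrow> (nat \<times> nat) list \<Rightarrow> bool" where
  "chainm m l \<longleftrightarrow> set l \<subseteq> nodes m \<and> sorted_wrt (mle m) l"

text \<open>These are the order-preserving maps over \<open>[1]\<close>. For
  \<open>[1] \<times> [q]\<close> it suffices to test the two copies of \<open>[q]\<close> and the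
  edges between them. Requiring \<open>mixed\<close> makes the source of \<open>QC l\<close> a join
  of two nonempty simplices.\<close>

fun inhom :: "model \<Rightarrow> cell \<Rightarrow> bool" where
  "inhom m (TC u) \<longleftrightarrow> u \<noteq> [] \<and>
    (\<forall>(a, b)\<in>set u. (0, a) \<in> nodes m \<and> (Suc 0, b) \<in> nodes m \<and> mle m (0, a) (Suc 0, b)) \<and>
    sorted_wrt (\<lambda>x y. fst x \<le> fst y \<and> snd x \<le> snd y) u"
| "inhom m (QC l) \<longleftrightarrow> chainm m l \<and> mixed l"

abbreviation hom :: "model \<Rightarrow> cell set" where
  "hom m \<equiv> {c. inhom m c}"

definition n0 :: "(nat \<times> 'a) list \<Rightarrow> nat" where
  "n0 l = length (filter (\<lambda>x. fst x = 0) l)"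

fun src :: "cell \<Rightarrow> model" where
  "src (TC u) = TM (length u - 1)"
| "src (QC l) = QM (n0 l - 1) (length l - n0 l - 1)"

fun vm0 :: "cell \<Rightarrow> nat \<Rightarrow> nat" where
  "vm0 (TC u) v = fst (u ! v)"
| "vm0 (QC l) v = snd (l ! v)"

text \<open>In \<open>QC l\<close> the entries of level 0 come first, so position \<open>v\<close>
  of level 1 sits at offset \<open>n0 l\<close>.\<close>

fun vm1 :: "cell \<Rightarrow> nat \<Rightarrow> nat" where
  "vm1 (TC u) v = snd (u ! v)"
| "vm1 (QC l) v = snd (l ! (n0 l + v))"

definition pushl :: "('a \<Rightarrow> 'b) \<Rightarrow> ('a \<Rightarrow> 'b) \<Rightarrow> (nat \<times> 'a) list \<Rightarrow> (nat \<times> 'b) list" where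
  "pushl f g = map (\<lambda>(e, v). (e, if e = 0 then f v else g v))"

text \<open>Postcomposition, separately on the two levels. With the components of a cell it is
  composition of morphisms of models, and \<open>iota m\<close> is the identity
  (\<open>push_iota\<close>).\<close>

fun pushc :: "(nat \<Rightarrow> nat) \<Rightarrow> (nat \<Rightarrow> nat) \<Rightarrow> cell \<Rightarrow> cell" where
  "pushc f g (TC u) = TC (map (\<lambda>(a, b). (f a, g b)) u)"
| "pushc f g (QC l) = QC (pushl f g l)"

abbreviation push :: "cell \<Rightarrow> cell \<Rightarrow> cell" where
  "push c \<equiv> pushc (vm0 c) (vm1 c)"

fun iota :: "model \<Rightarrow> cell" where
  "iota (TM q) = TC (map (\<lambda>k. (k, k)) [0..<Suc q])"
| "iota (QM i j) = QC (map (Pair 0) [0..<Suc i] @ map (Pair (Suc 0)) [0..<Suc j])"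

lemma nodes_tag: "x \<in> nodes m \<Longrightarrow> fst x = 0 \<or> fst x = Suc 0"
  by (cases m) auto

lemma mle_tag: "mle m x y \<Longrightarrow> fst x \<le> fst y"
  by (cases m) auto

lemma mle_same_tag: "mle m (e, a) (e, b) \<longleftrightarrow> a \<le> b"
  by (cases m) auto

lemma mle_trans: "mle m x y \<Longrightarrow> mle m y z \<Longrightarrow> mle m x z"
  by (cases m) auto

lemma filter_append_tags:
  assumes "\<forall>x\<in>set l. fst x = 0 \<or> fst x = Suc 0" "sorted (map fst l)"
  shows "l = filter (\<lambda>x. fst x = 0) l @ filter (\<lambda>x. fst x \<noteq> 0) l"
  using assms
proof (induction l)
  case (Cons x l)
  show ?case
  proof (cases "fst x = 0")
    case False
    then have "\<forall>y\<in>set l. fst y \<noteq> 0" using Cons.prems by auto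
    then have "filter (\<lambda>x. fst x = 0) l = []" "filter (\<lambda>x. fst x \<noteq> 0) l = l"
      by (auto simp: filter_empty_conv)
    with False show ?thesis by simp
  next
    case True
    then show ?thesis using Cons by simp
  qed
qed simp

lemma tag_nth:
  assumes "\<forall>x\<in>set l. fst x = 0 \<or> fst x = Suc 0" "sorted (map fst l)" "k < length l"
  shows "fst (l ! k) = (if k < n0 l then 0 else Suc 0)"
proof -
  let ?A = "filter (\<lambda>x. fst x = 0) l" and ?B = "filter (\<lambda>x. fst x \<noteq> 0) l"
  have l: "l = ?A @ ?B" by (rule filter_append_tags) (use assms in auto)
  have k: "k < length (?A @ ?B)" using assms(3) l by metis
  have "l ! k = (?A @ ?B) ! k" using l by metis
  then have nth: "l ! k = (if k < n0 l then ?A ! k else ?B ! (k - n0 l))"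
    by (simp add: nth_append n0_def)
  show ?thesis
  proof (cases "k < n0 l")
    case True
    then have "?A ! k \<in> set ?A" by (intro nth_mem) (simp add: n0_def)
    with True nth show ?thesis by auto
  next
    case False
    then have "?B ! (k - n0 l) \<in> set ?B" using k by (intro nth_mem) (simp add: n0_def)
    then have "l ! k \<in> set l" "fst (l ! k) \<noteq> 0" using False nth by auto
    then show ?thesis using assms(1) False by auto
  qed
qed

lemma chainm_tags:
  assumes "chainm m l"
  shows "\<forall>x\<in>set l. fst x = 0 \<or> fst x = Suc 0" "sorted (map fst l)"
proof -
  show "\<forall>x\<in>set l. fst x = 0 \<or> fst x = Suc 0"
    using assms nodes_tag by (force simp: chainm_def)
  have "sorted_wrt (mle m) l" using assms by (simp add: chainm_def)
  then show "sorted (map fst l)"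
    unfolding sorted_wrt_map by (rule sorted_wrt_mono_rel[rotated]) (rule mle_tag)
qed

lemma n0_bounds:
  assumes "mixed l"
  shows "0 < n0 l" "n0 l < length l"
proof -
  obtain x y where xy: "x \<in> set l" "fst x = 0" "y \<in> set l" "fst y = Suc 0"
    using assms by (auto simp: mixed_def)
  then show "0 < n0 l"
    unfolding n0_def by (metis (mono_tags, lifting) filter_empty_conv length_greater_0_conv)
  show "n0 l < length l"
    unfolding n0_def by (rule length_filter_less[of y]) (use xy in auto)
qed

lemma deg_src: "inhom m (QC l) \<Longrightarrow> deg (src (QC l)) = length l - 2"
  using n0_bounds[of l] by auto

lemma inhom_iota: "inhom m (iota m)"
proof (cases m)
  case (TM q)
  then show ?thesis by (auto simp: sorted_wrt_iff_nth_less simp del: upt_Suc)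
next
  case (QM i j)
  have "sorted_wrt (mle (QM i j)) (map (Pair 0) [0..<Suc i] @ map (Pair (Suc 0)) [0..<Suc j])"
    unfolding sorted_wrt_append by (auto simp: sorted_wrt_iff_nth_less simp del: upt_Suc)
  moreover have "mixed (map (Pair 0) [0..<Suc i] @ map (Pair (Suc 0)) [0..<Suc j])"
    unfolding mixed_def by (auto simp: image_Un image_image simp del: upt_Suc)
  ultimately show ?thesis by (auto simp: QM chainm_def simp del: upt_Suc)
qed

lemma src_iota [simp]: "src (iota m) = m"
  by (cases m) (auto simp: n0_def filter_map comp_def filter_empty_conv simp del: upt_Suc)

text \<open>The map of posets \<open>src c \<rightarrow> m\<close> that is encoded by a cell \<open>c\<close> of \<open>m\<close>.\<close>

definition vmap :: "cell \<Rightarrow> nat \<times> nat \<Rightarrow> nat \<times> nat" where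
  "vmap c = (\<lambda>(e, v). (e, if e = 0 then vm0 c v else vm1 c v))"

lemma pushl_vmap: "pushl (vm0 c) (vm1 c) = map (vmap c)"
  by (simp add: pushl_def vmap_def)

lemma vmap_QC:
  assumes "inhom m (QC l)" "x \<in> nodes (src (QC l))"
  shows "vmap (QC l) x = l ! (if fst x = 0 then snd x else n0 l + snd x)"
    "(if fst x = 0 then snd x else n0 l + snd x) < length l"
proof -
  let ?k = "if fst x = 0 then snd x else n0 l + snd x"
  have n: "0 < n0 l" "n0 l < length l" using assms(1) n0_bounds by auto
  have x: "fst x = 0 \<and> snd x \<le> n0 l - 1 \<or> fst x = Suc 0 \<and> snd x \<le> length l - n0 l - 1"
    using assms(2) by auto
  then show k: "?k < length l" using n by auto
  have "fst (l ! ?k) = fst x"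
    using tag_nth[OF chainm_tags[of m l] k] assms(1) x n by auto
  then show "vmap (QC l) x = l ! ?k"
    by (auto simp: vmap_def split_def prod_eq_iff)
qed

lemma nodes_src_TC:
  assumes "u \<noteq> []" "x \<in> nodes (src (TC u))"
  shows "snd x < length u" "fst x = 0 \<or> fst x = Suc 0"
  using assms by (cases u; auto)+

lemma inhom_TC_mem:
  assumes "inhom m (TC u)" "x \<in> set u"
  shows "(0, fst x) \<in> nodes m" "(Suc 0, snd x) \<in> nodes m" "mle m (0, fst x) (Suc 0, snd x)"
  using assms by (auto simp: split_beta)

lemma vmap_node:
  assumes "inhom m c" "x \<in> nodes (src c)"
  shows "vmap c x \<in> nodes m"
proof (cases c)
  case (TC u)
  have "u \<noteq> []" using assms(1) by (simp add: TC)
  note x = nodes_src_TC[OF this assms(2)[unfolded TC]]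
  then have "u ! snd x \<in> set u" by simp
  note inhom_TC_mem[OF assms(1)[unfolded TC] this]
  then show ?thesis using x(2) by (auto simp: TC vmap_def split_def)
next
  case (QC l)
  note v = vmap_QC[OF assms[unfolded QC]]
  then have "vmap c x \<in> set l" unfolding QC by (metis nth_mem)
  then show ?thesis using assms(1) by (auto simp: QC chainm_def)
qed

lemma vmap_mono:
  assumes "inhom m c" "x \<in> nodes (src c)" "y \<in> nodes (src c)" "mle (src c) x y"
  shows "mle m (vmap c x) (vmap c y)"
proof (cases c)
  case (TC u)
  have ne: "u \<noteq> []" using assms(1) by (simp add: TC)
  note x = nodes_src_TC[OF ne assms(2)[unfolded TC]]
  note y = nodes_src_TC[OF ne assms(3)[unfolded TC]]
  note len = x(1) y(1) and tags = x(2) y(2)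
  have le: "fst x \<le> fst y" "snd x \<le> snd y" using assms(4) by (auto simp: TC)
  have s: "sorted_wrt (\<lambda>x y. fst x \<le> fst y \<and> snd x \<le> snd y) u" using assms(1) by (simp add: TC)
  have u: "fst (u ! snd x) \<le> fst (u ! snd y)" "snd (u ! snd x) \<le> snd (u ! snd y)"
    using sorted_wrt_nth_less[OF s, of "snd x" "snd y"] le len by (cases "snd x = snd y"; simp)+
  have "u ! snd y \<in> set u" using len by simp
  then have "mle m (0, fst (u ! snd y)) (Suc 0, snd (u ! snd y))"
    using inhom_TC_mem(3) assms(1) unfolding TC by blast
  moreover have "mle m (0, fst (u ! snd x)) (0, fst (u ! snd y))"
    using u by (simp add: mle_same_tag)
  ultimately have "mle m (0, fst (u ! snd x)) (Suc 0, snd (u ! snd y))" by (rule mle_trans[rotated])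
  then show ?thesis using tags le u
    by (auto simp: TC vmap_def split_def mle_same_tag)
next
  case (QC l)
  let ?k = "\<lambda>x. if fst x = 0 then snd x else n0 l + snd x"
  have n: "0 < n0 l" "n0 l < length l" using assms(1) n0_bounds QC by auto
  have le: "?k x \<le> ?k y" using assms n by (auto simp: QC)
  have s: "sorted_wrt (mle m) l" using assms(1) by (simp add: QC chainm_def)
  have "mle m (l ! ?k x) (l ! ?k y)"
  proof (cases "?k x = ?k y")
    case True
    have "mle m z z" for z by (cases m) auto
    then show ?thesis by (simp only: True)
  next
    case False
    then show ?thesis using sorted_wrt_nth_less[OF s, of "?k x" "?k y"] le vmap_QC(2)[of m l y] assms
      by (simp add: QC)
  qed
  then show ?thesis using vmap_QC(1)[of m l] assms by (simp add: QC)
qed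

lemma mixed_pushl [simp]: "mixed (pushl f g l) \<longleftrightarrow> mixed l"
  by (simp add: mixed_def pushl_def image_image split_def)

lemma n0_pushl [simp]: "n0 (pushl f g l) = n0 l"
  by (simp add: n0_def pushl_def filter_map comp_def split_def)

lemma src_pushc [simp]: "src (pushc f g c) = src c"
  by (cases c) (simp_all add: pushl_def[of f g] n0_pushl[unfolded pushl_def])

lemma chainm_push:
  assumes "inhom m c" "chainm (src c) l"
  shows "chainm m (map (vmap c) l)"
  using assms(2) vmap_node[OF assms(1)] vmap_mono[OF assms(1)]
  unfolding chainm_def sorted_wrt_map
  by (auto simp: subset_iff intro!: sorted_wrt_mono_rel[of l "mle (src c)"])

lemma inhom_push:
  assumes "inhom m c" "inhom (src c) d"
  shows "inhom m (push c d)"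
proof (cases d)
  case (QC l)
  have "chainm m (map (vmap c) l)"
    by (rule chainm_push[OF assms(1)]) (use assms(2) in \<open>simp add: QC\<close>)
  then show ?thesis using assms by (simp add: QC pushl_vmap[symmetric])
next
  case (TC u)
  have 1: "(0, vm0 c a) \<in> nodes m" "(Suc 0, vm1 c b) \<in> nodes m" "mle m (0, vm0 c a) (Suc 0, vm1 c b)"
    if "(a, b) \<in> set u" for a b
    using that assms vmap_node[OF assms(1), of "(0, a)"] vmap_node[OF assms(1), of "(Suc 0, b)"]
      vmap_mono[OF assms(1), of "(0, a)" "(Suc 0, b)"]
    by (auto simp: TC vmap_def)
  have mono: "vm0 c (fst x) \<le> vm0 c (fst y)" "vm1 c (snd x) \<le> vm1 c (snd y)"
    if "x \<in> set u" "y \<in> set u" "fst x \<le> fst y" "snd x \<le> snd y" for x y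
    using that assms vmap_mono[OF assms(1), of "(0, fst x)" "(0, fst y)"]
      vmap_mono[OF assms(1), of "(Suc 0, snd x)" "(Suc 0, snd y)"]
    by (fastforce simp: TC vmap_def mle_same_tag split_def)+
  have "sorted_wrt (\<lambda>x y. fst x \<le> fst y \<and> snd x \<le> snd y) (map (\<lambda>(a, b). (vm0 c a, vm1 c b)) u)"
    unfolding sorted_wrt_map
    by (rule sorted_wrt_mono_rel[of u "\<lambda>x y. fst x \<le> fst y \<and> snd x \<le> snd y"])
      (use assms mono in \<open>auto simp: TC split_def\<close>)
  then show ?thesis using assms 1 by (auto simp: TC)
qed

lemma push_iota:
  assumes "inhom m c"
  shows "push c (iota (src c)) = c"
proof (cases c)
  case (TC u)
  then show ?thesis using assms
    by (auto simp: map_idI comp_def simp del: upt_Suc intro!: nth_equalityI)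
next
  case (QC l)
  have n: "0 < n0 l" "n0 l < length l" using assms n0_bounds QC by auto
  have "pushl (vm0 c) (vm1 c) (map (Pair 0) [0..<n0 l] @ map (Pair (Suc 0)) [0..<length l - n0 l]) = l"
  proof (rule nth_equalityI, goal_cases)
    case 1
    then show ?case using n by (simp add: pushl_def)
  next
    case (2 k)
    then have k: "k < length l" using n by (simp add: pushl_def)
    have "fst (l ! k) = (if k < n0 l then 0 else Suc 0)"
      using tag_nth[OF chainm_tags[of m l] k] assms by (auto simp: QC)
    then show ?case using k n
      by (auto simp: pushl_def nth_append QC prod_eq_iff)
  qed
  moreover have "Suc (n0 l - 1) = n0 l" "Suc (length l - n0 l - 1) = length l - n0 l" using n by auto
  ultimately show ?thesis by (simp only: QC src.simps iota.simps pushc.simps)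
qed

lemma vm0_pushc:
  assumes "inhom m d" "(0, v) \<in> nodes (src d)"
  shows "vm0 (pushc f g d) v = f (vm0 d v)"
proof (cases d)
  case (TC u)
  then have "v < length u" using assms by (cases u) auto
  then show ?thesis by (simp add: TC split_def)
next
  case (QC l)
  then have "fst (l ! v) = 0" "v < length l"
    using vmap_QC[of m l "(0, v)"] assms by (auto simp: vmap_def prod_eq_iff split_def)
  then show ?thesis by (simp add: QC pushl_def split_def)
qed

lemma vm1_pushc:
  assumes "inhom m d" "(Suc 0, v) \<in> nodes (src d)"
  shows "vm1 (pushc f g d) v = g (vm1 d v)"
proof (cases d)
  case (TC u)
  then have "v < length u" using assms by (cases u) auto
  then show ?thesis by (simp add: TC split_def)
next
  case (QC l)
  then have "fst (l ! (n0 l + v)) = Suc 0" "n0 l + v < length l"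
    using vmap_QC[of m l "(Suc 0, v)"] assms by (auto simp: vmap_def prod_eq_iff split_def)
  then show ?thesis by (simp add: QC n0_pushl) (simp add: pushl_def split_def)
qed

lemma vmap_push:
  assumes "inhom m d" "x \<in> nodes (src d)"
  shows "vmap (push c d) x = vmap c (vmap d x)"
  using vm0_pushc[OF assms(1), of "snd x" "vm0 c" "vm1 c"]
    vm1_pushc[OF assms(1), of "snd x" "vm0 c" "vm1 c"] assms(2) nodes_tag[OF assms(2)]
  by (cases x) (auto simp: vmap_def)

text \<open>Associativity of composition. The outer maps \<open>f\<close> and \<open>g\<close> may
  be arbitrary because the entries of \<open>r\<close> lie in the source of \<open>d\<close>, and
  only there are positions looked up.\<close>

lemma push_push:
  assumes "inhom m d" "inhom (src d) r"
  shows "push (pushc f g d) r = pushc f g (push d r)"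
proof (cases r)
  case (TC u)
  then show ?thesis using assms(2) vm0_pushc[OF assms(1)] vm1_pushc[OF assms(1)] by fastforce
next
  case (QC l)
  have "(e, if e = 0 then vm0 (pushc f g d) v else vm1 (pushc f g d) v)
      = (e, if e = 0 then f (vm0 d v) else g (vm1 d v))" if "(e, v) \<in> set l" for e v
  proof -
    have "(e, v) \<in> nodes (src d)" using that assms(2) by (auto simp: QC chainm_def)
    then show ?thesis
      using vm0_pushc[OF assms(1)] vm1_pushc[OF assms(1)] nodes_tag[of "(e, v)"] by auto
  qed
  then show ?thesis by (auto simp: QC pushl_def)
qed

lemma embQ_pushl:
  "embQ (lift (\<lambda>w. sing (pushl f g w)) p) = lift (\<lambda>c. sing (pushc f g c)) (embQ p)"
  unfolding lift_lift by (rule lift_cong) simp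

text \<open>Deletion and prism only rearrange entries, and being mixed depends on the tags, which
  \<open>pushc\<close> keeps: the cone differential is natural.\<close>

lemma bdc_pushc: "bdc (pushc f g c) = lift (\<lambda>d. sing (pushc f g d)) (bdc c)"
proof (cases c)
  case (TC u)
  have "embT (lift (\<lambda>w. sing (map (\<lambda>(a, b). (f a, g b)) w)) p)
    = (lift (\<lambda>c. sing (pushc f g c)) (embT p) :: _ \<Rightarrow>\<^sub>0 'a)" for p
    unfolding lift_lift by (rule lift_cong) simp
  then show ?thesis
    by (simp add: TC lift_add prism_map bdl_map flip: embQ_pushl pushl_def)
next
  case (QC l)
  then show ?thesis
    by (simp add: pushl_def[of f g] bdl_map) (simp flip: embQ_pushl pushl_def)
qed

lemma inhom_rmn:
  assumes "inhom m (TC u)" "rmn i u \<noteq> []"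
  shows "inhom m (TC (rmn i u))"
proof -
  have "u = take i u @ drop i u" by simp
  have sub: "set (rmn i u) \<subseteq> set u"
    unfolding rmn_def using set_take_subset set_drop_subset by fastforce
  have "sorted_wrt P (rmn i u)" if s: "sorted_wrt P u" for P
  proof -
    have "sorted_wrt P (take i u)" "sorted_wrt P (drop (Suc i) u)"
      using s by (simp_all add: sorted_wrt_take sorted_wrt_drop)
    moreover have "P x y" if "x \<in> set (take i u)" "y \<in> set (drop (Suc i) u)" for x y
    proof -
      have "sorted_wrt P (take i u @ drop i u)" using s by simp
      moreover have "y \<in> set (drop i u)"
        using that(2) set_drop_subset_set_drop[of i "Suc i" u] by auto
      ultimately show ?thesis using that(1) unfolding sorted_wrt_append by blast
    qed
    ultimately show ?thesis unfolding rmn_def sorted_wrt_append by blast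
  qed
  then show ?thesis using assms sub by auto
qed

lemma chainm_rmn:
  assumes "chainm m l"
  shows "chainm m (rmn i l)"
proof -
  have s: "sorted_wrt (mle m) l" using assms by (simp add: chainm_def)
  have sub: "set (rmn i l) \<subseteq> set l"
    unfolding rmn_def using set_take_subset set_drop_subset by fastforce
  have "sorted_wrt (mle m) (take i l)" "sorted_wrt (mle m) (drop (Suc i) l)"
    using s by (simp_all add: sorted_wrt_take sorted_wrt_drop)
  moreover have "mle m x y" if "x \<in> set (take i l)" "y \<in> set (drop (Suc i) l)" for x y
  proof -
    have "sorted_wrt (mle m) (take i l @ drop i l)" using s by simp
    moreover have "y \<in> set (drop i l)"
      using that(2) set_drop_subset_set_drop[of i "Suc i" l] by auto
    ultimately show ?thesis using that(1) unfolding sorted_wrt_append by blast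
  qed
  ultimately have "sorted_wrt (mle m) (rmn i l)" unfolding rmn_def sorted_wrt_append by blast
  then show ?thesis using assms sub by (auto simp: chainm_def)
qed

text \<open>A lower vertex lies below the lower vertex of any later pair, and that one lies below
  its own partner in level 1.\<close>

lemma chainm_prism:
  assumes "inhom m (TC u)"
  shows "chainm m (lower (take (Suc k) u) @ upper (drop k u))"
proof -
  let ?R = "\<lambda>x y :: nat \<times> nat. fst x \<le> fst y \<and> snd x \<le> snd y"
  have s: "sorted_wrt ?R u" using assms by simp
  have h: "(0, fst x) \<in> nodes m" "(Suc 0, snd x) \<in> nodes m" "mle m (0, fst x) (Suc 0, snd x)"
    if "x \<in> set u" for x using inhom_TC_mem[OF assms that] by auto
  have "sorted_wrt ?R (take (Suc k) u)" "sorted_wrt ?R (drop k u)"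
    using s by (simp_all add: sorted_wrt_take sorted_wrt_drop)
  then have "sorted_wrt (mle m) (lower (take (Suc k) u))" "sorted_wrt (mle m) (upper (drop k u))"
    unfolding sorted_wrt_map
    by (auto elim!: sorted_wrt_mono_rel[rotated] simp: mle_same_tag split_def)
  moreover have "mle m (0, fst x) (Suc 0, snd y)"
    if xy: "x \<in> set (take (Suc k) u)" "y \<in> set (drop k u)" for x y
  proof -
    obtain i where i: "x = u ! i" "i \<le> k" "i < length u"
      using xy(1) by (auto simp: in_set_conv_nth)
    obtain j' where "y = drop k u ! j'" "j' < length (drop k u)"
      using xy(2) by (metis in_set_conv_nth)
    then obtain j where j: "y = u ! j" "k \<le> j" "j < length u"
      by (auto intro: that[of "k + j'"])
    have "fst x \<le> fst y" using sorted_wrt_nth_less[OF s, of i j] i j by (cases "i = j") auto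
    then have "mle m (0, fst x) (0, fst y)" by (simp add: mle_same_tag)
    moreover have "mle m (0, fst y) (Suc 0, snd y)" using h(3)[of y] j by simp
    ultimately show ?thesis by (rule mle_trans)
  qed
  ultimately have "sorted_wrt (mle m) (lower (take (Suc k) u) @ upper (drop k u))"
    unfolding sorted_wrt_append by (auto simp: split_def)
  moreover have "set (lower (take (Suc k) u) @ upper (drop k u)) \<subseteq> nodes m"
    using h(1,2) by (auto simp: split_beta dest: in_set_takeD in_set_dropD)
  ultimately show ?thesis by (simp add: chainm_def)
qed

text \<open>That the sources drop by exactly one degree is what makes the recursion for the
  contraction work.\<close>

lemma keys_bdc:
  assumes "inhom m c" "d \<in> Poly_Mapping.keys (bdc c :: cell \<Rightarrow>\<^sub>0 'k::field)"
  shows "inhom m d" "Suc (deg (src d)) = deg (src c)"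
proof -
  have "inhom m d \<and> Suc (deg (src d)) = deg (src c)"
  proof (cases c)
    case (QC l)
    have "d \<in> Poly_Mapping.keys (embQ (bdl l) :: _ \<Rightarrow>\<^sub>0 'k)" using assms(2) by (simp add: QC)
    then obtain w where w: "w \<in> Poly_Mapping.keys (bdl l :: _ \<Rightarrow>\<^sub>0 'k)" "mixed w" "d = QC w"
      by (rule in_keys_lift) (auto split: if_splits)
    then obtain i where i: "w = rmn i l" using keys_bdl by blast
    have hd: "inhom m (QC w)" using chainm_rmn[of m l i] assms(1) w(2) by (simp add: QC i)
    have "Suc (length w) = length l" using w(1) by (rule keys_bdl_length)
    moreover have "2 \<le> length w" using n0_bounds[OF w(2)] by simp
    moreover have "inhom m (QC l)" using assms(1) by (simp only: QC)
    ultimately show ?thesis unfolding w(3) QC using deg_src[OF hd] deg_src[of m l] hd by linarith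
  next
    case (TC u)
    have "d \<in> Poly_Mapping.keys (embT (bdl u) :: _ \<Rightarrow>\<^sub>0 'k) \<union> Poly_Mapping.keys (embQ (prisml u) :: _ \<Rightarrow>\<^sub>0 'k)"
      using assms(2) unfolding TC bdc.simps by (rule subsetD[OF Poly_Mapping.keys_add])
    then consider "d \<in> Poly_Mapping.keys (embT (bdl u) :: _ \<Rightarrow>\<^sub>0 'k)"
      | "d \<in> Poly_Mapping.keys (embQ (prisml u) :: _ \<Rightarrow>\<^sub>0 'k)" by blast
    then show ?thesis
    proof cases
      case 1
      then obtain w where w: "w \<in> Poly_Mapping.keys (bdl u :: _ \<Rightarrow>\<^sub>0 'k)" "w \<noteq> []" "d = TC w"
        by (rule in_keys_lift) (auto split: if_splits)
      then obtain i where i: "w = rmn i u" using keys_bdl by blast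
      have "inhom m d"
        unfolding w(3) i by (rule inhom_rmn) (use assms(1) w(2) i TC in auto)
      moreover have "Suc (length w) = length u" using w(1) by (rule keys_bdl_length)
      ultimately show ?thesis using w(2,3) TC by auto
    next
      case 2
      then obtain w where w: "w \<in> Poly_Mapping.keys (prisml u :: _ \<Rightarrow>\<^sub>0 'k)" "mixed w" "d = QC w"
        by (rule in_keys_lift) (auto split: if_splits)
      then obtain k where k: "w = lower (take (Suc k) u) @ upper (drop k u)" "k < length u"
        using keys_prism by blast
      have hd: "inhom m (QC w)" using chainm_prism[of m u k] assms(1) w(2) by (simp add: TC k(1))
      have "length w = Suc (length u)" unfolding k(1) using k(2) by simp
      moreover have "deg (src c) = Suc (length u - 1)" by (simp add: TC)
      ultimately show ?thesis unfolding w(3) using deg_src[OF hd] hd k(2) by linarith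
    qed
  qed
  then show "inhom m d" "Suc (deg (src d)) = deg (src c)" by auto
qed

lemma inhom_QC_Cons:
  assumes "inhom m (QC l)"
  obtains a l' where "l = (0, a) # l'"
proof -
  have "0 < n0 l" "l \<noteq> []" using assms n0_bounds[of l] by auto
  moreover have "fst (l ! 0) = (if 0 < n0 l then 0 else Suc 0)"
    by (rule tag_nth[OF chainm_tags[of m l]]) (use assms \<open>l \<noteq> []\<close> in auto)
  ultimately show ?thesis using that by (cases l) auto
qed

text \<open>In both kinds of models \<open>(0, 0)\<close> lies below everything and
  \<open>(Suc 0, 0)\<close> is the least element of level 1, so the lists built by
  \<open>contr\<close> are chains again.\<close>

lemma inhom_contr:
  assumes "inhom m c" "d \<in> Poly_Mapping.keys (contr c :: cell \<Rightarrow>\<^sub>0 'k::field)"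
  shows "inhom m d"
proof -
  have min: "(0, 0) \<in> nodes m" "(Suc 0, 0) \<in> nodes m" "mle m (0, 0) (Suc 0, 0)"
    by (cases m; simp)+
  have bot: "x \<in> nodes m \<Longrightarrow> mle m (0, 0) x" for x by (cases m) auto
  show ?thesis
  proof (cases c)
    case (TC u)
    then show ?thesis using assms min by auto
  next
    case (QC l)
    obtain a l' where l: "l = (0, a) # l'" using assms(1) QC inhom_QC_Cons by blast
    have c0: "inhom m (QC ((0, 0) # l))"
      using assms(1) bot min by (auto simp: QC chainm_def mixed_def)
    have T: "inhom m (TC [(0, 0)])" using min by simp
    show ?thesis
    proof (cases "\<exists>b r. l' = (Suc 0, b) # r")
      case False
      have "l' \<noteq> []" using assms(1) l by (auto simp: QC mixed_def)
      then obtain e v r where l': "l' = (e, v) # r" by (cases l') auto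
      have "e = 0 \<or> e = Suc 0"
        using assms(1) nodes_tag[of "(e, v)" m] by (auto simp: QC l l' chainm_def)
      then show ?thesis using False c0 assms(2) by (auto simp: QC l l')
    next
      case True
      then obtain b r where l': "l' = (Suc 0, b) # r" by blast
      have ones: "fst x = Suc 0 \<and> mle m (Suc 0, 0) x" if "x \<in> set l'" for x
      proof -
        have "x \<in> nodes m" using that assms(1) by (auto simp: QC l chainm_def)
        moreover have "x = (Suc 0, b) \<or> mle m (Suc 0, b) x"
          using that assms(1) by (auto simp: QC l l' chainm_def)
        then have "Suc 0 \<le> fst x" using mle_tag[of m "(Suc 0, b)" x] by auto
        ultimately have "fst x = Suc 0" using nodes_tag[of x m] by auto
        then show ?thesis using mle_same_tag[of m "Suc 0" 0 "snd x"] by (metis prod.collapse zero_le)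
      qed
      have "inhom m (QC ((0, 0) # (Suc 0, 0) # l'))"
        using assms(1) bot min ones by (auto simp: QC l chainm_def mixed_def)
      then show ?thesis using c0 T assms(2) Poly_Mapping.keys_add Poly_Mapping.keys_diff
        by (fastforce simp: QC l l' split: if_splits)
    qed
  qed
qed

text \<open>A statement inside one fixed model: \<open>contr\<close> does not commute with
  \<open>push\<close> in general.\<close>

lemma contr_homotopy:
  assumes "Poly_Mapping.keys w \<subseteq> hom m"
  shows "lift bdc (lift contr w) + lift contr (lift bdc w) = w"
proof -
  have "lift bdc (contr c) + lift contr (bdc c) = (sing c :: _ \<Rightarrow>\<^sub>0 'a)"
    if "c \<in> Poly_Mapping.keys w" for c
  proof (cases c)
    case (TC u)
    then show ?thesis using that assms contr_TC[of u] by auto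
  next
    case (QC l)
    have h: "inhom m (QC l)" using that assms QC by auto
    then obtain a l' where l: "l = (0, a) # l'" using inhom_QC_Cons by blast
    show ?thesis unfolding QC
      by (rule contr_QC) (use h chainm_tags[of m l] l in \<open>auto\<close>)
  qed
  then have "lift (\<lambda>c. lift bdc (contr c) + lift contr (bdc c)) w = lift sing w"
    by (rule lift_cong)
  then show ?thesis by (simp add: lift_fun_add lift_lift)
qed


section \<open>Universal cells and the natural contraction\<close>

abbreviation pushp :: "cell \<Rightarrow> (cell \<Rightarrow>\<^sub>0 'k::field) \<Rightarrow> (cell \<Rightarrow>\<^sub>0 'k)" where
  "pushp c \<equiv> lift (\<lambda>d. sing (push c d))"

text \<open>Acyclic models: the contraction of the universal cell of each model, by recursion on the degree.\<close>

primrec sigma_upto :: "nat \<Rightarrow> model \<Rightarrow> (cell \<Rightarrow>\<^sub>0 'k::field)" where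
  "sigma_upto 0 m = 0"
| "sigma_upto (Suc n) m = lift contr (sing (iota m)
    - lift (\<lambda>c. pushp c (sigma_upto n (src c))) (bdc (iota m)))"

text \<open>The recursion passes to the sources of the boundary cells, hence the step count in
  \<open>sigma_upto\<close>. One step more than the degree suffices: in degree 0 the universal cell
  has zero boundary, so the default value at count 0 does not enter.\<close>

definition sigma :: "model \<Rightarrow> (cell \<Rightarrow>\<^sub>0 'k::field)" where
  "sigma m = sigma_upto (Suc (deg m)) m"

definition sigma_cell :: "cell \<Rightarrow> (cell \<Rightarrow>\<^sub>0 'k::field)" where
  "sigma_cell c = pushp c (sigma (src c))"

lemma sigma_eq:
  "sigma m = lift contr (sing (iota m) - lift sigma_cell (bdc (iota m)))"
proof -
  have "lift (\<lambda>c. pushp c (sigma_upto (deg m) (src c))) (bdc (iota m))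
      = (lift sigma_cell (bdc (iota m)) :: cell \<Rightarrow>\<^sub>0 'a)"
  proof (rule lift_cong)
    fix c assume "c \<in> Poly_Mapping.keys (bdc (iota m) :: cell \<Rightarrow>\<^sub>0 'a)"
    then have "Suc (deg (src c)) = deg m"
      using keys_bdc(2)[OF inhom_iota[of m]] by simp
    then show "pushp c (sigma_upto (deg m) (src c)) = (sigma_cell c :: cell \<Rightarrow>\<^sub>0 'a)"
      by (simp only: sigma_cell_def sigma_def)
  qed
  then show ?thesis by (simp add: sigma_def)
qed

lemma keys_bdc_subset: "inhom m c \<Longrightarrow> Poly_Mapping.keys (bdc c :: cell \<Rightarrow>\<^sub>0 'k::field) \<subseteq> hom m"
  using keys_bdc(1) by blast

lemma keys_pushp:
  assumes "inhom m c" "Poly_Mapping.keys p \<subseteq> hom (src c)"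
  shows "Poly_Mapping.keys (pushp c p) \<subseteq> hom m"
  by (rule keys_lift_subset) (use assms inhom_push in auto)

lemma keys_sigma: "Poly_Mapping.keys (sigma m :: cell \<Rightarrow>\<^sub>0 'k::field) \<subseteq> hom m"
proof (induction "deg m" arbitrary: m rule: less_induct)
  case less
  have "Poly_Mapping.keys (sigma_cell c :: cell \<Rightarrow>\<^sub>0 'k) \<subseteq> hom m"
    if "c \<in> Poly_Mapping.keys (bdc (iota m) :: cell \<Rightarrow>\<^sub>0 'k)" for c
  proof -
    have "inhom m c" "Suc (deg (src c)) = deg m" using keys_bdc[OF inhom_iota that] by auto
    then show ?thesis unfolding sigma_cell_def by (intro keys_pushp less) auto
  qed
  then have "Poly_Mapping.keys (sing (iota m) - lift sigma_cell (bdc (iota m)) :: cell \<Rightarrow>\<^sub>0 'k) \<subseteq> hom m"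
    by (intro keys_diff_subset keys_lift_subset) (auto simp: inhom_iota)
  then show ?case unfolding sigma_eq[of m]
    by (intro keys_lift_subset) (use inhom_contr in blast)
qed

lemma pushp_pushp:
  assumes "inhom m d" "Poly_Mapping.keys p \<subseteq> hom (src d)"
  shows "pushp (push c d) p = pushp c (pushp d p)"
  unfolding lift_lift by (rule lift_cong) (use assms push_push in fastforce)

text \<open>Naturality is built in: \<open>sigma_cell\<close> pushes the value on the universal cell
  along the given cell, and pushing is associative.\<close>

lemma sigma_cell_push:
  assumes "inhom m d"
  shows "sigma_cell (push c d) = (pushp c (sigma_cell d) :: cell \<Rightarrow>\<^sub>0 'k::field)"
  using pushp_pushp[OF assms keys_sigma] by (simp add: sigma_cell_def)

lemma bdc_pushp: "lift bdc (pushp c p) = pushp c (lift bdc p)"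
  by (simp add: lift_lift bdc_pushc)

lemma bdc_eq_pushp: "inhom m c \<Longrightarrow> bdc c = pushp c (bdc (iota (src c)))"
  using bdc_pushc[of "vm0 c" "vm1 c" "iota (src c)"] push_iota by simp

text \<open>The acyclic models argument. By induction the homotopy identity holds on the cells of
  the boundary, so \<open>?w\<close>, the universal cell minus its contracted boundary, is a cycle,
  and \<open>contr\<close> exhibits it as a boundary.\<close>

lemma sigma_homotopy:
  "lift bdc (sigma m) + lift sigma_cell (bdc (iota m)) = (sing (iota m) :: cell \<Rightarrow>\<^sub>0 'k::field)"
proof (induction "deg m" arbitrary: m rule: less_induct)
  case less
  let ?w = "sing (iota m) - lift sigma_cell (bdc (iota m)) :: cell \<Rightarrow>\<^sub>0 'k"
  \<comment> \<open>The identity for the universal cell of \<open>src c\<close>, pushed along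
    \<open>c\<close>.\<close>
  have cell: "lift bdc (sigma_cell c) + lift sigma_cell (bdc c) = (sing c :: cell \<Rightarrow>\<^sub>0 'k)"
    if c: "c \<in> Poly_Mapping.keys (bdc (iota m) :: cell \<Rightarrow>\<^sub>0 'k)" for c
  proof -
    have h: "inhom m c" "deg (src c) < deg m" using keys_bdc[OF inhom_iota c] by auto
    have "lift sigma_cell (bdc c) = pushp c (lift sigma_cell (bdc (iota (src c))) :: cell \<Rightarrow>\<^sub>0 'k)"
      unfolding bdc_eq_pushp[OF h(1)] lift_lift
      by (rule lift_cong) (use keys_bdc(1)[OF inhom_iota] sigma_cell_push in fastforce)
    moreover have "lift bdc (sigma_cell c) = pushp c (lift bdc (sigma (src c)) :: cell \<Rightarrow>\<^sub>0 'k)"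
      by (simp add: sigma_cell_def bdc_pushp)
    ultimately have "lift bdc (sigma_cell c) + lift sigma_cell (bdc c)
        = pushp c (sing (iota (src c)) :: cell \<Rightarrow>\<^sub>0 'k)"
      using less[OF h(2)] by (simp only: lift_add[symmetric])
    then show ?thesis using push_iota[OF h(1)] by simp
  qed
  have "lift (\<lambda>c. lift bdc (sigma_cell c) + lift sigma_cell (bdc c)) (bdc (iota m))
      = (lift sing (bdc (iota m)) :: cell \<Rightarrow>\<^sub>0 'k)"
    by (rule lift_cong) (rule cell)
  then have "lift bdc (lift sigma_cell (bdc (iota m))) + lift sigma_cell (lift bdc (bdc (iota m)))
      = (bdc (iota m) :: cell \<Rightarrow>\<^sub>0 'k)"
    by (simp only: lift_fun_add lift_lift lift_sing_id)
  then have w0: "lift bdc ?w = 0"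
    by (simp add: lift_diff bdc_bdc)
  have "Poly_Mapping.keys (lift sigma_cell (bdc (iota m)) :: cell \<Rightarrow>\<^sub>0 'k) \<subseteq> hom m"
  proof (rule keys_lift_subset)
    fix c assume "c \<in> Poly_Mapping.keys (bdc (iota m) :: cell \<Rightarrow>\<^sub>0 'k)"
    then show "Poly_Mapping.keys (sigma_cell c :: cell \<Rightarrow>\<^sub>0 'k) \<subseteq> hom m"
      unfolding sigma_cell_def by (intro keys_pushp keys_sigma keys_bdc(1)[OF inhom_iota])
  qed
  then have "Poly_Mapping.keys ?w \<subseteq> hom m"
    by (intro keys_diff_subset) (auto simp: inhom_iota)
  then have "lift bdc (lift contr ?w) = ?w"
    using contr_homotopy[of ?w m] w0 by simp
  then show ?case unfolding sigma_eq[of m] by simp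
qed


section \<open>Simplicial sets and their chains\<close>

lemma op_comp_coface:
  assumes "length l = Suc (Suc n)" "i \<le> Suc n"
  shows "op_comp l (coface n i) = rmn i l"
proof (rule nth_equalityI)
  show "length (op_comp l (coface n i)) = length (rmn i l)"
    using assms by (simp add: op_comp_def coface_def rmn_def)
  fix k assume "k < length (op_comp l (coface n i))"
  then have "k < Suc n" by (simp add: op_comp_def coface_def)
  then show "op_comp l (coface n i) ! k = rmn i l ! k"
    using assms by (auto simp: op_comp_def coface_def rmn_def nth_append simp del: upt_Suc)
qed

lemma coface_ops: "i \<le> Suc n \<Longrightarrow> coface n i \<in> ops n (Suc n)"
  by (auto simp: ops_def coface_def sorted_iff_nth_mono simp del: upt_Suc)

lemma op_id_ops: "op_id n \<in> ops n n"
  by (auto simp: ops_def op_id_def simp del: upt_Suc)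

lemma op_comp_op_id: "length a = Suc n \<Longrightarrow> op_comp a (op_id n) = a"
  unfolding op_comp_def op_id_def by (metis map_nth)

lemma op_id_comp: "\<theta> \<in> ops m n \<Longrightarrow> op_comp (op_id n) \<theta> = \<theta>"
  unfolding op_comp_def op_id_def ops_def by (rule map_idI) (auto simp del: upt_Suc)

lemma op_comp_map: "\<theta> \<in> ops m n \<Longrightarrow> length l = Suc n \<Longrightarrow> op_comp (map f l) \<theta> = map f (op_comp l \<theta>)"
  by (auto simp: op_comp_def ops_def)

lemma op_comp_comp:
  "\<theta> \<in> ops m n \<Longrightarrow> \<phi> \<in> ops l m \<Longrightarrow> op_comp (op_comp a \<theta>) \<phi> = op_comp a (op_comp \<theta> \<phi>)"
  by (auto simp: op_comp_def ops_def)

lemma op_comp_ops: "\<theta> \<in> ops m n \<Longrightarrow> \<phi> \<in> ops l m \<Longrightarrow> op_comp \<theta> \<phi> \<in> ops l n"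
  unfolding ops_def op_comp_def
  by (auto simp: sorted_map sorted_iff_nth_mono subset_iff le_imp_less_Suc
      intro!: sorted_wrt_mono_rel[of \<phi> "(\<le>)"]) 

lemma sorted_op_comp: "\<theta> \<in> ops m n \<Longrightarrow> length a = Suc n \<Longrightarrow> sorted a \<Longrightarrow> sorted (op_comp a \<theta>)"
  unfolding ops_def op_comp_def
  by (auto simp: sorted_map sorted_iff_nth_mono subset_iff le_imp_less_Suc
      intro!: sorted_wrt_mono_rel[of \<theta> "(\<le>)"])

lemma set_op_comp: "\<theta> \<in> ops m n \<Longrightarrow> length a = Suc n \<Longrightarrow> set (op_comp a \<theta>) \<subseteq> set a"
  unfolding ops_def op_comp_def by (auto simp: subset_iff le_imp_less_Suc)

lemma length_op_comp: "\<theta> \<in> ops m n \<Longrightarrow> length (op_comp a \<theta>) = Suc m"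
  by (simp add: op_comp_def ops_def)

lemma simplicial_setD:
  assumes "simplicial_set X" "x \<in> simplices X n"
  shows "\<theta> \<in> ops m n \<Longrightarrow> act X n x \<theta> \<in> simplices X m"
    "act X n x (op_id n) = x"
    "\<theta> \<in> ops m n \<Longrightarrow> \<phi> \<in> ops l m \<Longrightarrow> act X m (act X n x \<theta>) \<phi> = act X n x (op_comp \<theta> \<phi>)"
  using assms unfolding simplicial_set_def by auto

text \<open>Not augmented: it is zero in dimension 0. With the truncated \<open>n - 1\<close> as
  target this allows statements uniform in the dimension.\<close>

definition bds :: "'y sset \<Rightarrow> nat \<Rightarrow> 'y \<Rightarrow> ('y \<Rightarrow>\<^sub>0 'k::field)" where
  "bds Y n y = (case n of 0 \<Rightarrow> 0
    | Suc m \<Rightarrow> \<Sum>i\<le>Suc m. pscale ((-1) ^ i) (sing (act Y (Suc m) y (coface m i))))"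

lemma bds_0 [simp]: "bds Y 0 = (\<lambda>y. 0)"
  by (rule ext) (simp add: bds_def)

text \<open>The bridge from lists to simplicial sets. At least two entries are required because a
  vertex has boundary zero, while \<open>bdl\<close> of a single entry is the empty list.\<close>

lemma bds_eval:
  assumes "length l = Suc (Suc n)"
    and "\<And>i. i \<le> Suc n \<Longrightarrow> act Y (Suc n) (E l) (coface n i) = E (rmn i l)"
  shows "bds Y (Suc n) (E l) = lift (\<lambda>w. sing (E w)) (bdl l)"
proof -
  have "{..<length l} = {..Suc n}" using assms(1) by auto
  then show ?thesis
    by (simp add: bds_def bdl_def lift_sum lift_scale assms(2) del: sum.atMost_Suc cong: sum.cong_simp)
qed

lemma keys_bds:
  assumes "simplicial_set Y" "y \<in> simplices Y (Suc n)"
  shows "Poly_Mapping.keys (bds Y (Suc n) y :: _ \<Rightarrow>\<^sub>0 'k::field) \<subseteq> simplices Y n"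
  unfolding bds_def nat.case
  using simplicial_setD(1)[OF assms coface_ops]
  by (intro keys_sum_subset keys_pscale_subset) auto

text \<open>Write \<open>y\<close> as the value of \<open>act Y n y\<close> at the identity list.
  Both boundaries are then given by deletions, and the claim is the image of
  \<open>bdl_bdl\<close>.\<close>

lemma bds_bds:
  assumes "simplicial_set Y" "y \<in> simplices Y n"
  shows "lift (bds Y (n - 1)) (bds Y n y) = (0 :: _ \<Rightarrow>\<^sub>0 'k::field)"
proof -
  consider "n = 0" | "n = Suc 0" | m where "n = Suc (Suc m)"
    using not0_implies_Suc[of n] not0_implies_Suc[of "n - 1"] by fastforce
  then show ?thesis
  proof cases
    case (3 m)
    note y = assms(2)[unfolded 3]
    let ?E = "act Y n y" and ?id = "op_id n"
    have id: "length ?id = Suc (Suc (Suc m))" by (simp add: 3 op_id_def)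
    have R: "rmn i ?id = coface (Suc m) i" if "i \<le> Suc (Suc m)" for i
      using op_comp_coface[OF id that] op_id_comp[OF coface_ops[OF that]] 3 by simp
    have 1: "bds Y n y = (lift (\<lambda>w. sing (?E w)) (bdl ?id) :: _ \<Rightarrow>\<^sub>0 'k)"
    proof -
      have "act Y n (?E ?id) (coface (Suc m) i) = ?E (rmn i ?id)" if "i \<le> Suc (Suc m)" for i
        unfolding R[OF that] simplicial_setD(2)[OF assms] ..
      then have "bds Y (Suc (Suc m)) (?E ?id) = (lift (\<lambda>w. sing (?E w)) (bdl ?id) :: _ \<Rightarrow>\<^sub>0 'k)"
        unfolding 3[symmetric] by (intro bds_eval[where E = ?E, OF id, unfolded 3[symmetric]])
      then show ?thesis unfolding 3[symmetric] simplicial_setD(2)[OF assms] .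
    qed
    have 2: "bds Y (Suc m) (?E w) = (lift (\<lambda>w. sing (?E w)) (bdl w) :: _ \<Rightarrow>\<^sub>0 'k)"
      if w': "w \<in> Poly_Mapping.keys (bdl ?id :: _ \<Rightarrow>\<^sub>0 'k)" for w
    proof -
      obtain i where i: "i < length ?id" "w = rmn i ?id" using subsetD[OF keys_bdl w'] by auto
      then have i: "i \<le> Suc (Suc m)" "w = rmn i ?id" using id by auto
      have w: "w = coface (Suc m) i" using i R by simp
      then have wo: "w \<in> ops (Suc m) n" using coface_ops[OF i(1)] 3 by simp
      show ?thesis
      proof (rule bds_eval[where E = ?E])
        show len: "length w = Suc (Suc m)" using wo by (simp add: ops_def)
        fix k assume k: "k \<le> Suc m"
        show "act Y (Suc m) (?E w) (coface m k) = ?E (rmn k w)"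
          unfolding simplicial_setD(3)[OF assms wo coface_ops[OF k]] op_comp_coface[OF len k] ..
      qed
    qed
    have "lift (bds Y (n - 1)) (bds Y n y)
        = (lift (\<lambda>w. lift (\<lambda>w. sing (?E w)) (bdl w)) (bdl ?id) :: _ \<Rightarrow>\<^sub>0 'k)"
    proof -
      have n1: "n - 1 = Suc m" using 3 by simp
      show ?thesis unfolding 1 lift_lift lift_sing n1 by (rule lift_cong) (rule 2)
    qed
    also have "\<dots> = lift (\<lambda>w. sing (?E w)) (lift bdl (bdl ?id))"
      by (simp only: lift_lift)
    finally show ?thesis by (simp add: bdl_bdl)
  qed simp_all
qed

lemma lift_bds_bds:
  assumes "simplicial_set Y" "Poly_Mapping.keys p \<subseteq> simplices Y n"
  shows "lift (bds Y (n - 1)) (lift (bds Y n) p) = (0 :: _ \<Rightarrow>\<^sub>0 'k::field)"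
proof -
  have "lift (bds Y (n - 1)) (lift (bds Y n) p) = lift (\<lambda>_. 0 :: _ \<Rightarrow>\<^sub>0 'k) p"
    unfolding lift_lift by (rule lift_cong, rule bds_bds[OF assms(1)]) (use assms(2) in auto)
  then show ?thesis by simp
qed


section \<open>Evaluation of sections\<close>

text \<open>Simplices of \<open>\<Delta>\<^sup>p \<times> \<Delta>\<^sup>q\<close> as lists of pairs.\<close>

definition grid :: "nat \<Rightarrow> nat \<Rightarrow> (nat \<times> nat) list set" where
  "grid p q = {l. l \<noteq> [] \<and> set l \<subseteq> {..p} \<times> {..q} \<and> sorted (map fst l) \<and> sorted (map snd l)}"

text \<open>Recovering the dimension from the length turns a section into a single function on lists
  instead of a family indexed by dimensions.\<close>

definition sev :: "'x prism \<Rightarrow> (nat \<times> nat) list \<Rightarrow> 'x" where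
  "sev \<rho> l = \<rho> (length l - 1) (map fst l, map snd l)"

definition section_of :: "nat \<Rightarrow> nat \<Rightarrow> ((nat \<times> nat) list \<Rightarrow> 'x) \<Rightarrow> 'x prism" where
  "section_of p q F = (\<lambda>n. \<lambda>(\<theta>, \<phi>)\<in>simplices (prism_dom p q) n. F (zip \<theta> \<phi>))"

lemma simplices_prism_dom:
  "simplices (prism_dom p q) n = {(\<theta>, \<phi>). length \<theta> = Suc n \<and> length \<phi> = Suc n \<and>
     sorted \<theta> \<and> sorted \<phi> \<and> set \<theta> \<subseteq> {..p} \<and> set \<phi> \<subseteq> {..q}}"
  by (auto simp: sset_prod_def std_simplex_def nerve_def)

lemma grid_unzip:
  "l \<in> grid p q \<Longrightarrow> (map fst l, map snd l) \<in> simplices (prism_dom p q) (length l - 1)"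
  by (auto simp: grid_def simplices_prism_dom)

lemma grid_zip: "(\<theta>, \<phi>) \<in> simplices (prism_dom p q) n \<Longrightarrow> zip \<theta> \<phi> \<in> grid p q"
  by (cases \<theta>; cases \<phi>) (auto simp: grid_def simplices_prism_dom dest: set_zip_leftD set_zip_rightD)

lemma grid_op_comp:
  assumes "l \<in> grid p q" "length l = Suc n" "\<theta> \<in> ops m n"
  shows "op_comp l \<theta> \<in> grid p q"
proof -
  have "op_comp l \<theta> \<noteq> []" using length_op_comp[OF assms(3), of l] by auto
  moreover have "set (op_comp l \<theta>) \<subseteq> set l" using set_op_comp[OF assms(3,2)] .
  moreover have "sorted (map fst (op_comp l \<theta>))" "sorted (map snd (op_comp l \<theta>))"
    using sorted_op_comp[OF assms(3), of "map fst l"] sorted_op_comp[OF assms(3), of "map snd l"]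
      op_comp_map[OF assms(3,2), of fst] op_comp_map[OF assms(3,2), of snd] assms(1,2)
    by (auto simp: grid_def)
  ultimately show ?thesis using assms(1) by (auto simp: grid_def)
qed

lemma sev_section_of: "l \<in> grid p q \<Longrightarrow> sev (section_of p q F) l = F l"
  using grid_unzip[of l p q] by (simp add: sev_def section_of_def zip_map_fst_snd)

lemma section_of_cong:
  "(\<And>l. l \<in> grid p q \<Longrightarrow> F l = G l) \<Longrightarrow> section_of p q F = section_of p q G"
  unfolding section_of_def using grid_zip by (intro ext restrict_ext) fastforce

lemma simplices_section_space:
  assumes "length a = Suc p"
  shows "simplices (section_space X h a) q = {\<rho> \<in> simplicial_maps (prism_dom p q) X.
        \<forall>n. \<forall>(\<theta>, \<phi>)\<in>simplices (prism_dom p q) n. h n (\<rho> n (\<theta>, \<phi>)) = op_comp a \<theta>}"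
  using assms by (simp add: section_space_def)

text \<open>Rests on the extensionality of simplicial maps. Equality of sections thereby becomes
  equality of evaluations on \<open>grid\<close>.\<close>

lemma section_of_sev:
  assumes "\<rho> \<in> simplices (section_space X h a) q" "length a = Suc p"
  shows "section_of p q (sev \<rho>) = \<rho>"
proof (rule ext)
  fix n
  have "\<rho> n \<in> simplices (prism_dom p q) n \<rightarrow>\<^sub>E simplices X n"
    using assms by (simp add: simplices_section_space simplicial_maps_def)
  then have "\<rho> n \<in> extensional (simplices (prism_dom p q) n)" by (simp add: PiE_iff)
  then show "section_of p q (sev \<rho>) n = \<rho> n"
    unfolding section_of_def
    by (intro extensionalityI[of _ "simplices (prism_dom p q) n"])
      (auto simp: sev_def simplices_prism_dom)
qed

lemma sev_section:
  assumes "\<rho> \<in> simplices (section_space X h a) q" "length a = Suc p"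
    and "l \<in> grid p q" "length l = Suc n"
  shows "sev \<rho> l \<in> simplices X n"
    and "h n (sev \<rho> l) = map (\<lambda>x. a ! fst x) l"
    and "\<theta> \<in> ops m n \<Longrightarrow> act X n (sev \<rho> l) \<theta> = sev \<rho> (op_comp l \<theta>)"
proof -
  have s: "(map fst l, map snd l) \<in> simplices (prism_dom p q) n"
    using grid_unzip[OF assms(3)] assms(4) by simp
  have \<rho>: "\<rho> \<in> simplicial_maps (prism_dom p q) X"
    and hh: "h n (\<rho> n (map fst l, map snd l)) = op_comp a (map fst l)"
    using assms(1,2) s by (auto simp: simplices_section_space)
  show "sev \<rho> l \<in> simplices X n"
    using \<rho> s assms(4) by (auto simp: simplicial_maps_def sev_def)
  show "h n (sev \<rho> l) = map (\<lambda>x. a ! fst x) l"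
    using hh assms(4) by (simp add: sev_def op_comp_def)
  assume \<theta>: "\<theta> \<in> ops m n"
  have "\<rho> m (act (prism_dom p q) n (map fst l, map snd l) \<theta>) = act X n (\<rho> n (map fst l, map snd l)) \<theta>"
    using \<rho> s \<theta> unfolding simplicial_maps_def by blast
  moreover have "act (prism_dom p q) n (map fst l, map snd l) \<theta>
      = (map fst (op_comp l \<theta>), map snd (op_comp l \<theta>))"
    using op_comp_map[OF \<theta> assms(4), of fst] op_comp_map[OF \<theta> assms(4), of snd]
    by (simp add: sset_prod_def std_simplex_def nerve_def)
  ultimately show "act X n (sev \<rho> l) \<theta> = sev \<rho> (op_comp l \<theta>)"
    using assms(4) length_op_comp[OF \<theta>, of l] by (simp add: sev_def)
qed

text \<open>The tool for constructing sections: dimension, heights and compatibility with operators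
  are tested on lists of pairs, and \<open>zip\<close> translates back to pairs of lists.\<close>

lemma section_of_section:
  assumes "length a = Suc p"
    and "\<And>l n. l \<in> grid p q \<Longrightarrow> length l = Suc n \<Longrightarrow> F l \<in> simplices X n"
    and "\<And>l n. l \<in> grid p q \<Longrightarrow> length l = Suc n \<Longrightarrow> h n (F l) = map (\<lambda>x. a ! fst x) l"
    and "\<And>l n m \<theta>. l \<in> grid p q \<Longrightarrow> length l = Suc n \<Longrightarrow> \<theta> \<in> ops m n \<Longrightarrow>
      act X n (F l) \<theta> = F (op_comp l \<theta>)"
  shows "section_of p q F \<in> simplices (section_space X h a) q"
proof -
  have z: "length (zip \<theta> \<phi>) = Suc n" "map fst (zip \<theta> \<phi>) = \<theta>" "map snd (zip \<theta> \<phi>) = \<phi>"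
    if "(\<theta>, \<phi>) \<in> simplices (prism_dom p q) n" for \<theta> \<phi> n
    using that by (auto simp: simplices_prism_dom)
  have act: "act (prism_dom p q) n (\<theta>, \<phi>) \<psi> = (op_comp \<theta> \<psi>, op_comp \<phi> \<psi>)" for n \<theta> \<phi> \<psi>
    by (simp add: sset_prod_def std_simplex_def nerve_def)
  have "section_of p q F \<in> simplicial_maps (prism_dom p q) X"
    unfolding simplicial_maps_def
  proof (intro CollectI conjI allI ballI)
    fix n
    show "section_of p q F n \<in> simplices (prism_dom p q) n \<rightarrow>\<^sub>E simplices X n"
      unfolding section_of_def using assms(2) grid_zip z(1)
      by (intro restrict_PiE_iff[THEN iffD2]) auto
  next
    fix m n \<psi> x assume \<psi>: "\<psi> \<in> ops m n" and x: "x \<in> simplices (prism_dom p q) n"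
    obtain \<theta> \<phi> where xe: "x = (\<theta>, \<phi>)" by (cases x)
    let ?l = "zip \<theta> \<phi>"
    have l: "?l \<in> grid p q" "length ?l = Suc n" using x grid_zip z(1) xe by auto
    have "op_comp ?l \<psi> \<in> grid p q" by (rule grid_op_comp[OF l \<psi>])
    moreover have "map fst (op_comp ?l \<psi>) = op_comp \<theta> \<psi>" "map snd (op_comp ?l \<psi>) = op_comp \<phi> \<psi>"
      using op_comp_map[OF \<psi> l(2), of fst] op_comp_map[OF \<psi> l(2), of snd] z(2,3) x xe by auto
    ultimately have "(op_comp \<theta> \<psi>, op_comp \<phi> \<psi>) \<in> simplices (prism_dom p q) m"
      "zip (op_comp \<theta> \<psi>) (op_comp \<phi> \<psi>) = op_comp ?l \<psi>"
      using grid_unzip[of "op_comp ?l \<psi>" p q] length_op_comp[OF \<psi>, of ?l]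
      by (auto simp: zip_map_fst_snd) (metis zip_map_fst_snd)
    then show "section_of p q F m (act (prism_dom p q) n x \<psi>) = act X n (section_of p q F n x) \<psi>"
      using assms(4)[OF l \<psi>] x unfolding xe act by (simp add: section_of_def)
  qed
  moreover have "h n (section_of p q F n (\<theta>, \<phi>)) = op_comp a \<theta>"
    if x: "(\<theta>, \<phi>) \<in> simplices (prism_dom p q) n" for n \<theta> \<phi>
  proof -
    have "h n (F (zip \<theta> \<phi>)) = map ((!) a) (map fst (zip \<theta> \<phi>))"
      using assms(3)[OF grid_zip[OF x] z(1)[OF x]] by (simp add: comp_def)
    then show ?thesis using x z(2)[OF x] by (simp add: section_of_def op_comp_def)
  qed
  ultimately show ?thesis using assms(1) by (auto simp: simplices_section_space)
qed

lemma precomp_eq_section_of: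
  "precomp p' q' \<alpha> \<beta> \<rho> = section_of p' q' (\<lambda>l. sev \<rho> (map (\<lambda>(e, v). (\<alpha> ! e, \<beta> ! v)) l))"
proof -
  have "\<rho> n (op_comp \<alpha> \<theta>, op_comp \<beta> \<phi>) = sev \<rho> (map (\<lambda>(e, v). (\<alpha> ! e, \<beta> ! v)) (zip \<theta> \<phi>))"
    if "(\<theta>, \<phi>) \<in> simplices (prism_dom p' q') n" for n \<theta> \<phi>
  proof -
    have "length \<theta> = Suc n" "length \<phi> = Suc n" using that by (auto simp: simplices_prism_dom)
    then have "map fst (map (\<lambda>(e, v). (\<alpha> ! e, \<beta> ! v)) (zip \<theta> \<phi>)) = op_comp \<alpha> \<theta>"
      "map snd (map (\<lambda>(e, v). (\<alpha> ! e, \<beta> ! v)) (zip \<theta> \<phi>)) = op_comp \<beta> \<phi>"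
      "length (zip \<theta> \<phi>) = Suc n"
      by (auto simp: op_comp_def intro!: nth_equalityI)
    then show ?thesis by (simp add: sev_def)
  qed
  then show ?thesis unfolding precomp_def section_of_def by (intro ext restrict_ext) auto
qed

lemma grid_map:
  assumes "l \<in> grid p' q'" "\<alpha> \<in> ops p' p" "\<beta> \<in> ops q' q"
  shows "map (\<lambda>(e, v). (\<alpha> ! e, \<beta> ! v)) l \<in> grid p q"
proof -
  have \<alpha>: "\<alpha> ! e \<le> p" "e \<le> e' \<Longrightarrow> e' \<le> p' \<Longrightarrow> \<alpha> ! e \<le> \<alpha> ! e'" if "e \<le> p'" for e e'
    using that assms(2) by (auto simp: ops_def subset_iff sorted_iff_nth_mono)
  have \<beta>: "\<beta> ! e \<le> q" "e \<le> e' \<Longrightarrow> e' \<le> q' \<Longrightarrow> \<beta> ! e \<le> \<beta> ! e'" if "e \<le> q'" for e e'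
    using that assms(3) by (auto simp: ops_def subset_iff sorted_iff_nth_mono)
  have s: "sorted_wrt (\<lambda>x y. fst x \<le> fst y) l" "sorted_wrt (\<lambda>x y. snd x \<le> snd y) l"
    and b: "\<And>x. x \<in> set l \<Longrightarrow> fst x \<le> p' \<and> snd x \<le> q'"
    using assms(1) by (auto simp: grid_def sorted_map)
  have "sorted (map fst (map (\<lambda>(e, v). (\<alpha> ! e, \<beta> ! v)) l))"
    unfolding map_map sorted_map by (rule sorted_wrt_mono_rel[OF _ s(1)]) (use b \<alpha> in \<open>auto simp: split_def\<close>)
  moreover have "sorted (map snd (map (\<lambda>(e, v). (\<alpha> ! e, \<beta> ! v)) l))"
    unfolding map_map sorted_map by (rule sorted_wrt_mono_rel[OF _ s(2)]) (use b \<beta> in \<open>auto simp: split_def\<close>)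
  ultimately show ?thesis using assms(1) \<alpha> \<beta> by (auto simp: grid_def)
qed

lemma precomp_section:
  assumes "\<rho> \<in> simplices (section_space X h a) q" "length a = Suc p"
    and "\<alpha> \<in> ops p' p" "\<beta> \<in> ops q' q"
  shows "precomp p' q' \<alpha> \<beta> \<rho> \<in> simplices (section_space X h (op_comp a \<alpha>)) q'"
    and "l \<in> grid p' q' \<Longrightarrow> sev (precomp p' q' \<alpha> \<beta> \<rho>) l = sev \<rho> (map (\<lambda>(e, v). (\<alpha> ! e, \<beta> ! v)) l)"
proof -
  show "precomp p' q' \<alpha> \<beta> \<rho> \<in> simplices (section_space X h (op_comp a \<alpha>)) q'"
    unfolding precomp_eq_section_of
  proof (rule section_of_section)
    show "length (op_comp a \<alpha>) = Suc p'" using assms(3) by (simp add: op_comp_def ops_def)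
    fix l n assume l: "l \<in> grid p' q'" "length l = Suc n"
    let ?l = "map (\<lambda>(e, v). (\<alpha> ! e, \<beta> ! v)) l"
    have g: "?l \<in> grid p q" "length ?l = Suc n" using grid_map[OF l(1) assms(3,4)] l(2) by auto
    show "sev \<rho> ?l \<in> simplices X n" by (rule sev_section(1)[OF assms(1,2) g])
    have "set l \<subseteq> {..p'} \<times> {..q'}" using l by (auto simp: grid_def)
    then show "h n (sev \<rho> ?l) = map (\<lambda>x. op_comp a \<alpha> ! fst x) l"
      unfolding sev_section(2)[where h = h, OF assms(1,2) g] using assms(3)
      by (auto simp: op_comp_def ops_def)
    fix m \<theta> assume \<theta>: "\<theta> \<in> ops m n"
    show "act X n (sev \<rho> ?l) \<theta> = sev \<rho> (map (\<lambda>(e, v). (\<alpha> ! e, \<beta> ! v)) (op_comp l \<theta>))"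
      unfolding sev_section(3)[OF assms(1,2) g \<theta>] op_comp_map[OF \<theta> l(2)] ..
  qed
  show "l \<in> grid p' q' \<Longrightarrow> sev (precomp p' q' \<alpha> \<beta> \<rho>) l = sev \<rho> (map (\<lambda>(e, v). (\<alpha> ! e, \<beta> ! v)) l)"
    unfolding precomp_eq_section_of by (rule sev_section_of)
qed

lemma section_eqI:
  assumes "\<rho> \<in> simplices (section_space X h a) q" "\<rho>' \<in> simplices (section_space X h a) q"
    and "length a = Suc p" "\<And>l. l \<in> grid p q \<Longrightarrow> sev \<rho> l = sev \<rho>' l"
  shows "\<rho> = \<rho>'"
proof -
  have "section_of p q (sev \<rho>) = section_of p q (sev \<rho>')"
    by (rule section_of_cong) (rule assms(4))
  then show ?thesis unfolding section_of_sev[OF assms(1,3)] section_of_sev[OF assms(2,3)] .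
qed

lemma simplices_sections:
  "simplices (sections X h p) q
    = {(a, \<rho>). length a = Suc p \<and> sorted a \<and> \<rho> \<in> simplices (section_space X h a) q}"
  by (auto simp: sections_def sset_coprod_def real_line_def nerve_def)

lemma act_sections:
  "length a = Suc p \<Longrightarrow> act (sections X h p) q (a, \<rho>) \<beta> = (a, precomp p (length \<beta> - 1) (op_id p) \<beta> \<rho>)"
  by (simp add: sections_def sset_coprod_def section_space_def)

lemma simplicial_set_sections: "simplicial_set (sections X h p)"
  unfolding simplicial_set_def
proof (intro conjI allI ballI)
  fix m n \<theta> x assume \<theta>: "\<theta> \<in> ops m n" and "x \<in> simplices (sections X h p) n"
  then obtain a \<rho> where x: "x = (a, \<rho>)" and a: "length a = Suc p" "sorted a"
    and \<rho>: "\<rho> \<in> simplices (section_space X h a) n" by (auto simp: simplices_sections)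
  then show "act (sections X h p) n x \<theta> \<in> simplices (sections X h p) m"
    using precomp_section(1)[OF \<rho> a(1) op_id_ops \<theta>] op_comp_op_id[OF a(1)] \<theta>
    by (simp add: act_sections simplices_sections ops_def)
next
  fix n x assume "x \<in> simplices (sections X h p) n"
  then obtain a \<rho> where x: "x = (a, \<rho>)" and a: "length a = Suc p" "sorted a"
    and \<rho>: "\<rho> \<in> simplices (section_space X h a) n" by (auto simp: simplices_sections)
  have "section_of p n (\<lambda>l. sev \<rho> (map (\<lambda>(e, v). (op_id p ! e, op_id n ! v)) l)) = section_of p n (sev \<rho>)"
  proof (rule section_of_cong)
    fix l assume "l \<in> grid p n"
    then have "map (\<lambda>(e, v). (op_id p ! e, op_id n ! v)) l = l"
      by (intro map_idI) (auto simp: grid_def op_id_def simp del: upt_Suc)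
    then show "sev \<rho> (map (\<lambda>(e, v). (op_id p ! e, op_id n ! v)) l) = sev \<rho> l" by simp
  qed
  then show "act (sections X h p) n x (op_id n) = x"
    using section_of_sev[OF \<rho> a(1)] a
    by (simp add: x act_sections precomp_eq_section_of op_id_def[of n])
next
  fix l m n \<theta> \<phi> x assume \<theta>: "\<theta> \<in> ops m n" and \<phi>: "\<phi> \<in> ops l m" and "x \<in> simplices (sections X h p) n"
  then obtain a \<rho> where x: "x = (a, \<rho>)" and a: "length a = Suc p" "sorted a"
    and \<rho>: "\<rho> \<in> simplices (section_space X h a) n" by (auto simp: simplices_sections)
  have len: "length \<theta> = Suc m" "length \<phi> = Suc l" "length (op_comp \<theta> \<phi>) = Suc l"
    using \<theta> \<phi> by (auto simp: ops_def op_comp_def)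
  have "precomp p l (op_id p) \<phi> (precomp p m (op_id p) \<theta> \<rho>) = precomp p l (op_id p) (op_comp \<theta> \<phi>) \<rho>"
    unfolding precomp_eq_section_of[of p l]
  proof (rule section_of_cong)
    fix k assume k: "k \<in> grid p l"
    note k' = grid_map[OF k op_id_ops \<phi>]
    have E: "map (\<lambda>(e, v). (op_id p ! e, \<theta> ! v)) (map (\<lambda>(e, v). (op_id p ! e, \<phi> ! v)) k)
       = map (\<lambda>(e, v). (op_id p ! e, op_comp \<theta> \<phi> ! v)) k"
      using k \<phi> by (auto simp: grid_def op_id_def op_comp_def ops_def simp del: upt_Suc)
    show "sev (precomp p m (op_id p) \<theta> \<rho>) (map (\<lambda>(e, v). (op_id p ! e, \<phi> ! v)) k)
      = sev \<rho> (map (\<lambda>(e, v). (op_id p ! e, op_comp \<theta> \<phi> ! v)) k)"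
      unfolding precomp_section(2)[OF \<rho> a(1) op_id_ops \<theta> k'] E ..
  qed
  then show "act (sections X h p) m (act (sections X h p) n x \<theta>) \<phi>
      = act (sections X h p) n x (op_comp \<theta> \<phi>)"
    using a len by (simp add: x act_sections)
qed


section \<open>The triangulated prism over a simplex and simplicial homotopies\<close>

abbreviation diag :: "nat \<Rightarrow> (nat \<times> nat) list" where
  "diag q \<equiv> map (\<lambda>k. (k, k)) [0..<Suc q]"

lemma sorted_wrt_conj: "sorted_wrt (\<lambda>x y. P x y \<and> Q x y) l \<longleftrightarrow> sorted_wrt P l \<and> sorted_wrt Q l"
  by (induction l) auto

text \<open>Nonempty chains in the model \<open>[1] \<times> [q]\<close> are simplices of the
  product of the 1-simplex and the \<open>q\<close>-simplex; this links models with sections over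
  two levels.\<close>

lemma chainm_TM: "l \<noteq> [] \<Longrightarrow> chainm (TM q) l \<longleftrightarrow> l \<in> grid (Suc 0) q"
proof -
  assume "l \<noteq> []"
  have "mle (TM q) = (\<lambda>x y. fst x \<le> fst y \<and> snd x \<le> snd y)" by (intro ext) simp
  moreover have "nodes (TM q) = {..Suc 0} \<times> {..q}" by auto
  ultimately show ?thesis using \<open>l \<noteq> []\<close>
    by (simp add: chainm_def grid_def sorted_wrt_conj sorted_map)
qed

lemma inhom_diag: "inhom (TM q) (TC (diag q))"
  using inhom_iota[of "TM q"] by simp

lemma keys_prism_diag:
  assumes "w \<in> Poly_Mapping.keys (prisml (diag q) :: _ \<Rightarrow>\<^sub>0 'k::field)"
  shows "w \<in> grid (Suc 0) q" "length w = Suc (Suc q)" "mixed w"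
proof -
  obtain k where k: "k < length (diag q)" "w = lower (take (Suc k) (diag q)) @ upper (drop k (diag q))"
    using subsetD[OF keys_prism assms] by auto
  show len: "length w = Suc (Suc q)" using k by simp
  then have "w \<noteq> []" by auto
  moreover have "chainm (TM q) w" unfolding k(2) by (rule chainm_prism[OF inhom_diag])
  ultimately show "w \<in> grid (Suc 0) q" using chainm_TM by blast
  have "take (Suc k) (diag q) \<noteq> []" "drop k (diag q) \<noteq> []" using k(1) by auto
  then obtain x xs y ys where "take (Suc k) (diag q) = x # xs" "drop k (diag q) = y # ys"
    by (metis list.exhaust)
  then show "mixed w" unfolding k(2) mixed_def by (cases x; cases y) (simp del: upt_Suc)
qed

lemma rmn_map: "rmn i (map f l) = map f (rmn i l)"
  by (simp add: rmn_def take_map drop_map)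

lemma rmn_op_id: "i \<le> Suc n \<Longrightarrow> rmn i [0..<Suc (Suc n)] = coface n i"
  using op_comp_coface[of "op_id (Suc n)" n i] op_id_comp[OF coface_ops[of i n]]
  by (simp add: op_id_def del: upt_Suc)

lemma coface_eq: "coface n i = map (\<lambda>k. coface n i ! k) [0..<Suc n]"
  by (metis coface_def length_map length_upt map_nth diff_zero)

text \<open>Deleting a pair restricts the base of the prism along a coface. This matches the list
  boundary of the base with the faces in the \<open>q\<close> direction.\<close>

lemma rmn_diag:
  "i \<le> Suc n \<Longrightarrow> rmn i (diag (Suc n)) = map (\<lambda>(a, b). (coface n i ! a, coface n i ! b)) (diag n)"
  by (subst rmn_map, subst rmn_op_id, assumption, subst coface_eq) (simp del: upt_Suc)

lemma lift_bdl_diag: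
  "lift F (bdl (diag (Suc n))) = (\<Sum>i\<le>Suc n. pscale ((-1) ^ i) (F (rmn i (diag (Suc n)))))"
proof -
  have "{..<length (diag (Suc n))} = {..Suc n}" by auto
  then show ?thesis by (simp add: bdl_def lift_sum lift_scale del: upt_Suc sum.atMost_Suc)
qed

text \<open>A family \<open>E q z\<close> of simplicial maps \<open>\<Delta>\<^sup>1 \<times> \<Delta>\<^sup>q \<rightarrow> Y\<close>, natural in the simplex
  \<open>z \<in> Z\<^sub>q\<close>, is a simplicial homotopy; this is the induced chain homotopy.\<close>

lemma prism_homotopy:
  fixes E :: "nat \<Rightarrow> 'z \<Rightarrow> (nat \<times> nat) list \<Rightarrow> 'y" and Z :: "'z sset" and Y :: "'y sset"
  defines "H \<equiv> \<lambda>q z. lift (\<lambda>w. sing (E q z w)) (prisml (diag q)) :: 'y \<Rightarrow>\<^sub>0 'k::field"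
  assumes nat1: "\<And>l i. l \<in> grid (Suc 0) q \<Longrightarrow> length l = Suc (Suc q) \<Longrightarrow> i \<le> Suc q \<Longrightarrow>
      act Y (Suc q) (E q z l) (coface q i) = E q z (rmn i l)"
    and nat2: "\<And>m i w. q = Suc m \<Longrightarrow> i \<le> Suc m \<Longrightarrow> w \<in> grid (Suc 0) m \<Longrightarrow>
      E m (act Z q z (coface m i)) w = E q z (map (\<lambda>(e, v). (e, coface m i ! v)) w)"
  shows "lift (bds Y (Suc q)) (H q z) + lift (H (q - 1)) (bds Z q z)
    = sing (E q z (upper (diag q))) - sing (E q z (lower (diag q)))"
proof -
  let ?S = "lift (\<lambda>w. sing (E q z w)) :: _ \<Rightarrow> 'y \<Rightarrow>\<^sub>0 'k"
  have 1: "lift (bds Y (Suc q)) (H q z) = ?S (lift bdl (prisml (diag q)))"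
    unfolding H_def lift_lift lift_sing
    by (intro lift_cong bds_eval keys_prism_diag(2) nat1 keys_prism_diag(1)) auto
  \<comment> \<open>A deletion in the base gives the prism over a smaller diagonal, relabelled by a
    coface; \<open>nat2\<close> absorbs the relabelling into the face of \<open>z\<close>.\<close>
  have 2: "lift (H (q - 1)) (bds Z q z) = ?S (lift prisml (bdl (diag q)))"
  proof (cases q)
    case 0
    then show ?thesis by simp
  next
    case (Suc m)
    have "H m (act Z q z (coface m i)) = ?S (prisml (rmn i (diag q)))" if i: "i \<le> Suc m" for i
    proof -
      have "?S (prisml (rmn i (diag q)))
          = lift (\<lambda>w. sing (E q z (map (\<lambda>(e, v). (e, coface m i ! v)) w))) (prisml (diag m))"
        unfolding Suc rmn_diag[OF i] prism_map lift_lift by simp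
      also have "\<dots> = H m (act Z q z (coface m i))"
        unfolding H_def by (rule lift_cong) (simp add: nat2[OF Suc i keys_prism_diag(1)])
      finally show ?thesis ..
    qed
    then have "lift (H m) (bds Z q z) = (\<Sum>i\<le>Suc m. pscale ((-1) ^ i) (?S (prisml (rmn i (diag q)))))"
      unfolding Suc bds_def by (simp add: lift_sum lift_scale lift_add del: sum.atMost_Suc upt_Suc)
    also have "\<dots> = lift (\<lambda>w. ?S (prisml w)) (bdl (diag q))"
      unfolding Suc lift_bdl_diag ..
    finally show ?thesis by (simp add: Suc lift_lift)
  qed
  show ?thesis
    unfolding 1 2 lift_add[symmetric] prism_bdl by (simp add: lift_diff del: upt_Suc)
qed


section \<open>Sections over two levels compute the mixed chains\<close>

text \<open>Basis of the cone attached to X; a generator amounts to a map from a model to X.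
  \<open>QB\<close> records \<open>i\<close> and \<open>j\<close> so that the model can be read off,
  see \<open>gmod\<close>; for valid generators \<open>toQ\<close> recovers them from the
  heights.\<close>

datatype 'x gen = TB nat "real list \<times> 'x prism" | QB nat nat 'x

locale subdivided_height =
  fixes X :: "'x sset" and h :: "nat \<Rightarrow> 'x \<Rightarrow> real list"
  assumes X: "simplicial_set X"
    and h: "height_function X h"
    and subdiv: "subdivided X h"
begin

lemma height:
  assumes "x \<in> simplices X n"
  shows "length (h n x) = Suc n" "sorted (h n x)"
    "\<theta> \<in> ops m n \<Longrightarrow> h m (act X n x \<theta>) = op_comp (h n x) \<theta>"
  using h assms by (auto simp: height_function_def simplicial_maps_def real_line_def nerve_def PiE_iff)

text \<open>A vertex strictly between the end heights provides a height level between them. The edge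
  joining the first and the last vertex is then a section over \<open>[a, b]\<close>, which
  subdivision forbids.\<close>

lemma two_levels:
  assumes x: "x \<in> simplices X n" and "k \<le> n"
  shows "h n x ! k = h n x ! 0 \<or> h n x ! k = h n x ! n"
proof (rule ccontr)
  assume neg: "\<not> ?thesis"
  define a b c where "a = h n x ! 0" and "b = h n x ! n" and "c = h n x ! k"
  have "a \<le> c" "c \<le> b" unfolding a_def b_def c_def
    using height(1,2)[OF x] \<open>k \<le> n\<close> by (auto intro: sorted_nth_mono)
  with neg have ac: "a < c" "c < b" by (auto simp: a_def b_def c_def)
  have k: "[k] \<in> ops 0 n" using \<open>k \<le> n\<close> by (simp add: ops_def)
  have "h 0 (act X n x [k]) = [c]" using height(3)[OF x k] by (simp add: op_comp_def c_def)
  moreover have "act X n x [k] \<in> simplices X 0" using simplicial_setD(1)[OF X x k] .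
  ultimately have "c \<in> height_levels X h" unfolding height_levels_def by (auto intro!: image_eqI)
  then have "simplices (section_space X h [a, b]) 0 = {}"
    using subdiv ac unfolding subdivided_def by blast
  \<comment> \<open>The vertex map from \<open>[1] \<times> [0]\<close> to \<open>[n]\<close> whose
    image consists of the two end vertices.\<close>
  moreover define f :: "nat \<times> nat \<Rightarrow> nat" where "f = (\<lambda>(e, v). if e = 0 then 0 else n)"
  have f_ops: "map f l \<in> ops N n" if "l \<in> grid (Suc 0) 0" "length l = Suc N" for l N
    using that by (auto simp: ops_def grid_def sorted_map f_def split_def
        elim!: sorted_wrt_mono_rel[rotated])
  have "section_of (Suc 0) 0 (\<lambda>l. act X n x (map f l)) \<in> simplices (section_space X h [a, b]) 0"
  proof (rule section_of_section)
    fix l N assume l: "l \<in> grid (Suc 0) 0" "length l = Suc N"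
    show "act X n x (map f l) \<in> simplices X N" by (rule simplicial_setD(1)[OF X x f_ops[OF l]])
    have "fst y = 0 \<or> fst y = Suc 0" if "y \<in> set l" for y
      using that l by (fastforce simp: grid_def)
    then show "h N (act X n x (map f l)) = map (\<lambda>y. [a, b] ! fst y) l"
      unfolding height(3)[OF x f_ops[OF l]]
      by (fastforce simp: op_comp_def f_def a_def b_def split_def)
    fix m \<theta> assume \<theta>: "\<theta> \<in> ops m N"
    show "act X N (act X n x (map f l)) \<theta> = act X n x (map f (op_comp l \<theta>))"
      unfolding simplicial_setD(3)[OF X x f_ops[OF l] \<theta>] op_comp_map[OF \<theta> l(2)] ..
  qed simp
  ultimately show False by simp
qed

section \<open>Generators as maps from models to X, and the action of cells on them\<close>

fun gmod :: "'x gen \<Rightarrow> model" where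
  "gmod (TB q s) = TM q"
| "gmod (QB i j x) = QM i j"

fun gval :: "'x gen \<Rightarrow> bool" where
  "gval (TB q (a, \<rho>)) \<longleftrightarrow> length a = Suc (Suc 0) \<and> a ! 0 < a ! Suc 0 \<and> \<rho> \<in> simplices (section_space X h a) q"
| "gval (QB i j x) \<longleftrightarrow> x \<in> simplices X (Suc (i + j)) \<and>
    (\<exists>a b. a < b \<and> h (Suc (i + j)) x = replicate (Suc i) a @ replicate (Suc j) b)"

fun lev :: "'x gen \<Rightarrow> real list" where
  "lev (TB q s) = fst s"
| "lev (QB i j x) = [h (Suc (i + j)) x ! 0, h (Suc (i + j)) x ! Suc (i + j)]"

text \<open>The identification of the join of \<open>[i]\<close> and \<open>[j]\<close> with
  \<open>[i + j + 1]\<close>.\<close>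

abbreviation pos :: "nat \<Rightarrow> nat \<times> nat \<Rightarrow> nat" where
  "pos i \<equiv> \<lambda>(e, v). if e = 0 then v else Suc i + v"

fun ev :: "'x gen \<Rightarrow> (nat \<times> nat) list \<Rightarrow> 'x" where
  "ev (TB q s) l = sev (snd s) l"
| "ev (QB i j x) l = act X (Suc (i + j)) x (map (pos i) l)"

text \<open>Composition of a generator with a cell of its model, the kind of the result being
  dictated by the source of the cell. By \<open>gact_gact\<close> and \<open>gact_iota\<close> this
  is a right action.\<close>

fun gact :: "'x gen \<Rightarrow> cell \<Rightarrow> 'x gen" where
  "gact g (TC u) = TB (length u - 1)
    (lev g, section_of (Suc 0) (length u - 1) (\<lambda>l. ev g (map (vmap (TC u)) l)))"
| "gact g (QC l) = QB (n0 l - 1) (length l - n0 l - 1) (ev g l)"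

lemma lev_gval:
  assumes "gval g"
  shows "length (lev g) = Suc (Suc 0)" "lev g ! 0 < lev g ! Suc 0"
proof -
  have "length (lev g) = Suc (Suc 0) \<and> lev g ! 0 < lev g ! Suc 0"
  proof (cases g)
    case (TB q s)
    then show ?thesis using assms by (cases s) simp
  next
    case (QB i j x)
    then obtain a b where "a < b" "h (Suc (i + j)) x = replicate (Suc i) a @ replicate (Suc j) b"
      using assms by auto
    then show ?thesis by (simp add: QB nth_append del: replicate_Suc)
  qed
  then show "length (lev g) = Suc (Suc 0)" "lev g ! 0 < lev g ! Suc 0" by auto
qed

lemma pos_ops:
  assumes "chainm (QM i j) l" "length l = Suc n"
  shows "map (pos i) l \<in> ops n (Suc (i + j))"
proof -
  have nd: "fst x = 0 \<and> snd x \<le> i \<or> fst x = Suc 0 \<and> snd x \<le> j" if "x \<in> set l" for x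
    using that assms(1) by (force simp: chainm_def)
  have s: "sorted_wrt (mle (QM i j)) l" using assms(1) by (simp add: chainm_def)
  have "sorted_wrt (\<lambda>x y. pos i x \<le> pos i y) l"
    by (rule sorted_wrt_mono_rel[OF _ s]) (use nd in \<open>fastforce simp: split_def\<close>)
  then show ?thesis using assms(2) nd
    by (fastforce simp: ops_def sorted_map split_def)
qed

lemma ev_gval:
  assumes "gval g" "chainm (gmod g) l" "length l = Suc n"
  shows "ev g l \<in> simplices X n"
    and "h n (ev g l) = map (\<lambda>x. lev g ! fst x) l"
    and "\<theta> \<in> ops m n \<Longrightarrow> act X n (ev g l) \<theta> = ev g (op_comp l \<theta>)"
proof -
  have ne: "l \<noteq> []" using assms(3) by auto
  have "ev g l \<in> simplices X n \<and> h n (ev g l) = map (\<lambda>x. lev g ! fst x) l \<and>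
    (\<theta> \<in> ops m n \<longrightarrow> act X n (ev g l) \<theta> = ev g (op_comp l \<theta>))"
  proof (cases g)
    case (TB q s)
    obtain a \<rho> where s: "s = (a, \<rho>)" by (cases s)
    have a: "length a = Suc (Suc 0)" and \<rho>: "\<rho> \<in> simplices (section_space X h a) q"
      using assms(1) by (auto simp: TB s)
    have l: "l \<in> grid (Suc 0) q" using assms(2) chainm_TM[OF ne] by (simp add: TB)
    show ?thesis using sev_section[OF \<rho> a l assms(3)] by (simp add: TB s)
  next
    case (QB i j x)
    have x: "x \<in> simplices X (Suc (i + j))" using assms(1) by (simp add: QB)
    have p: "map (pos i) l \<in> ops n (Suc (i + j))"
      using pos_ops assms(2,3) by (simp add: QB)
    obtain a b where ab: "a < b" "h (Suc (i + j)) x = replicate (Suc i) a @ replicate (Suc j) b"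
      using assms(1) by (auto simp: QB)
    have "(replicate (Suc i) a @ replicate (Suc j) b) ! pos i y = lev g ! fst y" if "y \<in> set l" for y
    proof -
      have "y \<in> nodes (QM i j)" using that assms(2) by (auto simp: QB chainm_def)
      then show ?thesis unfolding QB lev.simps ab by (auto simp: nth_append simp del: replicate_Suc)
    qed
    then have "h n (ev g l) = map (\<lambda>x. lev g ! fst x) l"
      using height(3)[OF x p] by (simp add: QB ab(2) op_comp_def)
    moreover have "act X n (ev g l) \<theta> = ev g (op_comp l \<theta>)" if \<theta>: "\<theta> \<in> ops m n"
      using simplicial_setD(3)[OF X x p \<theta>] op_comp_map[OF \<theta> assms(3), of "pos i"]
      unfolding QB ev.simps by (simp only:)
    ultimately show ?thesis using simplicial_setD(1)[OF X x p] by (simp add: QB)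
  qed
  then show "ev g l \<in> simplices X n" "h n (ev g l) = map (\<lambda>x. lev g ! fst x) l"
    "\<theta> \<in> ops m n \<Longrightarrow> act X n (ev g l) \<theta> = ev g (op_comp l \<theta>)" by auto
qed

lemma gmod_gact [simp]: "gmod (gact g c) = src c"
  by (cases c) auto

lemma op_comp_vmap:
  assumes "inhom m (QC k)" "chainm (src (QC k)) l"
  shows "op_comp k (map (pos (n0 k - 1)) l) = map (vmap (QC k)) l"
proof -
  have "k ! pos (n0 k - 1) y = vmap (QC k) y" if "y \<in> set l" for y
  proof -
    have y: "y \<in> nodes (src (QC k))" using that assms(2) by (auto simp: chainm_def)
    show ?thesis using vmap_QC(1)[OF assms(1) y] n0_bounds[of k] assms(1) by (auto simp: split_def)
  qed
  then show ?thesis by (simp add: op_comp_def)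
qed

lemma length_QC:
  assumes "inhom m (QC l)"
  shows "length l = Suc (Suc ((n0 l - 1) + (length l - n0 l - 1)))"
  using n0_bounds[of l] assms by auto

lemma ev_gact:
  assumes "gval g" "inhom (gmod g) c" "chainm (src c) l" "l \<noteq> []"
  shows "ev (gact g c) l = ev g (map (vmap c) l)"
proof (cases c)
  case (TC u)
  have "l \<in> grid (Suc 0) (length u - 1)" using chainm_TM[OF assms(4)] assms(3) by (simp add: TC)
  then show ?thesis by (simp add: TC sev_section_of)
next
  case (QC k)
  obtain n where n: "length l = Suc n" using assms(4) by (cases l) auto
  have k: "chainm (gmod g) k" "inhom (gmod g) (QC k)" using assms(2) by (auto simp: QC)
  have p: "map (pos (n0 k - 1)) l \<in> ops n (Suc ((n0 k - 1) + (length k - n0 k - 1)))"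
    by (rule pos_ops) (use assms(3) n in \<open>simp_all add: QC\<close>)
  show ?thesis
    using ev_gval(3)[OF assms(1) k(1) length_QC[OF k(2)] p] op_comp_vmap[OF k(2)] assms(3)
    by (simp add: QC del: One_nat_def)
qed

text \<open>Tags increase along a chain, so its two ends decide. This matches \<open>mixed\<close>
  for lists with \<open>mixedX\<close> for simplices, which compares the end heights.\<close>

lemma hd_last_mixed:
  assumes "chainm m l" "length l = Suc n"
  shows "mixed l \<longleftrightarrow> fst (l ! 0) = 0 \<and> fst (l ! n) = Suc 0"
    and "\<not> mixed l \<Longrightarrow> fst (l ! 0) = fst (l ! n)"
proof -
  note t = chainm_tags[OF assms(1)]
  have nth: "fst (l ! 0) = (if 0 < n0 l then 0 else Suc 0)" "fst (l ! n) = (if n < n0 l then 0 else Suc 0)"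
    by (rule tag_nth[OF t]; use assms(2) in simp)+
  have mem: "l ! 0 \<in> set l" "l ! n \<in> set l" using assms(2) by simp_all
  have "mixed l" if "fst (l ! 0) = 0 \<and> fst (l ! n) = Suc 0"
    unfolding mixed_def using that mem by (metis imageI)
  moreover have "fst (l ! 0) = 0 \<and> fst (l ! n) = Suc 0" if "mixed l"
    using n0_bounds[OF that] nth assms(2) by auto
  moreover have "n0 l \<le> length l" by (simp add: n0_def)
  ultimately show *: "mixed l \<longleftrightarrow> fst (l ! 0) = 0 \<and> fst (l ! n) = Suc 0" by blast
  show "\<not> mixed l \<Longrightarrow> fst (l ! 0) = fst (l ! n)"
    using * nth by (auto split: if_splits)
qed

lemma map_tags:
  assumes "inhom m (QC l)"
  shows "map (\<lambda>x. a ! fst x) l = replicate (n0 l) (a ! 0) @ replicate (length l - n0 l) (a ! Suc 0)"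
  by (rule nth_equalityI)
    (use tag_nth[OF chainm_tags[of m l]] n0_bounds[of l] assms in \<open>auto simp: nth_append\<close>)

lemma gact_gval:
  assumes "gval g" "inhom (gmod g) c"
  shows "gval (gact g c)" "lev (gact g c) = lev g"
proof -
  have "gval (gact g c) \<and> lev (gact g c) = lev g"
  proof (cases c)
    case (TC u)
    have "section_of (Suc 0) (length u - 1) (\<lambda>l. ev g (map (vmap (TC u)) l))
      \<in> simplices (section_space X h (lev g)) (length u - 1)"
    proof (rule section_of_section[OF lev_gval(1)[OF assms(1)]])
      fix l n assume l: "l \<in> grid (Suc 0) (length u - 1)" "length l = Suc n"
      have ne: "l \<noteq> []" using l(2) by auto
      have cu: "chainm (gmod g) (map (vmap (TC u)) l)"
        by (rule chainm_push) (use assms(2) l(1) chainm_TM[OF ne] in \<open>simp_all add: TC\<close>)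
      note e = ev_gval[OF assms(1) cu, of n]
      show "ev g (map (vmap (TC u)) l) \<in> simplices X n" using e(1) l(2) by simp
      show "h n (ev g (map (vmap (TC u)) l)) = map (\<lambda>x. lev g ! fst x) l"
        using e(2) l(2) by (simp add: vmap_def split_def)
      fix m \<theta> assume \<theta>: "\<theta> \<in> ops m n"
      show "act X n (ev g (map (vmap (TC u)) l)) \<theta> = ev g (map (vmap (TC u)) (op_comp l \<theta>))"
        unfolding op_comp_map[OF \<theta> l(2), symmetric] using e(3)[OF _ \<theta>] l(2) by simp
    qed
    then show ?thesis using lev_gval[OF assms(1)] by (simp add: TC)
  next
    case (QC k)
    have k: "chainm (gmod g) k" "inhom (gmod g) (QC k)" using assms(2) by (auto simp: QC)
    note e = ev_gval[OF assms(1) k(1) length_QC[OF k(2)]]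
    have n: "0 < n0 k" "n0 k < length k" using n0_bounds k(2) by auto
    have hh: "h (Suc ((n0 k - 1) + (length k - n0 k - 1))) (ev g k)
        = replicate (Suc (n0 k - 1)) (lev g ! 0) @ replicate (Suc (length k - n0 k - 1)) (lev g ! Suc 0)"
      using e(2) map_tags[OF k(2), of "lev g"] n by (simp add: Suc_diff_Suc)
    have "lev (gact g c) = [lev g ! 0, lev g ! Suc 0]"
      unfolding QC gact.simps lev.simps hh by (simp add: nth_append del: replicate_Suc)
    also have "\<dots> = lev g"
      using lev_gval(1)[OF assms(1)] by (cases "lev g"; cases "tl (lev g)") auto
    finally have "lev (gact g c) = lev g" .
    moreover have "gval (gact g c)"
      unfolding QC gact.simps gval.simps using hh e(1) lev_gval(2)[OF assms(1)] by blast
    ultimately show ?thesis by blast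
  qed
  then show "gval (gact g c)" "lev (gact g c) = lev g" by auto
qed

text \<open>Associativity of the action; it carries natural operations on cells over to
  generators.\<close>

lemma gact_gact:
  assumes "gval g" "inhom (gmod g) c" "inhom (src c) d"
  shows "gact (gact g c) d = gact g (push c d)"
proof (cases d)
  case (QC l)
  have "l \<noteq> []" "chainm (src c) l" using assms(3) by (auto simp: QC mixed_def)
  then have "ev (gact g c) l = ev g (pushl (vm0 c) (vm1 c) l)"
    using ev_gact[OF assms(1,2)] by (simp add: pushl_vmap)
  moreover have "length (pushl (vm0 c) (vm1 c) l) = length l" by (simp add: pushl_def)
  ultimately show ?thesis by (simp add: QC n0_pushl del: ev.simps)
next
  case (TC w)
  have p: "push c (TC w) = TC (map (\<lambda>(a, b). (vm0 c a, vm1 c b)) w)" by simp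
  have *: "ev (gact g c) (map (vmap (TC w)) l) = ev g (map (vmap (push c (TC w))) l)"
    if l: "l \<in> grid (Suc 0) (length w - 1)" for l
  proof -
    have ne: "l \<noteq> []" using l by (auto simp: grid_def)
    have lc: "chainm (src (TC w)) l" using l chainm_TM[OF ne] by simp
    have "chainm (src c) (map (vmap (TC w)) l)"
      by (rule chainm_push[OF _ lc]) (use assms(3) TC in simp)
    then have "ev (gact g c) (map (vmap (TC w)) l) = ev g (map (vmap c) (map (vmap (TC w)) l))"
      using ev_gact[OF assms(1,2)] ne by simp
    also have "map (vmap c) (map (vmap (TC w)) l) = map (vmap (push c (TC w))) l"
      using vmap_push[of "src c" "TC w" _ c] assms(3) lc
      by (auto simp: TC chainm_def simp del: pushc.simps)
    finally show ?thesis .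
  qed
  have "section_of (Suc 0) (length w - 1) (\<lambda>l. ev (gact g c) (map (vmap (TC w)) l))
      = section_of (Suc 0) (length w - 1) (\<lambda>l. ev g (map (vmap (push c (TC w))) l))"
    by (rule section_of_cong) (rule *)
  then show ?thesis
    unfolding TC p gact.simps gact_gval(2)[OF assms(1,2)] length_map by (simp only:)
qed

lemma gact_iota:
  assumes "gval g"
  shows "gact g (iota (gmod g)) = g"
proof (cases g)
  case (TB q s)
  obtain a \<rho> where s: "s = (a, \<rho>)" by (cases s)
  have a: "length a = Suc (Suc 0)" and \<rho>: "\<rho> \<in> simplices (section_space X h a) q"
    using assms(1) by (auto simp: TB s)
  have "section_of (Suc 0) q (\<lambda>l. sev \<rho> (map (vmap (TC (diag q))) l)) = section_of (Suc 0) q (sev \<rho>)"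
  proof (rule section_of_cong)
    fix l assume l: "l \<in> grid (Suc 0) q"
    have "map (vmap (TC (diag q))) l = l"
      by (rule map_idI) (use l in \<open>auto simp: grid_def vmap_def simp del: upt_Suc\<close>)
    then show "sev \<rho> (map (vmap (TC (diag q))) l) = sev \<rho> l" by simp
  qed
  then show ?thesis using section_of_sev[OF \<rho> a] by (simp add: TB s del: upt_Suc)
next
  case (QB i j x)
  let ?l = "map (Pair 0) [0..<Suc i] @ map (Pair (Suc 0)) [0..<Suc j]"
  have "map (pos i) ?l = [0..<Suc i] @ map (\<lambda>v. v + Suc i) [0..<Suc j]"
    by (simp add: comp_def add.commute del: upt_Suc)
  also have "\<dots> = op_id (Suc (i + j))"
    unfolding map_add_upt op_id_def by (metis add.commute add_Suc add_Suc_right upt_add_eq_append zero_le)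
  finally have "ev g ?l = x" using simplicial_setD(2)[OF X, of x "Suc (i + j)"] assms by (simp add: QB)
  moreover have "src (iota (QM i j)) = QM i j" by (rule src_iota)
  ultimately show ?thesis by (simp add: QB del: upt_Suc ev.simps)
qed

end


lemma sorted_two_values:
  fixes a b :: "'a::linorder"
  assumes "sorted l" "set l \<subseteq> {a, b}" "a < b"
  shows "l = replicate (length (filter (\<lambda>t. t = a) l)) a @ replicate (length (filter (\<lambda>t. t \<noteq> a) l)) b"
  using assms(1,2)
proof (induction l)
  case (Cons t l)
  show ?case
  proof (cases "t = a")
    case True
    then show ?thesis using Cons by simp
  next
    case False
    then have "t = b" using Cons.prems by auto
    then have "\<forall>s\<in>set l. s \<noteq> a" using Cons.prems assms(3) by auto
    then have "filter (\<lambda>t. t = a) l = []" by (auto simp: filter_empty_conv)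
    then show ?thesis using Cons \<open>t = b\<close> False by simp
  qed
qed simp

section \<open>The cone attached to X and its contraction\<close>

context subdivided_height
begin

abbreviation gchain :: "'x gen \<Rightarrow> (cell \<Rightarrow>\<^sub>0 'k::field) \<Rightarrow> ('x gen \<Rightarrow>\<^sub>0 'k)" where
  "gchain g \<equiv> lift (\<lambda>c. sing (gact g c))"

text \<open>The boundary of the universal cell, acting on the generator. In terms of sections and
  simplices it is computed in \<open>dG_TB\<close> and \<open>dG_toQ\<close>.\<close>

definition dG :: "'x gen \<Rightarrow> ('x gen \<Rightarrow>\<^sub>0 'k::field)" where
  "dG g = gchain g (bdc (iota (gmod g)))"

definition sG :: "'x gen \<Rightarrow> ('x gen \<Rightarrow>\<^sub>0 'k::field)" where
  "sG g = gchain g (sigma (gmod g))"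

lemma gchain_gact:
  assumes "gval g" "inhom (gmod g) c" "Poly_Mapping.keys p \<subseteq> hom (src c)"
  shows "gchain (gact g c) p = gchain g (pushp c p)"
  unfolding lift_lift lift_sing
  by (rule lift_cong) (use gact_gact[OF assms(1,2)] assms(3) in auto)

lemma dG_gact:
  assumes "gval g" "inhom (gmod g) c"
  shows "dG (gact g c) = (gchain g (bdc c) :: _ \<Rightarrow>\<^sub>0 'k::field)"
  unfolding dG_def gmod_gact bdc_eq_pushp[OF assms(2)]
  by (rule gchain_gact[OF assms]) (rule keys_bdc_subset[OF inhom_iota])

lemma sG_gact:
  assumes "gval g" "inhom (gmod g) c"
  shows "sG (gact g c) = (gchain g (sigma_cell c) :: _ \<Rightarrow>\<^sub>0 'k::field)"
  unfolding sG_def gmod_gact sigma_cell_def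
  by (rule gchain_gact[OF assms]) (rule keys_sigma)

text \<open>The identity \<open>sigma_homotopy\<close> acting on \<open>g\<close>. Extended to
  chains, it says that the cone of the prism operator of X is contractible.\<close>

lemma dG_sG:
  assumes g: "gval g"
  shows "lift dG (sG g) + lift sG (dG g) = (sing g :: _ \<Rightarrow>\<^sub>0 'k::field)"
proof -
  have "lift dG (sG g) = (gchain g (lift bdc (sigma (gmod g))) :: _ \<Rightarrow>\<^sub>0 'k)"
    unfolding sG_def lift_lift lift_sing
    by (rule lift_cong, rule dG_gact[OF g]) (use keys_sigma in auto)
  moreover have "lift sG (dG g) = (gchain g (lift sigma_cell (bdc (iota (gmod g)))) :: _ \<Rightarrow>\<^sub>0 'k)"
    unfolding dG_def lift_lift lift_sing
    by (rule lift_cong, rule sG_gact[OF g]) (rule keys_bdc(1)[OF inhom_iota])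
  ultimately have "lift dG (sG g) + lift sG (dG g) = (gchain g (sing (iota (gmod g))) :: _ \<Rightarrow>\<^sub>0 'k)"
    by (simp only: lift_add[symmetric] sigma_homotopy)
  then show ?thesis using gact_iota[OF g] by simp
qed

lemma dG_sG_chain:
  assumes "Poly_Mapping.keys w \<subseteq> {g. gval g}"
  shows "lift dG (lift sG w) + lift sG (lift dG w) = (w :: _ \<Rightarrow>\<^sub>0 'k::field)"
proof -
  have "lift (\<lambda>g. lift dG (sG g) + lift sG (dG g)) w = lift sing w"
    by (rule lift_cong, rule dG_sG) (use assms in auto)
  then show ?thesis by (simp only: lift_fun_add lift_lift lift_sing_id)
qed

lemma keys_sG:
  assumes "Poly_Mapping.keys w \<subseteq> {g. gval g}"
  shows "Poly_Mapping.keys (lift sG w :: _ \<Rightarrow>\<^sub>0 'k::field) \<subseteq> {g. gval g}"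
proof (rule keys_lift_subset)
  fix g assume "g \<in> Poly_Mapping.keys w"
  then have g: "gval g" using assms by auto
  show "Poly_Mapping.keys (sG g :: _ \<Rightarrow>\<^sub>0 'k) \<subseteq> {g. gval g}"
    unfolding sG_def
    by (rule keys_lift_subset) (use gact_gval(1)[OF g] keys_sigma in auto)
qed

section \<open>Sections over two levels and mixed simplices as the two parts of the cone\<close>

abbreviation S1 :: "(real list \<times> 'x prism) sset" where
  "S1 \<equiv> sections X h (Suc 0)"

definition SS :: "nat \<Rightarrow> (real list \<times> 'x prism) set" where
  "SS q = {s \<in> simplices S1 q. fst s ! 0 < fst s ! Suc 0}"

lemma SS_gval: "s \<in> SS q \<longleftrightarrow> gval (TB q s)"
proof (cases s)
  case (Pair a \<rho>)
  have "sorted a" if "length a = Suc (Suc 0)" "a ! 0 < a ! Suc 0"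
    using that by (auto simp: sorted_iff_nth_mono less_Suc_eq le_less)
  then show ?thesis by (auto simp: SS_def simplices_sections Pair)
qed

definition Pr :: "nat \<Rightarrow> real list \<times> 'x prism \<Rightarrow> ('x \<Rightarrow>\<^sub>0 'k::field)" where
  "Pr q s = lift (\<lambda>w. sing (sev (snd s) w)) (prisml (diag q))"

definition mixedX :: "nat \<Rightarrow> 'x \<Rightarrow> bool" where
  "mixedX n x \<longleftrightarrow> h n x ! 0 \<noteq> h n x ! n"

text \<open>Reduction modulo level simplices, realised inside the chains of X by projecting to the
  complementary part of the basis.\<close>

abbreviation relX :: "nat \<Rightarrow> ('x \<Rightarrow>\<^sub>0 'k::field) \<Rightarrow> ('x \<Rightarrow>\<^sub>0 'k)" where
  "relX n \<equiv> lift (\<lambda>x. if mixedX n x then sing x else 0)"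

text \<open>A mixed simplex takes two heights, so the number of entries equal to the first one
  determines the join; the subtractions turn counts into dimensions.\<close>

definition toQ :: "nat \<Rightarrow> 'x \<Rightarrow> 'x gen" where
  "toQ n x = (let i = length (filter (\<lambda>t. t = h n x ! 0) (h n x)) - 1 in QB i (n - Suc i) x)"

lemma toQ_QB:
  assumes "gval (QB i j x)"
  shows "toQ (Suc (i + j)) x = QB i j x" "mixedX (Suc (i + j)) x"
proof -
  obtain a b where ab: "a < b" "h (Suc (i + j)) x = replicate (Suc i) a @ replicate (Suc j) b"
    using assms by auto
  have 0: "h (Suc (i + j)) x ! 0 = a" "h (Suc (i + j)) x ! Suc (i + j) = b"
    unfolding ab(2) by (simp_all add: nth_append del: replicate_Suc)
  have "filter (\<lambda>t. t = a) (replicate (Suc i) a @ replicate (Suc j) b) = replicate (Suc i) a"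
    using ab(1) by (simp add: filter_replicate del: replicate_Suc)
  then show "toQ (Suc (i + j)) x = QB i j x"
    unfolding toQ_def unfolding 0 unfolding ab(2) by (simp add: Let_def del: replicate_Suc)
  show "mixedX (Suc (i + j)) x" unfolding mixedX_def 0 using ab(1) by simp
qed

lemma gval_toQ:
  assumes "x \<in> simplices X n" "mixedX n x"
  obtains i j where "toQ n x = QB i j x" "n = Suc (i + j)" "gval (QB i j x)"
proof -
  let ?l = "h n x" and ?a = "h n x ! 0" and ?b = "h n x ! n"
  let ?A = "length (filter (\<lambda>t. t = ?a) ?l)" and ?B = "length (filter (\<lambda>t. t \<noteq> ?a) ?l)"
  have len: "length ?l = Suc n" and so: "sorted ?l" using height(1,2)[OF assms(1)] by auto
  have "?a \<le> ?b" using sorted_nth_mono[OF so, of 0 n] len by simp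
  then have ab: "?a < ?b" using assms(2) by (simp add: mixedX_def)
  have "set ?l \<subseteq> {?a, ?b}"
    using two_levels[OF assms(1)] len by (fastforce simp: in_set_conv_nth less_Suc_eq_le)
  then have l: "?l = replicate ?A ?a @ replicate ?B ?b" using sorted_two_values[OF so _ ab] by blast
  have "?a \<in> set ?l" "?b \<in> set ?l" using len by (auto intro!: nth_mem)
  then have "?a \<in> set (filter (\<lambda>t. t = ?a) ?l)" "?b \<in> set (filter (\<lambda>t. t \<noteq> ?a) ?l)"
    using ab by auto
  then have "filter (\<lambda>t. t = ?a) ?l \<noteq> []" "filter (\<lambda>t. t \<noteq> ?a) ?l \<noteq> []" by (metis empty_iff empty_set)+
  then obtain i j where ij: "?A = Suc i" "?B = Suc j" by (cases ?A; cases ?B) auto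
  have "Suc n = Suc i + Suc j" using arg_cong[OF l, of length] len ij by simp
  then have n: "n = Suc (i + j)" by simp
  have "toQ n x = QB i j x" unfolding toQ_def ij using n by (simp add: Let_def)
  moreover have "gval (QB i j x)"
    unfolding gval.simps n[symmetric] using assms(1) ab l ij by metis
  ultimately show ?thesis using that n by blast
qed

lemma keys_relX:
  assumes "Poly_Mapping.keys z \<subseteq> simplices X n" "x \<in> Poly_Mapping.keys (relX n z :: _ \<Rightarrow>\<^sub>0 'k::field)"
  shows "x \<in> simplices X n" "mixedX n x"
  using assms by (auto elim!: in_keys_lift split: if_splits)

lemma mixedX_ev:
  assumes "gval g" "chainm (gmod g) w" "length w = Suc n"
  shows "mixedX n (ev g w) \<longleftrightarrow> mixed w"
proof -
  have w: "w ! 0 \<in> set w" "w ! n \<in> set w" using assms(3) by simp_all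
  have "h n (ev g w) ! 0 = lev g ! fst (w ! 0)" "h n (ev g w) ! n = lev g ! fst (w ! n)"
    unfolding ev_gval(2)[OF assms] using assms(3) by simp_all
  then show ?thesis unfolding mixedX_def
    using hd_last_mixed[OF assms(2,3)] lev_gval(2)[OF assms(1)] by auto
qed

lemma gact_QC_toQ:
  assumes "gval g" "inhom (gmod g) (QC w)" "length w = Suc n"
  shows "gact g (QC w) = toQ n (ev g w)"
proof -
  have "Suc ((n0 w - 1) + (length w - n0 w - 1)) = n" using length_QC[OF assms(2)] assms(3) by simp
  moreover have "gval (QB (n0 w - 1) (length w - n0 w - 1) (ev g w))"
    using gact_gval(1)[OF assms(1,2)] by simp
  ultimately show ?thesis using toQ_QB(1) by (metis gact.simps(2))
qed

text \<open>The cells \<open>TC (rmn i (diag q))\<close> act as the faces of the section in the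
  \<open>q\<close> direction. The lists in the prism over \<open>diag q\<close> are all mixed, so
  \<open>embQ\<close> loses none of them.\<close>

lemma dG_TB:
  assumes s: "s \<in> SS q"
  shows "dG (TB q s) = lift (\<lambda>s. sing (TB (q - 1) s)) (bds S1 q s)
    + (lift (\<lambda>x. sing (toQ (Suc q) x)) (Pr q s) :: _ \<Rightarrow>\<^sub>0 'k::field)"
proof -
  have g: "gval (TB q s)" using s by (simp only: SS_gval)
  have Q: "gchain (TB q s) (embQ (prisml (diag q)))
      = (lift (\<lambda>x. sing (toQ (Suc q) x)) (Pr q s) :: _ \<Rightarrow>\<^sub>0 'k)"
    unfolding Pr_def lift_lift lift_sing
  proof (rule lift_cong)
    fix w assume "w \<in> Poly_Mapping.keys (prisml (diag q) :: _ \<Rightarrow>\<^sub>0 'k)"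
    note w = keys_prism_diag[OF this]
    then have ne: "w \<noteq> []" by auto
    have "inhom (gmod (TB q s)) (QC w)" using chainm_TM[OF ne] w by simp
    from gact_QC_toQ[OF g this w(2)] show "gchain (TB q s) (if mixed w then sing (QC w) else 0)
        = (sing (toQ (Suc q) (sev (snd s) w)) :: _ \<Rightarrow>\<^sub>0 'k)"
      using w(3) by simp
  qed
  have T: "gchain (TB q s) (embT (bdl (diag q)))
      = (lift (\<lambda>s. sing (TB (q - 1) s)) (bds S1 q s) :: _ \<Rightarrow>\<^sub>0 'k)"
  proof (cases q)
    case 0
    then show ?thesis by simp
  next
    case (Suc m)
    obtain a \<rho> where ar: "s = (a, \<rho>)" by (cases s)
    have a: "length a = Suc (Suc 0)" and \<rho>: "\<rho> \<in> simplices (section_space X h a) q"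
      using g by (auto simp: ar)
    have G: "gact (TB q s) (TC (rmn i (diag q))) = TB m (act S1 q s (coface m i))" if i: "i \<le> Suc m" for i
    proof -
      have "sev \<rho> (map (vmap (TC (rmn i (diag q)))) l) = sev \<rho> (map (\<lambda>(e, v). (op_id (Suc 0) ! e, coface m i ! v)) l)"
        if l: "l \<in> grid (Suc 0) m" for l
      proof -
        have "map (vmap (TC (rmn i (diag q)))) l = map (\<lambda>(e, v). (op_id (Suc 0) ! e, coface m i ! v)) l"
        proof (rule map_cong[OF refl])
          fix x assume "x \<in> set l"
          then have "fst x = 0 \<or> fst x = Suc 0" "snd x \<le> m" using l by (auto simp: grid_def)
          then show "vmap (TC (rmn i (diag q))) x = (\<lambda>(e, v). (op_id (Suc 0) ! e, coface m i ! v)) x"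
            unfolding Suc rmn_diag[OF i]
            by (auto simp: vmap_def op_id_def split_def simp del: upt_Suc)
        qed
        then show ?thesis by (simp only:)
      qed
      then have "section_of (Suc 0) m (\<lambda>l. sev \<rho> (map (vmap (TC (rmn i (diag q)))) l))
        = section_of (Suc 0) m (\<lambda>l. sev \<rho> (map (\<lambda>(e, v). (op_id (Suc 0) ! e, coface m i ! v)) l))"
        by (rule section_of_cong)
      moreover have "length (rmn i (diag q)) - 1 = m" unfolding Suc rmn_diag[OF i] by simp
      moreover have "length (coface m i) - 1 = m" by (simp add: coface_def)
      ultimately show ?thesis
        by (simp add: ar act_sections[OF a] precomp_eq_section_of del: upt_Suc)
    qed
    have N: "rmn i (diag q) \<noteq> []" if "i \<le> Suc m" for i unfolding Suc rmn_diag[OF that] by simp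
    have "gchain (TB q s) (embT (bdl (diag q)))
      = (\<Sum>i\<le>Suc m. pscale ((-1) ^ i) (gchain (TB q s)
          (if rmn i (diag q) = [] then 0 else sing (TC (rmn i (diag q))))) :: _ \<Rightarrow>\<^sub>0 'k)"
      unfolding lift_lift unfolding Suc lift_bdl_diag ..
    also have "\<dots> = (\<Sum>i\<le>Suc m. pscale ((-1) ^ i) (sing (TB m (act S1 q s (coface m i)))))"
      by (rule sum.cong[OF refl]) (use G N in \<open>simp del: upt_Suc gact.simps\<close>)
    also have "\<dots> = lift (\<lambda>s. sing (TB (q - 1) s)) (bds S1 q s)"
      unfolding Suc bds_def by (simp add: lift_sum lift_scale lift_add del: sum.atMost_Suc)
    finally show ?thesis .
  qed
  show ?thesis unfolding dG_def by (simp add: lift_add T Q del: upt_Suc)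
qed

text \<open>The universal list evaluates to \<open>x\<close> and its deletions to the faces of
  \<open>x\<close>; by \<open>mixedX_ev\<close> the discarded lists are exactly those with a level
  simplex as value.\<close>

lemma dG_QB:
  assumes g: "gval (QB i j x)"
  shows "dG (QB i j x)
    = (lift (\<lambda>x. sing (toQ (i + j) x)) (relX (i + j) (bds X (Suc (i + j)) x)) :: _ \<Rightarrow>\<^sub>0 'k::field)"
proof -
  let ?g = "QB i j x" and ?l = "map (Pair 0) [0..<Suc i] @ map (Pair (Suc 0)) [0..<Suc j]"
  have len: "length ?l = Suc (Suc (i + j))" by simp
  have io: "iota (gmod ?g) = QC ?l" by simp
  have c: "chainm (gmod ?g) ?l" using inhom_iota[of "gmod ?g"] unfolding io by simp
  have x: "ev ?g ?l = x" using gact_iota[OF g] unfolding io by simp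
  have b: "bds X (Suc (i + j)) x = (lift (\<lambda>w. sing (ev ?g w)) (bdl ?l) :: _ \<Rightarrow>\<^sub>0 'k)"
  proof -
    have "bds X (Suc (i + j)) (ev ?g ?l) = (lift (\<lambda>w. sing (ev ?g w)) (bdl ?l) :: _ \<Rightarrow>\<^sub>0 'k)"
    proof (rule bds_eval[OF len])
      fix k assume k: "k \<le> Suc (i + j)"
      show "act X (Suc (i + j)) (ev ?g ?l) (coface (i + j) k) = ev ?g (rmn k ?l)"
        unfolding ev_gval(3)[OF g c len coface_ops[OF k]] op_comp_coface[OF len k] ..
    qed
    then show ?thesis unfolding x .
  qed
  show ?thesis unfolding dG_def io bdc.simps b lift_lift lift_sing
  proof (rule lift_cong)
    fix w assume w: "w \<in> Poly_Mapping.keys (bdl ?l :: _ \<Rightarrow>\<^sub>0 'k)"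
    have lw: "length w = Suc (i + j)" using keys_bdl_length[OF w] len by simp
    obtain k where "w = rmn k ?l" using subsetD[OF keys_bdl w] by auto
    then have cw: "chainm (gmod ?g) w" using chainm_rmn[OF c] by simp
    show "gchain ?g (if mixed w then sing (QC w) else 0)
      = (lift (\<lambda>x. sing (toQ (i + j) x)) (if mixedX (i + j) (ev ?g w) then sing (ev ?g w) else 0) :: _ \<Rightarrow>\<^sub>0 'k)"
      using mixedX_ev[OF g cw lw] gact_QC_toQ[OF g _ lw] cw by (simp del: ev.simps gact.simps)
  qed
qed

lemma dG_toQ:
  assumes "x \<in> simplices X (Suc n)" "mixedX (Suc n) x"
  shows "dG (toQ (Suc n) x) = (lift (\<lambda>x. sing (toQ n x)) (relX n (bds X (Suc n) x)) :: _ \<Rightarrow>\<^sub>0 'k::field)"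
proof -
  obtain i j where "toQ (Suc n) x = QB i j x" "Suc n = Suc (i + j)" "gval (QB i j x)"
    by (rule gval_toQ[OF assms])
  then show ?thesis using dG_QB[of i j x] by (simp del: gval.simps)
qed

text \<open>The components by kind and degree. They extract section chains and chains of X from what
  the contraction returns.\<close>

fun partT :: "nat \<Rightarrow> 'x gen \<Rightarrow> (real list \<times> 'x prism \<Rightarrow>\<^sub>0 'k::field)" where
  "partT q (TB r s) = (if r = q then sing s else 0)"
| "partT q (QB i j x) = 0"

fun partQ :: "nat \<Rightarrow> 'x gen \<Rightarrow> ('x \<Rightarrow>\<^sub>0 'k::field)" where
  "partQ n (TB r s) = 0"
| "partQ n (QB i j x) = (if Suc (i + j) = n then sing x else 0)"

lemma partT_toQ [simp]: "partT q (toQ n x) = 0"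
  by (simp add: toQ_def Let_def)

lemma keys_parts:
  assumes "Poly_Mapping.keys w \<subseteq> {g. gval g}"
  shows "Poly_Mapping.keys (lift (partT q) w :: _ \<Rightarrow>\<^sub>0 'k::field) \<subseteq> SS q"
    "Poly_Mapping.keys (lift (partQ n) w :: _ \<Rightarrow>\<^sub>0 'k::field) \<subseteq> simplices X n"
proof -
  have "Poly_Mapping.keys (partT q g :: _ \<Rightarrow>\<^sub>0 'k) \<subseteq> SS q \<and>
    Poly_Mapping.keys (partQ n g :: _ \<Rightarrow>\<^sub>0 'k) \<subseteq> simplices X n" if "gval g" for g
    using that by (cases g) (auto simp: SS_gval simp del: gval.simps(1))
  then show "Poly_Mapping.keys (lift (partT q) w :: _ \<Rightarrow>\<^sub>0 'k) \<subseteq> SS q"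
    "Poly_Mapping.keys (lift (partQ n) w :: _ \<Rightarrow>\<^sub>0 'k) \<subseteq> simplices X n"
    using assms by (auto intro!: keys_lift_subset)
qed

lemma keys_Pr:
  assumes "s \<in> simplices S1 q"
  shows "Poly_Mapping.keys (Pr q s :: _ \<Rightarrow>\<^sub>0 'k::field) \<subseteq> simplices X (Suc q)"
proof -
  obtain a \<rho> where s: "s = (a, \<rho>)" "length a = Suc (Suc 0)" "\<rho> \<in> simplices (section_space X h a) q"
    using assms by (auto simp: simplices_sections)
  show ?thesis unfolding Pr_def
  proof (rule keys_lift_subset)
    fix w assume "w \<in> Poly_Mapping.keys (prisml (diag q) :: _ \<Rightarrow>\<^sub>0 'k)"
    note w = keys_prism_diag[OF this]
    show "Poly_Mapping.keys (sing (sev (snd s) w) :: _ \<Rightarrow>\<^sub>0 'k) \<subseteq> simplices X (Suc q)"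
      using sev_section(1)[OF s(3,2) w(1,2)] by (simp add: s(1))
  qed
qed

lemma partT_dG:
  assumes "gval g"
  shows "lift (partT q) (dG g) = (lift (bds S1 (Suc q)) (partT (Suc q) g) :: _ \<Rightarrow>\<^sub>0 'k::field)"
proof (cases g)
  case (QB i j x)
  then show ?thesis using assms by (simp add: dG_QB lift_lift del: gval.simps)
next
  case (TB r s)
  have s: "s \<in> SS r" using assms by (simp only: TB SS_gval)
  have "lift (partT q) (dG g) = lift (\<lambda>s. if r - 1 = q then sing s else 0 :: _ \<Rightarrow>\<^sub>0 'k) (bds S1 r s)"
    by (simp add: TB dG_TB[OF s] lift_add lift_lift)
  then show ?thesis by (cases r) (auto simp: TB)
qed

lemma mixedX_Pr:
  assumes "s \<in> SS q" "x \<in> Poly_Mapping.keys (Pr q s :: _ \<Rightarrow>\<^sub>0 'k::field)"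
  shows "mixedX (Suc q) x"
proof -
  have g: "gval (TB q s)" using assms(1) by (simp only: SS_gval)
  obtain w where w': "w \<in> Poly_Mapping.keys (prisml (diag q) :: _ \<Rightarrow>\<^sub>0 'k)" "x = sev (snd s) w"
    using assms(2) unfolding Pr_def by (rule in_keys_lift) auto
  note w = keys_prism_diag[OF w'(1)]
  then have "w \<noteq> []" by auto
  then have "chainm (gmod (TB q s)) w" using chainm_TM w(1) by simp
  from mixedX_ev[OF g this w(2)] show ?thesis using w(3) w'(2) by simp
qed

lemma partQ_toQ:
  assumes "x \<in> simplices X m" "mixedX m x"
  shows "partQ n (toQ m x) = (if m = n then sing x else 0 :: _ \<Rightarrow>\<^sub>0 'k::field)"
proof -
  obtain i j where "toQ m x = QB i j x" "m = Suc (i + j)" by (rule gval_toQ[OF assms])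
  then show ?thesis by simp
qed

lemma relX_Pr:
  assumes "s \<in> SS q"
  shows "relX (Suc q) (Pr q s) = (Pr q s :: _ \<Rightarrow>\<^sub>0 'k::field)"
proof -
  have "relX (Suc q) (Pr q s) = (lift sing (Pr q s) :: _ \<Rightarrow>\<^sub>0 'k)"
    by (rule lift_cong) (use mixedX_Pr[OF assms] in auto)
  then show ?thesis by simp
qed

lemma partQ_toQ_chain:
  assumes "Poly_Mapping.keys z \<subseteq> simplices X m" "\<And>x. x \<in> Poly_Mapping.keys z \<Longrightarrow> mixedX m x"
  shows "lift (partQ n) (lift (\<lambda>x. sing (toQ m x)) z) = (if m = n then z else 0 :: _ \<Rightarrow>\<^sub>0 'k::field)"
proof -
  have "lift (partQ n) (lift (\<lambda>x. sing (toQ m x)) z) = lift (\<lambda>x. if m = n then sing x else 0 :: _ \<Rightarrow>\<^sub>0 'k) z"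
    unfolding lift_lift lift_sing
    by (rule lift_cong, rule partQ_toQ) (use assms in auto)
  then show ?thesis by auto
qed

lemma partQ_dG:
  assumes "gval g"
  shows "lift (partQ (Suc n)) (dG g) = (lift (Pr n) (partT n g)
    + relX (Suc n) (lift (bds X (Suc (Suc n))) (partQ (Suc (Suc n)) g)) :: _ \<Rightarrow>\<^sub>0 'k::field)"
proof (cases g)
  case (TB q s)
  have s: "s \<in> SS q" using assms by (simp only: TB SS_gval)
  then have "s \<in> simplices S1 q" by (simp add: SS_def)
  then have "lift (partQ (Suc n)) (lift (\<lambda>x. sing (toQ (Suc q) x)) (Pr q s))
      = (if Suc q = Suc n then Pr q s else 0 :: _ \<Rightarrow>\<^sub>0 'k)"
    by (intro partQ_toQ_chain keys_Pr mixedX_Pr[OF s])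
  moreover have "lift (partQ (Suc n)) (lift (\<lambda>s. sing (TB (q - 1) s)) (bds S1 q s)) = (0 :: _ \<Rightarrow>\<^sub>0 'k)"
    by (simp add: lift_lift)
  ultimately show ?thesis by (simp add: TB dG_TB[OF s] lift_add)
next
  case (QB i j x)
  have g: "gval (QB i j x)" using assms by (simp only: QB)
  have k: "Poly_Mapping.keys (bds X (Suc (i + j)) x :: _ \<Rightarrow>\<^sub>0 'k) \<subseteq> simplices X (i + j)"
    by (rule keys_bds[OF X]) (use g in simp)
  have "lift (partQ (Suc n)) (dG (QB i j x))
      = (if i + j = Suc n then relX (i + j) (bds X (Suc (i + j)) x) else 0 :: _ \<Rightarrow>\<^sub>0 'k)"
    unfolding dG_QB[OF g] using keys_relX[OF k] by (intro partQ_toQ_chain) auto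
  then show ?thesis by (simp add: QB)
qed

text \<open>By \<open>two_levels\<close> all heights of such a simplex coincide, hence so do those
  of its faces. Level chains form a subcomplex and the relative boundary makes sense.\<close>

lemma relX_bds_level:
  assumes "x \<in> simplices X (Suc n)" "\<not> mixedX (Suc n) x"
  shows "relX n (bds X (Suc n) x) = (0 :: _ \<Rightarrow>\<^sub>0 'k::field)"
proof -
  have "\<not> mixedX n (act X (Suc n) x (coface n i))" if i: "i \<le> Suc n" for i
  proof -
    have c: "coface n i \<in> ops n (Suc n)" by (rule coface_ops[OF i])
    have eq: "h (Suc n) x ! k = h (Suc n) x ! 0" if "k \<le> Suc n" for k
      using two_levels[OF assms(1) that] assms(2) by (auto simp: mixedX_def)
    have "op_comp (h (Suc n) x) (coface n i) ! k = h (Suc n) x ! 0" if "k \<le> n" for k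
    proof -
      have "coface n i ! k \<le> Suc n" using that by (simp add: coface_def del: upt_Suc)
      moreover have "op_comp (h (Suc n) x) (coface n i) ! k = h (Suc n) x ! (coface n i ! k)"
        using that by (simp add: op_comp_def coface_def del: upt_Suc)
      ultimately show ?thesis using eq[of "coface n i ! k"] by (simp only:)
    qed
    from this[of 0] this[of n] show ?thesis unfolding mixedX_def height(3)[OF assms(1) c] by simp
  qed
  then show ?thesis
    by (simp add: bds_def lift_sum lift_scale lift_add del: sum.atMost_Suc)
qed

lemma relX_bds_relX:
  assumes "Poly_Mapping.keys z \<subseteq> simplices X (Suc n)"
  shows "relX n (lift (bds X (Suc n)) (relX (Suc n) z)) = (relX n (lift (bds X (Suc n)) z) :: _ \<Rightarrow>\<^sub>0 'k::field)"
  unfolding lift_lift by (rule lift_cong) (use relX_bds_level assms in auto)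

lemma relX_bds_toQ:
  assumes "Poly_Mapping.keys z \<subseteq> simplices X (Suc n)"
  shows "lift dG (lift (\<lambda>x. sing (toQ (Suc n) x)) (relX (Suc n) z))
    = (lift (\<lambda>x. sing (toQ n x)) (relX n (lift (bds X (Suc n)) z)) :: _ \<Rightarrow>\<^sub>0 'k::field)"
proof -
  have "lift dG (lift (\<lambda>x. sing (toQ (Suc n) x)) (relX (Suc n) z))
      = lift (\<lambda>x. lift (\<lambda>x. sing (toQ n x)) (relX n (bds X (Suc n) x))) (relX (Suc n) z)"
    unfolding lift_lift[of dG] lift_sing
    by (rule lift_cong, rule dG_toQ) (use keys_relX[OF assms] in auto)
  also have "\<dots> = lift (\<lambda>x. sing (toQ n x)) (relX n (lift (bds X (Suc n)) (relX (Suc n) z)))"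
    by (simp only: lift_lift)
  finally show ?thesis by (simp only: relX_bds_relX[OF assms])
qed

lemma parts_dG_chain:
  assumes "Poly_Mapping.keys w \<subseteq> {g. gval g}"
  shows "lift (partT q) (lift dG w) = (lift (bds S1 (Suc q)) (lift (partT (Suc q)) w) :: _ \<Rightarrow>\<^sub>0 'k::field)"
    and "lift (partQ (Suc n)) (lift dG w) = (lift (Pr n) (lift (partT n) w)
      + relX (Suc n) (lift (bds X (Suc (Suc n))) (lift (partQ (Suc (Suc n))) w)) :: _ \<Rightarrow>\<^sub>0 'k::field)"
proof -
  show "lift (partT q) (lift dG w) = (lift (bds S1 (Suc q)) (lift (partT (Suc q)) w) :: _ \<Rightarrow>\<^sub>0 'k)"
    unfolding lift_lift by (rule lift_cong, rule partT_dG) (use assms in auto)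
  have "lift (partQ (Suc n)) (lift dG w) = lift (\<lambda>g. lift (Pr n) (partT n g)
      + relX (Suc n) (lift (bds X (Suc (Suc n))) (partQ (Suc (Suc n)) g)) :: _ \<Rightarrow>\<^sub>0 'k) w"
    unfolding lift_lift[of "partQ (Suc n)"] by (rule lift_cong, rule partQ_dG) (use assms in auto)
  then show "lift (partQ (Suc n)) (lift dG w) = (lift (Pr n) (lift (partT n) w)
      + relX (Suc n) (lift (bds X (Suc (Suc n))) (lift (partQ (Suc (Suc n))) w)) :: _ \<Rightarrow>\<^sub>0 'k)"
    by (simp only: lift_fun_add lift_lift)
qed

lemma gval_toQ_chain:
  assumes "Poly_Mapping.keys z \<subseteq> simplices X n"
  shows "Poly_Mapping.keys (lift (\<lambda>x. sing (toQ n x)) (relX n z) :: _ \<Rightarrow>\<^sub>0 'k::field) \<subseteq> {g. gval g}"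
proof (rule keys_lift_subset)
  fix x assume "x \<in> Poly_Mapping.keys (relX n z)"
  note x = keys_relX[OF assms this]
  obtain i j where "toQ n x = QB i j x" "gval (QB i j x)" by (rule gval_toQ[OF x])
  then show "Poly_Mapping.keys (sing (toQ n x) :: _ \<Rightarrow>\<^sub>0 'k) \<subseteq> {g. gval g}" by simp
qed

text \<open>Surjectivity of the prism map on homology. A relative cycle is a cycle of the cone, and
  the contraction writes it as \<open>dG v\<close>; the section part of \<open>v\<close> is the
  cycle \<open>s\<close>, its simplex part is \<open>y\<close>.\<close>

theorem prism_surj:
  fixes z :: "'x \<Rightarrow>\<^sub>0 'k::field"
  assumes z: "Poly_Mapping.keys z \<subseteq> simplices X (Suc n)"
    and rel: "relX n (lift (bds X (Suc n)) z) = 0"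
  obtains s y where "Poly_Mapping.keys s \<subseteq> SS n" "lift (bds S1 n) s = 0"
    "Poly_Mapping.keys y \<subseteq> simplices X (Suc (Suc n))"
    "relX (Suc n) z = lift (Pr n) s + relX (Suc n) (lift (bds X (Suc (Suc n))) y)"
proof -
  define w where "w = (lift (\<lambda>x. sing (toQ (Suc n) x)) (relX (Suc n) z) :: _ \<Rightarrow>\<^sub>0 'k)"
  define v where "v = lift sG w"
  have kw: "Poly_Mapping.keys w \<subseteq> {g. gval g}" unfolding w_def by (rule gval_toQ_chain[OF z])
  have kv: "Poly_Mapping.keys v \<subseteq> {g. gval g}" unfolding v_def by (rule keys_sG[OF kw])
  have "lift dG w = 0" unfolding w_def relX_bds_toQ[OF z] rel by simp
  then have dv: "lift dG v = w" using dG_sG_chain[OF kw] unfolding v_def by simp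
  \<comment> \<open>The chain \<open>w\<close> has no section component, so the section component of
    \<open>v\<close> is a cycle.\<close>
  have "lift (bds S1 n) (lift (partT n) v) = 0"
  proof (cases n)
    case (Suc m)
    have "lift (partT m) w = 0" unfolding w_def lift_lift[of "partT m"] by simp
    then show ?thesis using parts_dG_chain(1)[OF kv, of m] dv Suc by simp
  qed simp
  moreover have "lift (partQ (Suc n)) w = relX (Suc n) z"
    unfolding w_def using partQ_toQ_chain[of "relX (Suc n) z" "Suc n" "Suc n"] keys_relX[OF z] by auto
  then have "relX (Suc n) z = lift (Pr n) (lift (partT n) v)
      + relX (Suc n) (lift (bds X (Suc (Suc n))) (lift (partQ (Suc (Suc n))) v))"
    using parts_dG_chain(2)[OF kv, of n] dv by simp
  ultimately show ?thesis using that keys_parts[OF kv] by blast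
qed

text \<open>Injectivity on homology. If \<open>y\<close> relatively bounds the prism of
  \<open>s\<close>, then \<open>s\<close> minus \<open>y\<close> is a cycle of the cone, and a chain
  bounding it has a section part with boundary \<open>s\<close>.\<close>

theorem prism_inj:
  fixes s :: "real list \<times> 'x prism \<Rightarrow>\<^sub>0 'k::field"
  assumes s: "Poly_Mapping.keys s \<subseteq> SS q" "lift (bds S1 q) s = 0"
    and y: "Poly_Mapping.keys y \<subseteq> simplices X (Suc (Suc q))"
    and eq: "lift (Pr q) s = relX (Suc q) (lift (bds X (Suc (Suc q))) y)"
  obtains t where "Poly_Mapping.keys t \<subseteq> SS (Suc q)" "s = lift (bds S1 (Suc q)) t"
proof -
  define a where "a = (lift (\<lambda>s. sing (TB q s)) s :: _ \<Rightarrow>\<^sub>0 'k)"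
  define b where "b = (lift (\<lambda>x. sing (toQ (Suc (Suc q)) x)) (relX (Suc (Suc q)) y) :: _ \<Rightarrow>\<^sub>0 'k)"
  define w where "w = a - b"
  define v where "v = lift sG w"
  have "Poly_Mapping.keys a \<subseteq> {g. gval g}"
    unfolding a_def by (rule keys_lift_subset) (use s(1) SS_gval in auto)
  then have kw: "Poly_Mapping.keys w \<subseteq> {g. gval g}"
    unfolding w_def b_def by (intro keys_diff_subset gval_toQ_chain[OF y])
  have kv: "Poly_Mapping.keys v \<subseteq> {g. gval g}" unfolding v_def by (rule keys_sG[OF kw])
  have "lift dG a = lift (\<lambda>s. lift (\<lambda>s. sing (TB (q - 1) s)) (bds S1 q s)
      + lift (\<lambda>x. sing (toQ (Suc q) x)) (Pr q s)) s"
    unfolding a_def lift_lift[of dG] lift_sing by (rule lift_cong, rule dG_TB) (use s(1) in auto)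
  also have "\<dots> = lift (\<lambda>s. sing (TB (q - 1) s)) (lift (bds S1 q) s)
      + lift (\<lambda>x. sing (toQ (Suc q) x)) (lift (Pr q) s)"
    by (simp only: lift_fun_add lift_lift)
  finally have "lift dG a = lift (\<lambda>x. sing (toQ (Suc q) x)) (relX (Suc q) (lift (bds X (Suc (Suc q))) y))"
    unfolding s(2) eq by simp
  then have "lift dG w = 0" unfolding w_def b_def lift_diff relX_bds_toQ[OF y] by simp
  then have dv: "lift dG v = w" using dG_sG_chain[OF kw] unfolding v_def by simp
  have "lift (partT q) w = s"
    unfolding w_def a_def b_def lift_diff lift_lift[of "partT q"] by simp
  then have "s = lift (bds S1 (Suc q)) (lift (partT (Suc q)) v)"
    using parts_dG_chain(1)[OF kv, of q] dv by simp
  then show ?thesis using that keys_parts(1)[OF kv] by blast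
qed

end


section \<open>Horizontal operators\<close>

lemma sections_cases:
  assumes "s \<in> simplices (sections X h p) q"
  obtains a \<rho> where "s = (a, \<rho>)" "length a = Suc p" "sorted a" "\<rho> \<in> simplices (section_space X h a) q"
  using assms by (auto simp: simplices_sections)

lemma hor_op_simplices:
  assumes "s \<in> simplices (sections X h p) q" "\<alpha> \<in> ops p' p"
  shows "hor_op \<alpha> q s \<in> simplices (sections X h p') q"
proof -
  obtain a \<rho> where s: "s = (a, \<rho>)" "length a = Suc p" "sorted a" "\<rho> \<in> simplices (section_space X h a) q"
    using assms(1) by (rule sections_cases)
  have "length \<alpha> - 1 = p'" using assms(2) by (simp add: ops_def)
  then show ?thesis
    using precomp_section(1)[OF s(4,2) assms(2) op_id_ops] sorted_op_comp[OF assms(2) s(2,3)]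
      length_op_comp[OF assms(2)]
    by (simp add: hor_op_def s(1) simplices_sections)
qed

lemma sev_hor_op:
  assumes "s \<in> simplices (sections X h p) q" "\<alpha> \<in> ops p' p" "l \<in> grid p' q"
  shows "sev (snd (hor_op \<alpha> q s)) l = sev (snd s) (map (\<lambda>(e, v). (\<alpha> ! e, v)) l)"
proof -
  obtain a \<rho> where s: "s = (a, \<rho>)" "length a = Suc p" "sorted a" "\<rho> \<in> simplices (section_space X h a) q"
    using assms(1) by (rule sections_cases)
  have p': "length \<alpha> - 1 = p'" using assms(2) by (simp add: ops_def)
  have M: "map (\<lambda>(e, v). (\<alpha> ! e, op_id q ! v)) l = map (\<lambda>(e, v). (\<alpha> ! e, v)) l"
    using assms(3) by (auto simp: grid_def op_id_def simp del: upt_Suc)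
  have "snd (hor_op \<alpha> q s) = precomp p' q \<alpha> (op_id q) \<rho>"
    unfolding hor_op_def s(1) p'[symmetric] by simp
  then show ?thesis unfolding s(1) snd_conv
    using precomp_section(2)[OF s(4,2) assms(2) op_id_ops assms(3)] M by (simp only:)
qed

lemma sev_act:
  assumes "s \<in> simplices (sections X h p) q" "\<beta> \<in> ops q' q" "l \<in> grid p q'"
  shows "sev (snd (act (sections X h p) q s \<beta>)) l = sev (snd s) (map (\<lambda>(e, v). (e, \<beta> ! v)) l)"
proof -
  obtain a \<rho> where s: "s = (a, \<rho>)" "length a = Suc p" "sorted a" "\<rho> \<in> simplices (section_space X h a) q"
    using assms(1) by (rule sections_cases)
  have q': "length \<beta> - 1 = q'" using assms(2) by (simp add: ops_def)
  have M: "map (\<lambda>(e, v). (op_id p ! e, \<beta> ! v)) l = map (\<lambda>(e, v). (e, \<beta> ! v)) l"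
    using assms(3) by (auto simp: grid_def op_id_def simp del: upt_Suc)
  have "snd (act (sections X h p) q s \<beta>) = precomp p q' (op_id p) \<beta> \<rho>"
    unfolding s(1) act_sections[OF s(2)] q'[symmetric] by simp
  then show ?thesis unfolding s(1) snd_conv
    using precomp_section(2)[OF s(4,2) op_id_ops assms(2,3)] M by (simp only:)
qed

lemma fst_act: "s \<in> simplices (sections X h p) q \<Longrightarrow> fst (act (sections X h p) q s \<beta>) = fst s"
  by (erule sections_cases) (simp add: act_sections)

lemma fst_hor_op: "fst (hor_op \<alpha> q s) = op_comp (fst s) \<alpha>"
  by (simp add: hor_op_def split_def)

lemma sections_eqI:
  assumes "s \<in> simplices (sections X h p) q" "s' \<in> simplices (sections X h p) q"
    and "fst s = fst s'" "\<And>l. l \<in> grid p q \<Longrightarrow> sev (snd s) l = sev (snd s') l"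
  shows "s = s'"
proof -
  obtain a \<rho> where s: "s = (a, \<rho>)" "length a = Suc p" "\<rho> \<in> simplices (section_space X h a) q"
    using assms(1) by (rule sections_cases)
  obtain \<rho>' where s': "s' = (a, \<rho>')" "\<rho>' \<in> simplices (section_space X h a) q"
    using assms(2,3) by (auto simp: s(1) simplices_sections)
  show ?thesis using section_eqI[OF s(3) s'(2) s(2)] assms(4) by (simp add: s(1) s'(1))
qed

text \<open>The two kinds of operators act on different factors of the prism, so horizontal
  operators are simplicial maps, hence chain maps as in \<open>bds_horc\<close>.\<close>

lemma hor_op_act:
  assumes "s \<in> simplices (sections X h p) q" "\<alpha> \<in> ops p' p" "\<beta> \<in> ops q' q"
  shows "hor_op \<alpha> q' (act (sections X h p) q s \<beta>) = act (sections X h p') q (hor_op \<alpha> q s) \<beta>"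
proof (rule sections_eqI)
  note SS = simplicial_set_sections
  have a: "act (sections X h p) q s \<beta> \<in> simplices (sections X h p) q'"
    by (rule simplicial_setD(1)[OF SS assms(1,3)])
  have b: "hor_op \<alpha> q s \<in> simplices (sections X h p') q" by (rule hor_op_simplices[OF assms(1,2)])
  show "hor_op \<alpha> q' (act (sections X h p) q s \<beta>) \<in> simplices (sections X h p') q'"
    by (rule hor_op_simplices[OF a assms(2)])
  show "act (sections X h p') q (hor_op \<alpha> q s) \<beta> \<in> simplices (sections X h p') q'"
    by (rule simplicial_setD(1)[OF SS b assms(3)])
  show "fst (hor_op \<alpha> q' (act (sections X h p) q s \<beta>)) = fst (act (sections X h p') q (hor_op \<alpha> q s) \<beta>)"
    by (simp add: fst_hor_op fst_act[OF assms(1)] fst_act[OF b])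
  fix l assume l: "l \<in> grid p' q'"
  have l1: "map (\<lambda>(e, v). (\<alpha> ! e, v)) l \<in> grid p q'"
  proof -
    have "map (\<lambda>(e, v). (\<alpha> ! e, op_id q' ! v)) l = map (\<lambda>(e, v). (\<alpha> ! e, v)) l"
      using l by (auto simp: grid_def op_id_def simp del: upt_Suc)
    then show ?thesis using grid_map[OF l assms(2) op_id_ops[of q']] by (simp only:)
  qed
  have l2: "map (\<lambda>(e, v). (e, \<beta> ! v)) l \<in> grid p' q"
  proof -
    have "map (\<lambda>(e, v). (op_id p' ! e, \<beta> ! v)) l = map (\<lambda>(e, v). (e, \<beta> ! v)) l"
      using l by (auto simp: grid_def op_id_def simp del: upt_Suc)
    then show ?thesis using grid_map[OF l op_id_ops[of p'] assms(3)] by (simp only:)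
  qed
  show "sev (snd (hor_op \<alpha> q' (act (sections X h p) q s \<beta>))) l
    = sev (snd (act (sections X h p') q (hor_op \<alpha> q s) \<beta>)) l"
    unfolding sev_hor_op[OF a assms(2) l] sev_act[OF assms(1,3) l1] sev_act[OF b assms(3) l]
      sev_hor_op[OF assms(1,2) l2]
    by (simp add: comp_def split_def)
qed

abbreviation horc :: "nat list \<Rightarrow> nat \<Rightarrow> (real list \<times> 'x prism \<Rightarrow>\<^sub>0 'k::field) \<Rightarrow> (real list \<times> 'x prism \<Rightarrow>\<^sub>0 'k)" where
  "horc \<alpha> q \<equiv> lift (\<lambda>s. sing (hor_op \<alpha> q s))"

lemma bds_horc:
  assumes "Poly_Mapping.keys z \<subseteq> simplices (sections X h p) q" "\<alpha> \<in> ops p' p"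
  shows "lift (bds (sections X h p') q) (horc \<alpha> q z) = horc \<alpha> (q - 1) (lift (bds (sections X h p) q) z)"
  unfolding lift_lift lift_sing
proof (rule lift_cong)
  fix s assume "s \<in> Poly_Mapping.keys z"
  then have s: "s \<in> simplices (sections X h p) q" using assms(1) by auto
  show "bds (sections X h p') q (hor_op \<alpha> q s) = horc \<alpha> (q - 1) (bds (sections X h p) q s)"
  proof (cases q)
    case (Suc m)
    have "hor_op \<alpha> m (act (sections X h p) q s (coface m i))
        = act (sections X h p') q (hor_op \<alpha> q s) (coface m i)" if "i \<le> Suc m" for i
      by (rule hor_op_act[OF s assms(2)]) (use coface_ops[OF that] Suc in simp)
    then show ?thesis unfolding Suc bds_def
      by (simp add: lift_sum lift_scale lift_add del: sum.atMost_Suc)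
  qed simp
qed

lemma keys_horc:
  assumes "Poly_Mapping.keys z \<subseteq> simplices (sections X h p) q" "\<alpha> \<in> ops p' p"
  shows "Poly_Mapping.keys (horc \<alpha> q z) \<subseteq> simplices (sections X h p') q"
proof (rule keys_lift_subset)
  fix s assume "s \<in> Poly_Mapping.keys z"
  then show "Poly_Mapping.keys (sing (hor_op \<alpha> q s)) \<subseteq> simplices (sections X h p') q"
    using hor_op_simplices[OF subsetD[OF assms(1)] assms(2)] by simp
qed

text \<open>The simplicial operators of the section spaces keep the sequence \<open>a\<close>, so
  their chains split according to it; this is the projection to the summands selected by
  \<open>P\<close>.\<close>

definition restr :: "(real list \<Rightarrow> bool) \<Rightarrow> (real list \<times> 'x prism \<Rightarrow>\<^sub>0 'k::field) \<Rightarrow> (real list \<times> 'x prism \<Rightarrow>\<^sub>0 'k)" where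
  "restr P = lift (\<lambda>s. if P (fst s) then sing s else 0)"

lemma bds_restr:
  assumes "Poly_Mapping.keys z \<subseteq> simplices (sections X h p) q"
  shows "lift (bds (sections X h p) q) (restr P z) = restr P (lift (bds (sections X h p) q) z)"
  unfolding restr_def lift_lift
proof (rule lift_cong)
  fix s assume "s \<in> Poly_Mapping.keys z"
  then have s: "s \<in> simplices (sections X h p) q" using assms by auto
  show "lift (bds (sections X h p) q) (if P (fst s) then sing s else 0)
    = lift (\<lambda>s. if P (fst s) then sing s else 0) (bds (sections X h p) q s)"
    using fst_act[OF s]
    by (cases q) (simp_all add: bds_def lift_sum lift_scale lift_add del: sum.atMost_Suc)
qed

lemma keys_restr:
  "s \<in> Poly_Mapping.keys (restr P z) \<Longrightarrow> P (fst s) \<and> s \<in> Poly_Mapping.keys z"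
  unfolding restr_def by (erule in_keys_lift) (auto split: if_splits)

lemma restr_id: "(\<And>s. s \<in> Poly_Mapping.keys z \<Longrightarrow> P (fst s)) \<Longrightarrow> restr P z = z"
proof -
  assume "\<And>s. s \<in> Poly_Mapping.keys z \<Longrightarrow> P (fst s)"
  then have "restr P z = lift sing z" unfolding restr_def by (intro lift_cong) auto
  then show ?thesis by simp
qed

lemma restr_zero: "(\<And>s. s \<in> Poly_Mapping.keys z \<Longrightarrow> \<not> P (fst s)) \<Longrightarrow> restr P z = 0"
proof -
  assume "\<And>s. s \<in> Poly_Mapping.keys z \<Longrightarrow> \<not> P (fst s)"
  then have "restr P z = lift (\<lambda>_. 0) z" unfolding restr_def by (intro lift_cong) auto
  then show ?thesis by simp
qed

lemma restr_split: "restr P z + restr (\<lambda>a. \<not> P a) z = z"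
proof -
  have "restr P z + restr (\<lambda>a. \<not> P a) z = lift sing z"
    unfolding restr_def lift_fun_add[symmetric] by (rule lift_cong) auto
  then show ?thesis by simp
qed


section \<open>Repeated levels\<close>

definition rep :: "real list \<Rightarrow> bool" where
  "rep a \<longleftrightarrow> (\<exists>j. Suc j < length a \<and> a ! j = a ! Suc j)"

text \<open>A choice that depends on \<open>a\<close> alone and is therefore unchanged by the
  operators in the \<open>q\<close> direction; the homotopy below inherits its naturality from
  this.\<close>

definition repj :: "real list \<Rightarrow> nat" where
  "repj a = (LEAST j. Suc j < length a \<and> a ! j = a ! Suc j)"

lemma repj: "rep a \<Longrightarrow> Suc (repj a) < length a \<and> a ! repj a = a ! Suc (repj a)"
  unfolding rep_def repj_def by (rule LeastI_ex)

text \<open>If \<open>a\<^sub>j = a\<^sub>j\<^sub>+\<^sub>1\<close>, the map \<open>\<delta>\<^sup>j\<^sup>+\<^sup>1 \<sigma>\<^sup>j\<close> lies below the identity and is compatible with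
  \<open>a\<close>; \<open>flat j l\<close> is the homotopy between the two along \<open>l\<close>.\<close>

definition flat :: "nat \<Rightarrow> (nat \<times> nat) list \<Rightarrow> nat \<times> nat \<Rightarrow> nat \<times> nat" where
  "flat j l = (\<lambda>(u, w). (if fst (l ! w) = 0 \<and> u = Suc j then j else u, snd (l ! w)))"

text \<open>The homotopy evaluated at a simplex \<open>l\<close> of the product of the 1-simplex and
  the \<open>q\<close>-simplex. The second coordinates in \<open>k\<close> are positions in
  \<open>l\<close>.\<close>

definition flat_section :: "nat \<Rightarrow> nat \<Rightarrow> real list \<times> 'x prism \<Rightarrow> (nat \<times> nat) list \<Rightarrow> real list \<times> 'x prism" where
  "flat_section p q s l = (fst s, section_of p (length l - 1) (\<lambda>k. sev (snd s) (map (flat (repj (fst s)) l) k)))"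

text \<open>Monotone because the collapsing map lies below the identity and is applied at tag 0,
  which precedes tag 1.\<close>

lemma grid_flat:
  assumes l: "l \<in> grid (Suc 0) q" and k: "k \<in> grid p (length l - 1)"
  shows "map (flat j l) k \<in> grid p q"
proof -
  have lw: "fst (l ! w) \<le> Suc 0" "snd (l ! w) \<le> q" if "w < length l" for w
    using l nth_mem[OF that] by (auto simp: grid_def)
  have kx: "fst x \<le> p" "snd x < length l" if "x \<in> set k" for x
    using k l that by (cases l; force simp: grid_def)+
  have mono: "fst (l ! v) \<le> fst (l ! w)" "snd (l ! v) \<le> snd (l ! w)" if "v \<le> w" "w < length l" for v w
    using l that sorted_nth_mono[of "map fst l" v w] sorted_nth_mono[of "map snd l" v w]
    by (auto simp: grid_def)
  have s: "sorted_wrt (\<lambda>x y. fst x \<le> fst y \<and> snd x \<le> snd y) k"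
    using k by (simp add: grid_def sorted_wrt_conj sorted_map)
  have "sorted_wrt (\<lambda>x y. fst (flat j l x) \<le> fst (flat j l y) \<and> snd (flat j l x) \<le> snd (flat j l y)) k"
  proof (rule sorted_wrt_mono_rel[OF _ s])
    fix x y assume xy: "x \<in> set k" "y \<in> set k" "fst x \<le> fst y \<and> snd x \<le> snd y"
    have "fst (l ! snd x) \<le> fst (l ! snd y)" "snd (l ! snd x) \<le> snd (l ! snd y)"
      using mono[of "snd x" "snd y"] xy kx by auto
    then show "fst (flat j l x) \<le> fst (flat j l y) \<and> snd (flat j l x) \<le> snd (flat j l y)"
      using xy(3) by (auto simp: flat_def split_def)
  qed
  moreover have "set (map (flat j l) k) \<subseteq> {..p} \<times> {..q}"
    using kx lw by (fastforce simp: flat_def split_def)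
  moreover have "k \<noteq> []" using k by (auto simp: grid_def)
  moreover have "sorted (map fst (map (flat j l) k))" "sorted (map snd (map (flat j l) k))"
    if "sorted_wrt (\<lambda>x y. fst (flat j l x) \<le> fst (flat j l y) \<and> snd (flat j l x) \<le> snd (flat j l y)) k"
    using that unfolding sorted_wrt_conj sorted_map sorted_wrt_map by blast+
  ultimately show ?thesis unfolding grid_def by simp
qed

text \<open>Moving \<open>Suc j\<close> down to \<open>j\<close> leaves all heights unchanged,
  because these two entries of \<open>a\<close> agree.\<close>

lemma flat_section_simplices:
  assumes s: "s \<in> simplices (sections X h p) q" and r: "rep (fst s)"
    and l: "l \<in> grid (Suc 0) q" "length l = Suc n"
  shows "flat_section p q s l \<in> simplices (sections X h p) n"
proof -
  obtain a \<rho> where sa: "s = (a, \<rho>)" "length a = Suc p" "sorted a" "\<rho> \<in> simplices (section_space X h a) q"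
    using s by (rule sections_cases)
  let ?f = "flat (repj a) l"
  have j: "a ! repj a = a ! Suc (repj a)" using repj r by (simp add: sa(1))
  have "section_of p n (\<lambda>k. sev \<rho> (map ?f k)) \<in> simplices (section_space X h a) n"
  proof (rule section_of_section[OF sa(2)])
    fix k N assume k: "k \<in> grid p n" "length k = Suc N"
    have g: "map ?f k \<in> grid p q" "length (map ?f k) = Suc N"
      using grid_flat[OF l(1)] k l(2) by auto
    show "sev \<rho> (map ?f k) \<in> simplices X N" by (rule sev_section(1)[OF sa(4,2) g])
    show "h N (sev \<rho> (map ?f k)) = map (\<lambda>x. a ! fst x) k"
      unfolding sev_section(2)[where h = h, OF sa(4,2) g] using j by (auto simp: flat_def split_def)
    fix m \<theta> assume \<theta>: "\<theta> \<in> ops m N"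
    show "act X N (sev \<rho> (map ?f k)) \<theta> = sev \<rho> (map ?f (op_comp k \<theta>))"
      unfolding sev_section(3)[OF sa(4,2) g \<theta>] op_comp_map[OF \<theta> k(2)] ..
  qed
  then show ?thesis using sa l(2) by (simp add: flat_section_def simplices_sections)
qed

lemma sev_flat_section:
  assumes "length l = Suc n" "k \<in> grid p n"
  shows "sev (snd (flat_section p q s l)) k = sev (snd s) (map (flat (repj (fst s)) l) k)"
  using assms by (simp add: flat_section_def sev_section_of)

lemma grid_snd:
  assumes "k \<in> grid p m" "\<theta> \<in> ops m n"
  shows "map (\<lambda>(e, v). (e, \<theta> ! v)) k \<in> grid p n"
proof -
  have "map (\<lambda>(e, v). (op_id p ! e, \<theta> ! v)) k = map (\<lambda>(e, v). (e, \<theta> ! v)) k"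
    using assms(1) by (auto simp: grid_def op_id_def simp del: upt_Suc)
  then show ?thesis using grid_map[OF assms(1) op_id_ops[of p] assms(2)] by (simp only:)
qed

lemma flat_section_act:
  assumes s: "s \<in> simplices (sections X h p) q" and r: "rep (fst s)"
    and l: "l \<in> grid (Suc 0) q" "length l = Suc n" and \<theta>: "\<theta> \<in> ops m n"
  shows "act (sections X h p) n (flat_section p q s l) \<theta> = flat_section p q s (op_comp l \<theta>)"
proof (rule sections_eqI)
  have f: "flat_section p q s l \<in> simplices (sections X h p) n" by (rule flat_section_simplices[OF s r l])
  have g: "op_comp l \<theta> \<in> grid (Suc 0) q" "length (op_comp l \<theta>) = Suc m"
    by (rule grid_op_comp[OF l \<theta>], rule length_op_comp[OF \<theta>])
  show "act (sections X h p) n (flat_section p q s l) \<theta> \<in> simplices (sections X h p) m"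
    by (rule simplicial_setD(1)[OF simplicial_set_sections f \<theta>])
  show "flat_section p q s (op_comp l \<theta>) \<in> simplices (sections X h p) m"
    by (rule flat_section_simplices[OF s r g])
  show "fst (act (sections X h p) n (flat_section p q s l) \<theta>) = fst (flat_section p q s (op_comp l \<theta>))"
    unfolding fst_act[OF f] by (simp add: flat_section_def)
  fix k assume k: "k \<in> grid p m"
  have "map (flat (repj (fst s)) l) (map (\<lambda>(e, v). (e, \<theta> ! v)) k) = map (flat (repj (fst s)) (op_comp l \<theta>)) k"
  proof -
    have "v < length \<theta>" if "(e, v) \<in> set k" for e v
      using that k \<theta> by (auto simp: grid_def ops_def)
    then show ?thesis by (auto simp: flat_def op_comp_def)
  qed
  then show "sev (snd (act (sections X h p) n (flat_section p q s l) \<theta>)) k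
      = sev (snd (flat_section p q s (op_comp l \<theta>))) k"
    unfolding sev_act[OF f \<theta> k] sev_flat_section[OF l(2) grid_snd[OF k \<theta>]] sev_flat_section[OF g(2) k]
    by (simp only:)
qed

lemma flat_section_nat:
  assumes s: "s \<in> simplices (sections X h p) q" and r: "rep (fst s)"
    and \<beta>: "\<beta> \<in> ops m q" and w: "w \<in> grid (Suc 0) m"
  shows "flat_section p m (act (sections X h p) q s \<beta>) w
    = flat_section p q s (map (\<lambda>(e, v). (e, \<beta> ! v)) w)"
proof -
  obtain n where n: "length w = Suc n" using w by (cases w) (auto simp: grid_def)
  let ?s = "act (sections X h p) q s \<beta>" and ?w = "map (\<lambda>(e, v). (e, \<beta> ! v)) w"
  have s': "?s \<in> simplices (sections X h p) m" by (rule simplicial_setD(1)[OF simplicial_set_sections s \<beta>])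
  have f: "fst ?s = fst s" by (rule fst_act[OF s])
  have w': "?w \<in> grid (Suc 0) q" "length ?w = Suc n" using grid_snd[OF w \<beta>] n by auto
  show ?thesis
  proof (rule sections_eqI)
    show "flat_section p m ?s w \<in> simplices (sections X h p) n"
      by (rule flat_section_simplices[OF s' _ w n]) (use r f in simp)
    show "flat_section p q s ?w \<in> simplices (sections X h p) n"
      by (rule flat_section_simplices[OF s r w'])
    show "fst (flat_section p m ?s w) = fst (flat_section p q s ?w)"
      by (simp add: flat_section_def f)
    fix k assume k: "k \<in> grid p n"
    have k': "map (flat (repj (fst s)) w) k \<in> grid p m" using grid_flat[OF w] k n by simp
    have "map (\<lambda>(e, v). (e, \<beta> ! v)) (map (flat (repj (fst s)) w) k) = map (flat (repj (fst s)) ?w) k"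
    proof -
      have "v < length w" if "(e, v) \<in> set k" for e v using that k n by (auto simp: grid_def)
      then show ?thesis by (auto simp: flat_def split_def)
    qed
    then show "sev (snd (flat_section p m ?s w)) k = sev (snd (flat_section p q s ?w)) k"
      unfolding sev_flat_section[OF n k] sev_flat_section[OF w'(2) k] f sev_act[OF s \<beta> k'] by (simp only:)
  qed
qed

lemma codegen_ops: "j \<le> n \<Longrightarrow> codegen n j \<in> ops (Suc n) n"
  by (auto simp: ops_def codegen_def sorted_iff_nth_mono simp del: upt_Suc)

definition flatK :: "nat \<Rightarrow> nat \<Rightarrow> real list \<times> 'x prism \<Rightarrow> (real list \<times> 'x prism \<Rightarrow>\<^sub>0 'k::field)" where
  "flatK p q s = lift (\<lambda>w. sing (flat_section p q s w)) (prisml (diag q))"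

lemma grid_upper: "upper (diag q) \<in> grid (Suc 0) q" "lower (diag q) \<in> grid (Suc 0) q"
  by (auto simp: grid_def comp_def sorted_iff_nth_mono simp del: upt_Suc)

text \<open>At the upper end nothing is collapsed. At the lower end \<open>Suc j\<close> is sent to
  \<open>j\<close> everywhere, which is precomposition with a coface after a codegeneracy.\<close>

lemma flat_homotopy:
  assumes s: "s \<in> simplices (sections X h (Suc p)) q" and r: "rep (fst s)"
  shows "lift (bds (sections X h (Suc p)) (Suc q)) (flatK (Suc p) q s)
      + lift (flatK (Suc p) (q - 1)) (bds (sections X h (Suc p)) q s)
    = (sing s - sing (hor_op (codegen p (repj (fst s))) q (hor_op (coface p (Suc (repj (fst s)))) q s))
        :: _ \<Rightarrow>\<^sub>0 'k::field)"
proof -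
  let ?Y = "sections X h (Suc p)" and ?j = "repj (fst s)"
  obtain a \<rho> where sa: "s = (a, \<rho>)" "length a = Suc (Suc p)" "sorted a" "\<rho> \<in> simplices (section_space X h a) q"
    using s by (rule sections_cases)
  have j: "?j \<le> p" "a ! ?j = a ! Suc ?j" using repj[OF r] sa by auto
  have "lift (bds ?Y (Suc q)) (flatK (Suc p) q s) + lift (flatK (Suc p) (q - 1)) (bds ?Y q s)
    = (sing (flat_section (Suc p) q s (upper (diag q))) - sing (flat_section (Suc p) q s (lower (diag q)))
        :: _ \<Rightarrow>\<^sub>0 'k)"
    unfolding flatK_def
  proof (rule prism_homotopy)
    fix l i assume l: "l \<in> grid (Suc 0) q" "length l = Suc (Suc q)" and i: "i \<le> Suc q"
    show "act ?Y (Suc q) (flat_section (Suc p) q s l) (coface q i) = flat_section (Suc p) q s (rmn i l)"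
      unfolding flat_section_act[OF s r l coface_ops[OF i]] op_comp_coface[OF l(2) i] ..
  next
    fix m i w assume q: "q = Suc m" and i: "i \<le> Suc m" and w: "w \<in> grid (Suc 0) m"
    have "coface m i \<in> ops m q" using coface_ops[OF i] q by simp
    then show "flat_section (Suc p) m (act ?Y q s (coface m i)) w
      = flat_section (Suc p) q s (map (\<lambda>(e, v). (e, coface m i ! v)) w)"
      by (rule flat_section_nat[OF s r _ w])
  qed
  moreover have "flat_section (Suc p) q s (upper (diag q)) = s"
  proof (rule sections_eqI[OF flat_section_simplices[OF s r grid_upper(1)] s])
    fix k assume k: "k \<in> grid (Suc p) q"
    have "map (flat ?j (upper (diag q))) k = k"
      by (rule map_idI) (use k in \<open>auto simp: flat_def grid_def simp del: upt_Suc\<close>)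
    then show "sev (snd (flat_section (Suc p) q s (upper (diag q)))) k = sev (snd s) k"
      using sev_flat_section[of "upper (diag q)" q k "Suc p" q s] k by (simp del: upt_Suc)
  qed (simp_all add: flat_section_def)
  moreover have "flat_section (Suc p) q s (lower (diag q))
      = hor_op (codegen p ?j) q (hor_op (coface p (Suc ?j)) q s)"
  proof -
    have c: "coface p (Suc ?j) \<in> ops p (Suc p)" "codegen p ?j \<in> ops (Suc p) p"
      using coface_ops[of "Suc ?j" p] codegen_ops[of ?j p] j by auto
    have d: "hor_op (coface p (Suc ?j)) q s \<in> simplices (sections X h p) q"
      by (rule hor_op_simplices[OF s c(1)])
    \<comment> \<open>The composite is the identity except that it sends \<open>Suc ?j\<close> to
      \<open>?j\<close>.\<close>
    have cc: "coface p (Suc ?j) ! (codegen p ?j ! u) = (if u = Suc ?j then ?j else u)" if "u \<le> Suc p" for u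
      using that j by (auto simp: coface_def codegen_def simp del: upt_Suc)
    show ?thesis
    proof (rule sections_eqI[OF flat_section_simplices[OF s r grid_upper(2)] hor_op_simplices[OF d c(2)]])
      show "length (lower (diag q)) = Suc q" by simp
      have "op_comp (op_comp a (coface p (Suc ?j))) (codegen p ?j) = a"
      proof (rule nth_equalityI)
        show len: "length (op_comp (op_comp a (coface p (Suc ?j))) (codegen p ?j)) = length a"
          using length_op_comp[OF c(2)] sa(2) by simp
        fix u assume "u < length (op_comp (op_comp a (coface p (Suc ?j))) (codegen p ?j))"
        then have u: "u \<le> Suc p" using len sa(2) by simp
        then have "codegen p ?j ! u \<le> p" using c(2) by (auto simp: ops_def subset_iff)
        then have "op_comp (op_comp a (coface p (Suc ?j))) (codegen p ?j) ! u
            = a ! (coface p (Suc ?j) ! (codegen p ?j ! u))"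
          using u c by (simp add: op_comp_def ops_def)
        then show "op_comp (op_comp a (coface p (Suc ?j))) (codegen p ?j) ! u = a ! u"
          using cc[OF u] j(2) by (simp split: if_splits)
      qed
      then show "fst (flat_section (Suc p) q s (lower (diag q)))
        = fst (hor_op (codegen p ?j) q (hor_op (coface p (Suc ?j)) q s))"
        by (simp add: fst_hor_op flat_section_def sa(1))
      fix k assume k: "k \<in> grid (Suc p) q"
      have k': "map (\<lambda>(e, v). (codegen p ?j ! e, v)) k \<in> grid p q"
      proof -
        have "map (\<lambda>(e, v). (codegen p ?j ! e, op_id q ! v)) k = map (\<lambda>(e, v). (codegen p ?j ! e, v)) k"
          using k by (auto simp: grid_def op_id_def simp del: upt_Suc)
        then show ?thesis using grid_map[OF k c(2) op_id_ops[of q]] by (simp only:)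
      qed
      have "map (flat ?j (lower (diag q))) k
          = map ((\<lambda>(e, v). (coface p (Suc ?j) ! e, v)) \<circ> (\<lambda>(e, v). (codegen p ?j ! e, v))) k"
      proof (rule map_cong[OF refl])
        fix x assume "x \<in> set k"
        then have "fst x \<le> Suc p" "snd x \<le> q" using k by (auto simp: grid_def)
        then show "flat ?j (lower (diag q)) x
            = ((\<lambda>(e, v). (coface p (Suc ?j) ! e, v)) \<circ> (\<lambda>(e, v). (codegen p ?j ! e, v))) x"
          using cc[of "fst x"] by (auto simp: flat_def split_def simp del: upt_Suc)
      qed
      from this[folded map_map] show "sev (snd (flat_section (Suc p) q s (lower (diag q)))) k
        = sev (snd (hor_op (codegen p ?j) q (hor_op (coface p (Suc ?j)) q s))) k"
        using sev_flat_section[of "lower (diag q)" q k "Suc p" q s] k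
        unfolding sev_hor_op[OF d c(2) k] sev_hor_op[OF s c(1) k'] by (simp del: upt_Suc map_map)
    qed
  qed
  ultimately show ?thesis by simp
qed

lemma keys_flatK:
  assumes s: "s \<in> simplices (sections X h p) q" and r: "rep (fst s)"
  shows "Poly_Mapping.keys (flatK p q s :: _ \<Rightarrow>\<^sub>0 'k::field) \<subseteq> simplices (sections X h p) (Suc q)"
  unfolding flatK_def
proof (rule keys_lift_subset)
  fix w assume "w \<in> Poly_Mapping.keys (prisml (diag q) :: _ \<Rightarrow>\<^sub>0 'k)"
  from flat_section_simplices[OF s r keys_prism_diag(1,2)[OF this]]
  show "Poly_Mapping.keys (sing (flat_section p q s w) :: _ \<Rightarrow>\<^sub>0 'k) \<subseteq> simplices (sections X h p) (Suc q)"
    by simp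
qed

text \<open>The operators in the \<open>q\<close> direction preserve \<open>repj\<close>, so the
  pieces of \<open>z\<close> with a fixed value \<open>j\<close> are cycles themselves. The homotopy
  moves each piece to the \<open>j\<close>-th degeneracy of its face \<open>c j\<close>.\<close>

lemma degenerate_cycle:
  fixes z :: "real list \<times> 'x prism \<Rightarrow>\<^sub>0 'k::field"
  assumes z: "Poly_Mapping.keys z \<subseteq> simplices (sections X h (Suc p)) q"
    and r: "\<And>s. s \<in> Poly_Mapping.keys z \<Longrightarrow> rep (fst s)"
    and cyc: "lift (bds (sections X h (Suc p)) q) z = 0"
  obtains t c where "Poly_Mapping.keys t \<subseteq> simplices (sections X h (Suc p)) (Suc q)"
    and "\<And>j. j \<le> p \<Longrightarrow> Poly_Mapping.keys (c j) \<subseteq> simplices (sections X h p) q"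
    and "\<And>j. j \<le> p \<Longrightarrow> lift (bds (sections X h p) q) (c j) = 0"
    and "z = lift (bds (sections X h (Suc p)) (Suc q)) t + (\<Sum>j\<le>p. horc (codegen p j) q (c j))"
proof -
  let ?Y = "sections X h (Suc p)"
  define zj where "zj j = restr (\<lambda>a. repj a = j) z" for j
  define c where "c j = horc (coface p (Suc j)) q (zj j)" for j
  define t where "t = lift (flatK (Suc p) q) z"
  have zj: "Poly_Mapping.keys (zj j) \<subseteq> simplices ?Y q" for j
    using keys_restr z unfolding zj_def by blast
  have zj0: "lift (bds ?Y q) (zj j) = 0" for j
    unfolding zj_def bds_restr[OF z] cyc by (simp add: restr_def)
  have cf: "coface p (Suc j) \<in> ops p (Suc p)" if "j \<le> p" for j using that coface_ops by simp
  have 1: "Poly_Mapping.keys t \<subseteq> simplices ?Y (Suc q)"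
    unfolding t_def by (rule keys_lift_subset, rule keys_flatK) (use z r in auto)
  have 2: "Poly_Mapping.keys (c j) \<subseteq> simplices (sections X h p) q" if "j \<le> p" for j
    unfolding c_def by (rule keys_horc[OF zj cf[OF that]])
  have 3: "lift (bds (sections X h p) q) (c j) = 0" if "j \<le> p" for j
    unfolding c_def bds_horc[OF zj cf[OF that]] zj0 by simp
  have rp: "repj (fst s) \<le> p" if "s \<in> Poly_Mapping.keys z" for s
  proof -
    have "length (fst s) = Suc (Suc p)" using that z by (auto simp: simplices_sections)
    then show ?thesis using repj[OF r[OF that]] by simp
  qed
  have hom: "lift (bds ?Y (Suc q)) (flatK (Suc p) q s) + lift (flatK (Suc p) (q - 1)) (bds ?Y q s)
      = sing s - (\<Sum>j\<le>p. if repj (fst s) = j then sing (hor_op (codegen p j) q (hor_op (coface p (Suc j)) q s)) else 0)"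
    if "s \<in> Poly_Mapping.keys z" for s
    using flat_homotopy[OF subsetD[OF z that] r[OF that]] rp[OF that] by (simp add: sum.delta)
  have "lift (\<lambda>s. lift (bds ?Y (Suc q)) (flatK (Suc p) q s) + lift (flatK (Suc p) (q - 1)) (bds ?Y q s)) z
    = lift (\<lambda>s. sing s - (\<Sum>j\<le>p. if repj (fst s) = j then sing (hor_op (codegen p j) q (hor_op (coface p (Suc j)) q s)) else 0)) z"
    by (rule lift_cong) (rule hom)
  moreover have "lift (\<lambda>s. lift (flatK (Suc p) (q - 1)) (bds ?Y q s)) z = 0"
    unfolding lift_lift[symmetric] cyc by simp
  moreover have "lift (\<lambda>s. lift (bds ?Y (Suc q)) (flatK (Suc p) q s)) z = lift (bds ?Y (Suc q)) t"
    unfolding t_def lift_lift ..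
  moreover have "lift (\<lambda>s. if repj (fst s) = j then sing (hor_op (codegen p j) q (hor_op (coface p (Suc j)) q s)) else 0) z
      = horc (codegen p j) q (c j)" for j
    unfolding c_def zj_def restr_def lift_lift by (rule lift_cong) simp
  ultimately have "lift (bds ?Y (Suc q)) t = z - (\<Sum>j\<le>p. horc (codegen p j) q (c j))"
    by (simp only: lift_fun_add lift_fun_diff lift_fun_sum lift_sing_id add_0_right)
  then have "z = lift (bds ?Y (Suc q)) t + (\<Sum>j\<le>p. horc (codegen p j) q (c j))" by simp
  then show ?thesis using that 1 2 3 by blast
qed


section \<open>Level simplices\<close>

context subdivided_height
begin

text \<open>Restricting a section over \<open>a\<close> to one vertex of the second factor gives a
  simplex with heights \<open>a\<close>. By \<open>two_levels\<close> its entry at index 1 equals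
  the first or the last one, hence by monotonicity the entry at index 0 or at index 2.\<close>

lemma rep_sections:
  assumes "s \<in> simplices (sections X h (Suc (Suc p))) q"
  shows "rep (fst s)"
proof -
  obtain a \<rho> where s: "s = (a, \<rho>)" "length a = Suc (Suc (Suc p))" "sorted a"
    "\<rho> \<in> simplices (section_space X h a) q"
    using assms by (rule sections_cases)
  let ?l = "map (\<lambda>e. (e, 0)) [0..<Suc (Suc (Suc p))]"
  have l: "?l \<in> grid (Suc (Suc p)) q" "length ?l = Suc (Suc (Suc p))"
    by (auto simp: grid_def comp_def sorted_iff_nth_mono simp del: upt_Suc)
  let ?x = "sev \<rho> ?l"
  have x: "?x \<in> simplices X (Suc (Suc p))" by (rule sev_section(1)[OF s(4,2) l])
  have "h (Suc (Suc p)) ?x = map ((!) a) [0..<length a]"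
    unfolding sev_section(2)[OF s(4,2) l] s(2) by (simp del: upt_Suc)
  then have hx: "h (Suc (Suc p)) ?x = a" by (simp only: map_nth)
  have "a ! Suc 0 = a ! 0 \<or> a ! Suc 0 = a ! Suc (Suc p)" using two_levels[OF x, of "Suc 0"] unfolding hx by simp
  moreover have "a ! Suc 0 \<le> a ! Suc (Suc 0)" "a ! Suc (Suc 0) \<le> a ! Suc (Suc p)"
    using sorted_nth_mono[OF s(3)] s(2) by auto
  ultimately have "a ! 0 = a ! Suc 0 \<or> a ! Suc 0 = a ! Suc (Suc 0)" by auto
  then show ?thesis unfolding rep_def s(1) using s(2) by auto
qed

abbreviation S0 :: "(real list \<times> 'x prism) sset" where
  "S0 \<equiv> sections X h 0"

text \<open>Evaluation at the top simplex of the trivial prism. This identifies sections over one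
  level with level simplices of X; the inverse is \<open>un\<close>.\<close>

definition nu :: "nat \<Rightarrow> real list \<times> 'x prism \<Rightarrow> 'x" where
  "nu q s = sev (snd s) (map (Pair 0) [0..<Suc q])"

definition un :: "nat \<Rightarrow> 'x \<Rightarrow> real list \<times> 'x prism" where
  "un q x = ([h q x ! 0], section_of 0 q (\<lambda>l. act X q x (map snd l)))"

lemma grid_0: "map (Pair 0) [0..<Suc q] \<in> grid 0 q" "length (map (Pair 0) [0..<Suc q]) = Suc q"
  by (auto simp: grid_def comp_def sorted_iff_nth_mono simp del: upt_Suc)

lemma snd_grid_ops: "l \<in> grid p q \<Longrightarrow> length l = Suc n \<Longrightarrow> map snd l \<in> ops n q"
  by (auto simp: grid_def ops_def)

lemma sev_level:
  assumes "s \<in> simplices S0 q" "l \<in> grid 0 q" "length l = Suc n"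
  shows "sev (snd s) l = act X q (nu q s) (map snd l)"
proof -
  obtain a \<rho> where s: "s = (a, \<rho>)" "length a = Suc 0" "sorted a" "\<rho> \<in> simplices (section_space X h a) q"
    using assms(1) by (rule sections_cases)
  have "l = op_comp (map (Pair 0) [0..<Suc q]) (map snd l)"
    using assms(2) by (auto simp: op_comp_def grid_def comp_def simp del: upt_Suc intro!: map_idI[symmetric])
  then show ?thesis
    using sev_section(3)[OF s(4,2) grid_0 snd_grid_ops[OF assms(2,3)]]
    by (simp add: nu_def s(1) del: upt_Suc)
qed

lemma nu_level:
  assumes "s \<in> simplices S0 q"
  shows "nu q s \<in> simplices X q" "\<not> mixedX q (nu q s)" "un q (nu q s) = s"
proof -
  obtain a \<rho> where s: "s = (a, \<rho>)" "length a = Suc 0" "sorted a" "\<rho> \<in> simplices (section_space X h a) q"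
    using assms by (rule sections_cases)
  have hn: "h q (nu q s) = map (\<lambda>x. a ! fst x) (map (Pair 0) [0..<Suc q])"
    unfolding nu_def using sev_section(2)[OF s(4,2) grid_0] by (simp add: s(1) del: upt_Suc)
  show "nu q s \<in> simplices X q"
    unfolding nu_def using sev_section(1)[OF s(4,2) grid_0] by (simp add: s(1) del: upt_Suc)
  show "\<not> mixedX q (nu q s)" unfolding mixedX_def hn by (simp del: upt_Suc)
  have "section_of 0 q (\<lambda>l. act X q (nu q s) (map snd l)) = section_of 0 q (sev \<rho>)"
  proof (rule section_of_cong)
    fix l assume l: "l \<in> grid 0 q"
    then obtain n where "length l = Suc n" by (cases l) (auto simp: grid_def)
    from sev_level[OF assms l this] show "act X q (nu q s) (map snd l) = sev \<rho> l" by (simp add: s(1))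
  qed
  moreover have "[h q (nu q s) ! 0] = a" unfolding hn using s(2) by (cases a) (simp_all del: upt_Suc)
  ultimately show "un q (nu q s) = s"
    using section_of_sev[OF s(4,2)] by (simp add: un_def s(1))
qed

lemma un_level:
  assumes "x \<in> simplices X q" "\<not> mixedX q x"
  shows "un q x \<in> simplices S0 q" "nu q (un q x) = x"
proof -
  have eq: "h q x ! k = h q x ! 0" if "k \<le> q" for k
    using two_levels[OF assms(1) that] assms(2) by (auto simp: mixedX_def)
  have "section_of 0 q (\<lambda>l. act X q x (map snd l)) \<in> simplices (section_space X h [h q x ! 0]) q"
  proof (rule section_of_section)
    fix l n assume l: "l \<in> grid 0 q" "length l = Suc n"
    note o = snd_grid_ops[OF l]
    show "act X q x (map snd l) \<in> simplices X n" by (rule simplicial_setD(1)[OF X assms(1) o])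
    have "h q x ! snd y = [h q x ! 0] ! fst y" if "y \<in> set l" for y
    proof -
      have "snd y \<le> q" "fst y = 0" using that l(1) by (auto simp: grid_def)
      then show ?thesis using eq[of "snd y"] by (simp only: nth_Cons_0)
    qed
    then show "h n (act X q x (map snd l)) = map (\<lambda>y. [h q x ! 0] ! fst y) l"
      unfolding height(3)[OF assms(1) o] by (simp add: op_comp_def del: nth_Cons_0)
    fix m \<theta> assume \<theta>: "\<theta> \<in> ops m n"
    show "act X n (act X q x (map snd l)) \<theta> = act X q x (map snd (op_comp l \<theta>))"
      unfolding simplicial_setD(3)[OF X assms(1) o \<theta>] op_comp_map[OF \<theta> l(2)] ..
  qed simp
  then show "un q x \<in> simplices S0 q" by (simp add: un_def simplices_sections)
  have id: "map snd (map (Pair 0) [0..<Suc q]) = op_id q" by (simp add: comp_def op_id_def del: upt_Suc)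
  show "nu q (un q x) = x"
    by (simp only: nu_def un_def snd_conv sev_section_of[OF grid_0(1)] id simplicial_setD(2)[OF X assms(1)])
qed

abbreviation nuc :: "nat \<Rightarrow> (real list \<times> 'x prism \<Rightarrow>\<^sub>0 'k::field) \<Rightarrow> ('x \<Rightarrow>\<^sub>0 'k)" where
  "nuc q \<equiv> lift (\<lambda>s. sing (nu q s))"

lemma keys_nuc: "Poly_Mapping.keys l \<subseteq> simplices S0 q \<Longrightarrow> Poly_Mapping.keys (nuc q l) \<subseteq> simplices X q"
  by (rule keys_lift_subset) (use nu_level in auto)

lemma relX_nuc:
  assumes "Poly_Mapping.keys l \<subseteq> simplices S0 q"
  shows "relX q (nuc q l) = 0"
proof -
  have "relX q (nuc q l) = lift (\<lambda>_. 0) l"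
    unfolding lift_lift lift_sing by (rule lift_cong) (use nu_level assms in auto)
  then show ?thesis by simp
qed

lemma nuc_inj:
  assumes "Poly_Mapping.keys l \<subseteq> simplices S0 q" "nuc q l = 0"
  shows "l = 0"
proof -
  have "lift (\<lambda>x. sing (un q x)) (nuc q l) = lift sing l"
    unfolding lift_lift lift_sing by (rule lift_cong) (use nu_level(3) assms(1) in auto)
  then show ?thesis by (simp add: assms(2))
qed

text \<open>The mixed part and the level part of a chain add up to the chain. Together with
  \<open>nuc_inj\<close> and \<open>relX_nuc\<close>, the kernel of \<open>relX\<close> is the chain
  space of \<open>S0\<close>.\<close>

lemma nuc_surj:
  assumes "Poly_Mapping.keys z \<subseteq> simplices X q" "relX q z = 0"
  obtains l where "Poly_Mapping.keys l \<subseteq> simplices S0 q" "nuc q l = z"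
proof -
  let ?lev = "lift (\<lambda>x. if mixedX q x then 0 else sing x)"
  have "?lev z + relX q z = lift sing z"
    unfolding lift_fun_add[symmetric] by (rule lift_cong) simp
  then have z: "z = ?lev z" using assms(2) by simp
  define l where "l = lift (\<lambda>x. if mixedX q x then 0 else sing (un q x)) z"
  have "Poly_Mapping.keys l \<subseteq> simplices S0 q"
    unfolding l_def by (rule keys_lift_subset) (use un_level(1) assms(1) in auto)
  moreover have "nuc q l = ?lev z"
    unfolding l_def lift_lift by (rule lift_cong) (use un_level(2) assms(1) in auto)
  ultimately show ?thesis using that z by simp
qed

lemma bds_nuc:
  assumes "Poly_Mapping.keys l \<subseteq> simplices S0 q"
  shows "lift (bds X q) (nuc q l) = nuc (q - 1) (lift (bds S0 q) l)"
  unfolding lift_lift lift_sing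
proof (rule lift_cong)
  fix s assume "s \<in> Poly_Mapping.keys l"
  then have s: "s \<in> simplices S0 q" using assms by auto
  show "bds X q (nu q s) = nuc (q - 1) (bds S0 q s)"
  proof (cases q)
    case (Suc m)
    have "act X q (nu q s) (coface m i) = nu m (act S0 q s (coface m i))" if i: "i \<le> Suc m" for i
    proof -
      have c: "coface m i \<in> ops m q" using coface_ops[OF i] Suc by simp
      let ?l = "map (\<lambda>(e, v). (e, coface m i ! v)) (map (Pair (0 :: nat)) [0..<Suc m])"
      have "nu m (act S0 q s (coface m i)) = sev (snd s) ?l"
        unfolding nu_def by (rule sev_act[OF s c grid_0(1)])
      also have "\<dots> = act X q (nu q s) (map snd ?l)"
        by (rule sev_level[OF s grid_snd[OF grid_0(1) c]]) simp
      also have "map snd ?l = map (\<lambda>k. coface m i ! k) [0..<Suc m]" by (simp add: comp_def del: upt_Suc)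
      also have "\<dots> = coface m i" by (rule coface_eq[symmetric])
      finally show ?thesis ..
    qed
    then show ?thesis unfolding Suc bds_def
      by (simp add: lift_sum lift_scale lift_add del: sum.atMost_Suc)
  qed simp
qed

text \<open>The differential of the Reeb complex from degree 1 to degree 0, on chains. Since
  \<open>coface 0 0\<close> omits the lower level, this is upper end minus lower end.\<close>

definition DD :: "nat \<Rightarrow> (real list \<times> 'x prism \<Rightarrow>\<^sub>0 'k::field) \<Rightarrow> (real list \<times> 'x prism \<Rightarrow>\<^sub>0 'k)" where
  "DD q z = horc (coface 0 0) q z - horc (coface 0 (Suc 0)) q z"

text \<open>Without division by level chains the two ends of the prism survive; this identity is the
  reason why \<open>DD\<close> is the connecting map.\<close>

lemma prism_X:
  assumes s: "Poly_Mapping.keys z \<subseteq> simplices S1 q"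
  shows "lift (bds X (Suc q)) (lift (Pr q) z) + lift (Pr (q - 1)) (lift (bds S1 q) z)
    = (nuc q (DD q z) :: _ \<Rightarrow>\<^sub>0 'k::field)"
proof -
  have "lift (bds X (Suc q)) (Pr q s) + lift (Pr (q - 1)) (bds S1 q s)
      = (sing (nu q (hor_op (coface 0 0) q s)) - sing (nu q (hor_op (coface 0 (Suc 0)) q s)) :: _ \<Rightarrow>\<^sub>0 'k)"
    if "s \<in> Poly_Mapping.keys z" for s
  proof -
    have s: "s \<in> simplices S1 q" using that assms by auto
    obtain a \<rho> where sa: "s = (a, \<rho>)" "length a = Suc (Suc 0)" "sorted a" "\<rho> \<in> simplices (section_space X h a) q"
      using s by (rule sections_cases)
    have "lift (bds X (Suc q)) (Pr q s) + lift (Pr (q - 1)) (bds S1 q s)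
        = (sing (sev (snd s) (upper (diag q))) - sing (sev (snd s) (lower (diag q))) :: _ \<Rightarrow>\<^sub>0 'k)"
      unfolding Pr_def
    proof (rule prism_homotopy)
      fix l i assume l: "l \<in> grid (Suc 0) q" "length l = Suc (Suc q)" and i: "i \<le> Suc q"
      show "act X (Suc q) (sev (snd s) l) (coface q i) = sev (snd s) (rmn i l)"
        using sev_section(3)[OF sa(4,2) l coface_ops[OF i]] op_comp_coface[OF l(2) i] by (simp add: sa(1))
    next
      fix m i w assume q: "q = Suc m" and i: "i \<le> Suc m" and w: "w \<in> grid (Suc 0) m"
      have "coface m i \<in> ops m q" using coface_ops[OF i] q by simp
      then show "sev (snd (act S1 q s (coface m i))) w = sev (snd s) (map (\<lambda>(e, v). (e, coface m i ! v)) w)"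
        by (rule sev_act[OF s _ w])
    qed
    moreover have H: "nu q (hor_op (coface 0 i) q s)
        = sev (snd s) (map (\<lambda>(e, v). (coface 0 i ! e, v)) (map (Pair 0) [0..<Suc q]))" if "i \<le> Suc 0" for i
      unfolding nu_def by (rule sev_hor_op[OF s coface_ops[OF that] grid_0(1)])
    have "nu q (hor_op (coface 0 0) q s) = sev (snd s) (upper (diag q))"
      "nu q (hor_op (coface 0 (Suc 0)) q s) = sev (snd s) (lower (diag q))"
      unfolding H[OF le0] H[OF le_refl] by (simp_all add: comp_def coface_def del: upt_Suc)
    ultimately show ?thesis by simp
  qed
  then have "lift (\<lambda>s. lift (bds X (Suc q)) (Pr q s) + lift (Pr (q - 1)) (bds S1 q s)) z
      = lift (\<lambda>s. sing (nu q (hor_op (coface 0 0) q s)) - sing (nu q (hor_op (coface 0 (Suc 0)) q s)) :: _ \<Rightarrow>\<^sub>0 'k) z"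
    by (rule lift_cong)
  then show ?thesis
    by (simp only: lift_fun_add lift_fun_diff lift_lift DD_def lift_diff lift_sing)
qed

end

section \<open>Presentations of modules\<close>

text \<open>All modules of the statement are written as quotients of spaces of finitely supported functions,
  where the linear algebra of type classes is available: \<open>f\<close> maps \<open>Z\<close> onto \<open>M\<close> with kernel \<open>K\<close>.\<close>

definition presents ::
    "('x \<Rightarrow>\<^sub>0 'k::field) set \<Rightarrow> (('x \<Rightarrow>\<^sub>0 'k) \<Rightarrow> 'm) \<Rightarrow> ('k, 'm) module \<Rightarrow> ('x \<Rightarrow>\<^sub>0 'k) set \<Rightarrow> bool" where
  "presents Z f M K \<longleftrightarrow> pm.subspace Z \<and> f ` Z = carrier M \<and>
    (\<forall>x\<in>Z. \<forall>y\<in>Z. f (x + y) = f x \<oplus>\<^bsub>M\<^esub> f y) \<and> (\<forall>r. \<forall>x\<in>Z. f (pscale r x) = r \<odot>\<^bsub>M\<^esub> f x) \<and>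
    f 0 = \<zero>\<^bsub>M\<^esub> \<and> K = {z \<in> Z. f z = \<zero>\<^bsub>M\<^esub>}"

lemma presentsD:
  assumes "presents Z f M K"
  shows "pm.subspace Z" "f ` Z = carrier M" "x \<in> Z \<Longrightarrow> y \<in> Z \<Longrightarrow> f (x + y) = f x \<oplus>\<^bsub>M\<^esub> f y"
    "x \<in> Z \<Longrightarrow> f (pscale r x) = r \<odot>\<^bsub>M\<^esub> f x" "f 0 = \<zero>\<^bsub>M\<^esub>" "z \<in> K \<longleftrightarrow> z \<in> Z \<and> f z = \<zero>\<^bsub>M\<^esub>"
  using assms unfolding presents_def by auto

lemma presents_eq_iff:
  assumes P: "presents Z f M K" and "x \<in> Z" "y \<in> Z"
  shows "f x = f y \<longleftrightarrow> x - y \<in> K"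
proof -
  note P' = presentsD[OF P]
  have my: "- y \<in> Z" "x - y \<in> Z" "0 \<in> Z"
    using assms P'(1) by (auto simp: pm.subspace_neg pm.subspace_diff pm.subspace_0)
  show ?thesis
  proof
    assume "f x = f y"
    then have "f (x + - y) = f (y + - y)"
      unfolding P'(3)[OF assms(2) my(1)] P'(3)[OF assms(3) my(1)] by simp
    then show "x - y \<in> K" using my P'(5,6) by simp
  next
    assume "x - y \<in> K"
    then have "f (x - y) = f 0" using P'(5,6) by simp
    then have "f ((x - y) + y) = f (0 + y)"
      unfolding P'(3)[OF my(2) assms(3)] P'(3)[OF my(3) assms(3)] by simp
    then show "f x = f y" by simp
  qed
qed

lemma presents_kernel_subspace:
  assumes "presents Z f M K" shows "pm.subspace K" "K \<subseteq> Z"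
proof -
  note P' = presentsD[OF assms]
  show "K \<subseteq> Z" using P'(6) by auto
  have 0: "0 \<in> Z" using P'(1) by (rule pm.subspace_0)
  have "x + y \<in> K" if "x \<in> K" "y \<in> K" for x y
    using that P'(3)[OF 0 0] P'(3)[of x y] pm.subspace_add[OF P'(1)] by (simp add: P'(5,6))
  moreover have "pscale r x \<in> K" if "x \<in> K" for r x
    using that P'(4)[OF 0, of r] P'(4)[of x r] pm.subspace_scale[OF P'(1)] by (simp add: P'(5,6))
  ultimately show "pm.subspace K" using 0 by (auto simp: pm.subspace_def P'(5,6))
qed

text \<open>Send \<open>f z\<close> to \<open>g z\<close>; the common kernel makes this well defined
  and injective.\<close>

lemma presents_mod_iso:
  assumes P: "presents Z f M K" and Q: "presents Z g N K"
  shows "mod_iso class_ring M N"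
proof -
  define \<phi> where "\<phi> m = g (SOME z. z \<in> Z \<and> f z = m)" for m
  have \<phi>: "\<phi> (f z) = g z" if "z \<in> Z" for z
  proof -
    have "(SOME w. w \<in> Z \<and> f w = f z) \<in> Z \<and> f (SOME w. w \<in> Z \<and> f w = f z) = f z"
      by (rule someI[of _ z]) (use that in simp)
    then show ?thesis unfolding \<phi>_def using presents_eq_iff[OF P] presents_eq_iff[OF Q] that by blast
  qed
  note P' = presentsD[OF P] and Q' = presentsD[OF Q]
  have "inj_on \<phi> (carrier M)"
    unfolding P'(2)[symmetric] by (auto intro!: inj_onI simp: \<phi> presents_eq_iff[OF P] presents_eq_iff[OF Q])
  moreover have "\<phi> ` carrier M = carrier N"
    unfolding P'(2)[symmetric] Q'(2)[symmetric] image_image by (rule image_cong) (simp_all add: \<phi>)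
  moreover have "\<phi> \<in> LinearCombinations.module_hom class_ring M N"
    unfolding LinearCombinations.module_hom_def P'(2)[symmetric]
    using Q'(2) by (auto simp: \<phi> P'(3)[symmetric] P'(4)[symmetric] Q'(3)[symmetric] Q'(4)[symmetric]
        pm.subspace_add[OF P'(1)] pm.subspace_scale[OF P'(1)])
  ultimately show ?thesis unfolding mod_iso_def bij_betw_def by blast
qed

lemma presents_sub:
  assumes P: "presents Z f M K" and Z': "pm.subspace Z'" "Z' \<subseteq> Z" and C: "C = f ` Z'"
  shows "presents Z' f (M\<lparr>carrier := C\<rparr>) (Z' \<inter> K)"
  using presentsD[OF P] Z' unfolding presents_def C by (auto simp: subset_iff)

text \<open>A smaller space of representatives suffices if it meets every class modulo
  \<open>K\<close>. It serves to replace cycles by cycles over strictly increasing pairs.\<close>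

lemma presents_restrict:
  assumes P: "presents Z f M K" and Z': "pm.subspace Z'" "Z' \<subseteq> Z"
    and sp: "\<And>z. z \<in> Z \<Longrightarrow> \<exists>z'\<in>Z'. z - z' \<in> K"
  shows "presents Z' f M (Z' \<inter> K)"
proof -
  have "f ` Z \<subseteq> f ` Z'"
  proof
    fix m assume "m \<in> f ` Z"
    then obtain z where z: "z \<in> Z" "m = f z" by auto
    with sp obtain z' where "z' \<in> Z'" "z - z' \<in> K" by blast
    then have "f z = f z'" using presents_eq_iff[OF P z(1)] Z'(2) by blast
    then show "m \<in> f ` Z'" using z \<open>z' \<in> Z'\<close> by auto
  qed
  then have "carrier M = f ` Z'" using presentsD(2)[OF P] Z'(2) by auto
  from presents_sub[OF P Z' this] show ?thesis by simp
qed

lemma presents_coset: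
  assumes P: "presents Z f M K" and N: "N' \<subseteq> Z" "N = f ` N'" and z: "z \<in> Z"
  shows "N +>\<^bsub>M\<^esub> f z = f ` ((\<lambda>n. n + z) ` N')"
proof -
  have "f (n + z) = f n \<oplus>\<^bsub>M\<^esub> f z" if "n \<in> N'" for n
    using presentsD(3)[OF P _ z] that N(1) by blast
  then show ?thesis unfolding N(2) a_r_coset_def r_coset_def by (auto simp: image_iff)
qed

text \<open>A quotient of a quotient of \<open>Z\<close> is again a quotient of \<open>Z\<close>
  with a larger kernel. Taking homology and dividing by degenerate elements are both of this
  kind.\<close>

lemma presents_quot:
  assumes P: "presents Z f M K" and N': "pm.subspace N'" "K \<subseteq> N'" "N' \<subseteq> Z" and N: "N = f ` N'"
  shows "presents Z (\<lambda>z. N +>\<^bsub>M\<^esub> f z) (quot_mod M N) N'"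
proof -
  note P' = presentsD[OF P]
  note C = presents_coset[OF P N'(3) N]
  \<comment> \<open>Membership in a coset, read off from representatives; the coset identities below
    are reduced to it.\<close>
  have mem: "f w \<in> N +>\<^bsub>M\<^esub> f z \<longleftrightarrow> w - z \<in> N'" if w: "w \<in> Z" and z: "z \<in> Z" for w z
  proof
    assume "f w \<in> N +>\<^bsub>M\<^esub> f z"
    then obtain n where n: "n \<in> N'" "f w = f (n + z)" unfolding C[OF z] by auto
    then have "n + z \<in> Z" using N'(3) n z pm.subspace_add[OF P'(1)] by blast
    then have "w - (n + z) \<in> N'" using presents_eq_iff[OF P w] n N'(2) by blast
    then have "(w - (n + z)) + n \<in> N'" using n pm.subspace_add[OF N'(1)] by blast
    then show "w - z \<in> N'" by (simp add: algebra_simps)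
  next
    assume "w - z \<in> N'"
    then have "f ((w - z) + z) \<in> f ` (\<lambda>n. n + z) ` N'" by (intro imageI)
    then show "f w \<in> N +>\<^bsub>M\<^esub> f z" unfolding C[OF z] by simp
  qed
  have sub: "N +>\<^bsub>M\<^esub> f z \<subseteq> f ` Z" if "z \<in> Z" for z
    unfolding C[OF that] using N'(3) that pm.subspace_add[OF P'(1)] by blast
  have eqI: "N +>\<^bsub>M\<^esub> f z = A" if "z \<in> Z" "A \<subseteq> f ` Z" "\<And>w. w \<in> Z \<Longrightarrow> f w \<in> A \<longleftrightarrow> w - z \<in> N'" for z A
  proof
    show "N +>\<^bsub>M\<^esub> f z \<subseteq> A" using sub[OF that(1)] mem[OF _ that(1)] that(3) by blast
    show "A \<subseteq> N +>\<^bsub>M\<^esub> f z" using mem[OF _ that(1)] that(2,3) by blast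
  qed
  have eq: "N +>\<^bsub>M\<^esub> f z = N +>\<^bsub>M\<^esub> f w" if "z \<in> Z" "w \<in> Z" "w - z \<in> N'" for z w
  proof (rule eqI[OF that(1) sub[OF that(2)]])
    fix v assume v: "v \<in> Z"
    have "v - z = (v - w) + (w - z)" "v - w = (v - z) - (w - z)" by simp_all
    then show "f v \<in> N +>\<^bsub>M\<^esub> f w \<longleftrightarrow> v - z \<in> N'"
      unfolding mem[OF v that(2)] using that(3) pm.subspace_add[OF N'(1)] pm.subspace_diff[OF N'(1)] by metis
  qed
  have 0: "0 \<in> Z" "0 \<in> N'" using P'(1) N'(1) by (auto simp: pm.subspace_0)
  have zero: "N +>\<^bsub>M\<^esub> f 0 = N" using C[OF 0(1)] by (simp add: N[symmetric])
  show ?thesis unfolding presents_def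
  proof (intro conjI ballI allI)
    show "pm.subspace Z" by (rule P'(1))
    show "(\<lambda>z. N +>\<^bsub>M\<^esub> f z) ` Z = carrier (quot_mod M N)"
      unfolding quot_mod_def by (auto simp: A_RCOSETS_def RCOSETS_def a_r_coset_def P'(2)[symmetric])
    show "N +>\<^bsub>M\<^esub> f 0 = \<zero>\<^bsub>quot_mod M N\<^esub>" by (simp add: zero quot_mod_def)
    show "N' = {z \<in> Z. N +>\<^bsub>M\<^esub> f z = \<zero>\<^bsub>quot_mod M N\<^esub>}"
    proof (intro equalityI subsetI)
      fix z assume z: "z \<in> N'"
      then have "z \<in> Z" "0 - z \<in> N'" using N'(3) pm.subspace_neg[OF N'(1)] by auto
      then show "z \<in> {z \<in> Z. N +>\<^bsub>M\<^esub> f z = \<zero>\<^bsub>quot_mod M N\<^esub>}"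
        using eq[OF _ 0(1)] by (simp add: zero quot_mod_def)
    next
      fix z assume z: "z \<in> {z \<in> Z. N +>\<^bsub>M\<^esub> f z = \<zero>\<^bsub>quot_mod M N\<^esub>}"
      then have z': "z \<in> Z" "N +>\<^bsub>M\<^esub> f z = N +>\<^bsub>M\<^esub> f 0" by (simp_all add: zero quot_mod_def)
      have "f z \<in> N +>\<^bsub>M\<^esub> f z" using mem[OF z'(1) z'(1)] 0 by simp
      then show "z \<in> N'" unfolding z'(2) mem[OF z'(1) 0(1)] by simp
    qed
    fix x assume x: "x \<in> Z"
    show "N +>\<^bsub>M\<^esub> f (pscale r x) = r \<odot>\<^bsub>quot_mod M N\<^esub> (N +>\<^bsub>M\<^esub> f x)" for r
    proof -
      have rx: "pscale r x \<in> Z" using x pm.subspace_scale[OF P'(1)] by blast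
      have "N +>\<^bsub>M\<^esub> (r \<odot>\<^bsub>M\<^esub> v) = N +>\<^bsub>M\<^esub> f (pscale r x)" if v: "v \<in> N +>\<^bsub>M\<^esub> f x" for v
      proof -
        obtain w where w: "w \<in> Z" "v = f w" using sub[OF x] v by blast
        then have "w - x \<in> N'" using mem[OF _ x] v by blast
        then have "pscale r w - pscale r x \<in> N'"
          using pm.subspace_scale[OF N'(1)] by (metis pm.scale_right_diff_distrib)
        then have "pscale r x - pscale r w \<in> N'" using pm.subspace_neg[OF N'(1)] by fastforce
        then show ?thesis
          unfolding w(2) P'(4)[OF w(1), symmetric] by (rule eq[OF pm.subspace_scale[OF P'(1) w(1)] rx])
      qed
      moreover have "f x \<in> N +>\<^bsub>M\<^esub> f x" using mem[OF x x] 0 by simp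
      ultimately show ?thesis unfolding quot_mod_def by auto
    qed
    fix y assume y: "y \<in> Z"
    show "N +>\<^bsub>M\<^esub> f (x + y) = (N +>\<^bsub>M\<^esub> f x) \<oplus>\<^bsub>quot_mod M N\<^esub> (N +>\<^bsub>M\<^esub> f y)"
    proof (rule eqI)
      show xy: "x + y \<in> Z" using x y pm.subspace_add[OF P'(1)] by blast
      have S: "(N +>\<^bsub>M\<^esub> f x) \<oplus>\<^bsub>quot_mod M N\<^esub> (N +>\<^bsub>M\<^esub> f y)
          = {a \<oplus>\<^bsub>M\<^esub> b | a b. a \<in> N +>\<^bsub>M\<^esub> f x \<and> b \<in> N +>\<^bsub>M\<^esub> f y}"
        by (auto simp: quot_mod_def set_add_def set_mult_def)
      show "(N +>\<^bsub>M\<^esub> f x) \<oplus>\<^bsub>quot_mod M N\<^esub> (N +>\<^bsub>M\<^esub> f y) \<subseteq> f ` Z"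
      proof
        fix c assume "c \<in> (N +>\<^bsub>M\<^esub> f x) \<oplus>\<^bsub>quot_mod M N\<^esub> (N +>\<^bsub>M\<^esub> f y)"
        then obtain a b where ab: "c = a \<oplus>\<^bsub>M\<^esub> b" "a \<in> f ` Z" "b \<in> f ` Z"
          unfolding S using sub[OF x] sub[OF y] by blast
        then obtain u v where "a = f u" "b = f v" "u \<in> Z" "v \<in> Z" by blast
        then have "c = f (u + v)" "u + v \<in> Z" using ab(1) P'(3) pm.subspace_add[OF P'(1)] by auto
        then show "c \<in> f ` Z" by blast
      qed
      fix w assume w: "w \<in> Z"
      show "f w \<in> (N +>\<^bsub>M\<^esub> f x) \<oplus>\<^bsub>quot_mod M N\<^esub> (N +>\<^bsub>M\<^esub> f y) \<longleftrightarrow> w - (x + y) \<in> N'"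
      proof
        assume "f w \<in> (N +>\<^bsub>M\<^esub> f x) \<oplus>\<^bsub>quot_mod M N\<^esub> (N +>\<^bsub>M\<^esub> f y)"
        then obtain a b where ab: "f w = a \<oplus>\<^bsub>M\<^esub> b" "a \<in> N +>\<^bsub>M\<^esub> f x" "b \<in> N +>\<^bsub>M\<^esub> f y"
          unfolding S by blast
        then obtain u v where uv: "a = f u" "b = f v" "u \<in> Z" "v \<in> Z" using sub[OF x] sub[OF y] by blast
        then have "u - x \<in> N'" "v - y \<in> N'" using ab mem[OF _ x] mem[OF _ y] by auto
        moreover have "f w = f (u + v)" unfolding ab(1) uv(1,2) P'(3)[OF uv(3,4)] ..
        then have "w - (u + v) \<in> N'"
          using presents_eq_iff[OF P w pm.subspace_add[OF P'(1) uv(3,4)]] N'(2) by blast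
        ultimately have "(w - (u + v)) + ((u - x) + (v - y)) \<in> N'" using pm.subspace_add[OF N'(1)] by blast
        then show "w - (x + y) \<in> N'" by (simp add: algebra_simps)
      next
        assume a: "w - (x + y) \<in> N'"
        have wy: "w - y \<in> Z" using w y pm.subspace_diff[OF P'(1)] by blast
        have "f (w - y) \<in> N +>\<^bsub>M\<^esub> f x" unfolding mem[OF wy x] using a by (simp add: algebra_simps)
        moreover have "f y \<in> N +>\<^bsub>M\<^esub> f y" unfolding mem[OF y y] using 0 by simp
        moreover have "f w = f (w - y) \<oplus>\<^bsub>M\<^esub> f y" using P'(3)[OF wy y] by simp
        ultimately show "f w \<in> (N +>\<^bsub>M\<^esub> f x) \<oplus>\<^bsub>quot_mod M N\<^esub> (N +>\<^bsub>M\<^esub> f y)" unfolding S by blast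
      qed
    qed
  qed
qed

lemma presents_quot_map:
  assumes P: "presents Z f M K" and N': "0 \<in> N'" "N' \<subseteq> Z" and N: "N = f ` N'"
    and P2: "presents Z2 f2 M2 K2" and N2': "pm.subspace N2'" "K2 \<subseteq> N2'" "N2' \<subseteq> Z2" and N2: "N2 = f2 ` N2'"
    and F: "\<And>z. z \<in> Z \<Longrightarrow> F (f z) = f2 (g z)"
    and g: "\<And>z. z \<in> Z \<Longrightarrow> g z \<in> Z2" "\<And>x y. x \<in> Z \<Longrightarrow> y \<in> Z \<Longrightarrow> g (x + y) = g x + g y"
      "\<And>z. z \<in> N' \<Longrightarrow> g z \<in> N2'"
    and z: "z \<in> Z"
  shows "quot_map M2 N2 F (N +>\<^bsub>M\<^esub> f z) = N2 +>\<^bsub>M2\<^esub> f2 (g z)"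
proof -
  note Q = presents_quot[OF P2 N2' N2]
  have "N2 +>\<^bsub>M2\<^esub> F (f (n + z)) = N2 +>\<^bsub>M2\<^esub> f2 (g z)" if n: "n \<in> N'" for n
  proof -
    have nz: "n \<in> Z" "n + z \<in> Z" using n N'(2) z pm.subspace_add[OF presentsD(1)[OF P]] by auto
    have "g (n + z) - g z \<in> N2'" using g(3)[OF n] g(2)[OF nz(1) z] by simp
    then show ?thesis unfolding F[OF nz(2)]
      using presents_eq_iff[OF Q g(1)[OF nz(2)] g(1)[OF z]] by simp
  qed
  then show ?thesis unfolding quot_map_def presents_coset[OF P N'(2) N z] using N'(1) by auto
qed

text \<open>The axioms are inherited from \<open>Z\<close>. They give access to
  \<open>finsum\<close> and \<open>span\<close> in the presented modules.\<close>

lemma presents_module: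
  assumes P: "presents Z f M K"
  shows "Module.module class_ring M"
proof -
  note P' = presentsD[OF P]
  have add: "x + y \<in> Z" if "x \<in> Z" "y \<in> Z" for x y using that pm.subspace_add[OF P'(1)] by blast
  have sc: "pscale r x \<in> Z" if "x \<in> Z" for r x using that pm.subspace_scale[OF P'(1)] by blast
  have 0: "0 \<in> Z" using P'(1) by (rule pm.subspace_0)
  have ag: "abelian_group M"
  proof (rule abelian_groupI)
    fix x assume "x \<in> carrier M"
    then obtain u where u: "u \<in> Z" "x = f u" using P'(2) by auto
    have "- u \<in> Z" using u pm.subspace_neg[OF P'(1)] by blast
    moreover have "f (- u) \<oplus>\<^bsub>M\<^esub> f u = \<zero>\<^bsub>M\<^esub>" unfolding P'(3)[OF \<open>- u \<in> Z\<close> u(1), symmetric] by (simp add: P'(5))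
    ultimately show "\<exists>y\<in>carrier M. y \<oplus>\<^bsub>M\<^esub> x = \<zero>\<^bsub>M\<^esub>" using u P'(2) by auto
    show "\<zero>\<^bsub>M\<^esub> \<oplus>\<^bsub>M\<^esub> x = x" using P'(3)[OF 0 u(1)] P'(5) u(2) by simp
  next
    fix x y assume "x \<in> carrier M" "y \<in> carrier M"
    then obtain u v where u: "u \<in> Z" "x = f u" "v \<in> Z" "y = f v"
      unfolding P'(2)[symmetric] by blast
    have xy: "x \<oplus>\<^bsub>M\<^esub> y = f (u + v)" unfolding u P'(3)[OF u(1,3)] ..
    show "x \<oplus>\<^bsub>M\<^esub> y \<in> carrier M" unfolding xy P'(2)[symmetric] by (rule imageI[OF add[OF u(1,3)]])
    show "x \<oplus>\<^bsub>M\<^esub> y = y \<oplus>\<^bsub>M\<^esub> x"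
      unfolding u P'(3)[OF u(1,3), symmetric] P'(3)[OF u(3,1), symmetric] by (simp only: add.commute)
    fix z assume "z \<in> carrier M"
    then obtain w where w: "w \<in> Z" "z = f w" using P'(2) by auto
    show "x \<oplus>\<^bsub>M\<^esub> y \<oplus>\<^bsub>M\<^esub> z = x \<oplus>\<^bsub>M\<^esub> (y \<oplus>\<^bsub>M\<^esub> z)"
      unfolding u w P'(3)[OF u(1,3), symmetric] P'(3)[OF u(3) w(1), symmetric]
        P'(3)[OF add[OF u(1,3)] w(1), symmetric] P'(3)[OF u(1) add[OF u(3) w(1)], symmetric]
      by (simp only: add.assoc)
  next
    show "\<zero>\<^bsub>M\<^esub> \<in> carrier M" unfolding P'(2)[symmetric] P'(5)[symmetric] by (rule imageI[OF 0])
  qed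
  show ?thesis
  proof (rule moduleI)
    interpret field "class_ring :: 'b ring" by (rule class_field)
    show "cring (class_ring :: 'b ring)" ..
    show "abelian_group M" by (rule ag)
  next
    fix a x assume "x \<in> carrier M"
    then obtain u where u: "u \<in> Z" "x = f u" using P'(2) by auto
    show "a \<odot>\<^bsub>M\<^esub> x \<in> carrier M" 
      unfolding u(2) P'(4)[OF u(1), symmetric] P'(2)[symmetric] by (rule imageI[OF sc[OF u(1)]])
    show "\<one>\<^bsub>class_ring\<^esub> \<odot>\<^bsub>M\<^esub> x = x"
      unfolding u(2) P'(4)[OF u(1), symmetric] by (simp add: class_ring_simps)
    fix b
    show "(a \<oplus>\<^bsub>class_ring\<^esub> b) \<odot>\<^bsub>M\<^esub> x = a \<odot>\<^bsub>M\<^esub> x \<oplus>\<^bsub>M\<^esub> b \<odot>\<^bsub>M\<^esub> x"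
      unfolding u(2) P'(4)[OF u(1), symmetric] P'(3)[OF sc[OF u(1)] sc[OF u(1)], symmetric]
      by (simp add: class_ring_simps pm.scale_left_distrib)
    show "(a \<otimes>\<^bsub>class_ring\<^esub> b) \<odot>\<^bsub>M\<^esub> x = a \<odot>\<^bsub>M\<^esub> (b \<odot>\<^bsub>M\<^esub> x)"
      unfolding u(2) P'(4)[OF u(1), symmetric] P'(4)[OF sc[OF u(1)], symmetric]
      by (simp add: class_ring_simps)
    fix y assume "y \<in> carrier M"
    then obtain v where v: "v \<in> Z" "y = f v" using P'(2) by auto
    show "a \<odot>\<^bsub>M\<^esub> (x \<oplus>\<^bsub>M\<^esub> y) = a \<odot>\<^bsub>M\<^esub> x \<oplus>\<^bsub>M\<^esub> a \<odot>\<^bsub>M\<^esub> y"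
      unfolding u(2) v(2) P'(3)[OF u(1) v(1), symmetric] P'(4)[OF u(1), symmetric] P'(4)[OF v(1), symmetric]
        P'(3)[OF sc[OF u(1)] sc[OF v(1)], symmetric] P'(4)[OF add[OF u(1) v(1)], symmetric]
      by (simp only: pm.scale_right_distrib)
  qed
qed

lemma presents_alt_sum:
  assumes P: "presents Z f M K" and g: "\<And>i. i \<le> n \<Longrightarrow> g i \<in> Z" and d: "\<And>i. i \<le> n \<Longrightarrow> d i v = f (g i)"
  shows "alt_sum M d n v = f (\<Sum>i\<le>n. pscale ((-1) ^ i) (g i))"
proof -
  interpret M: Module.module class_ring M using P by (rule presents_module)
  note P' = presentsD[OF P]
  have t: "pscale ((-1) ^ i) (g i) \<in> Z" if "i \<le> n" for i
    using g[OF that] pm.subspace_scale[OF P'(1)] by blast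
  have e: "(-1) ^ i \<odot>\<^bsub>M\<^esub> d i v = f (pscale ((-1) ^ i) (g i))" if "i \<le> n" for i
    using d[OF that] P'(4)[OF g[OF that]] by simp
  have "finsum M (\<lambda>i. (-1) ^ i \<odot>\<^bsub>M\<^esub> d i v) I = f (\<Sum>i\<in>I. pscale ((-1) ^ i) (g i)) \<and> (\<Sum>i\<in>I. pscale ((-1) ^ i) (g i)) \<in> Z"
    if "finite I" "I \<subseteq> {..n}" for I
    using that
  proof (induction I)
    case empty
    show ?case by (simp add: P'(5) pm.subspace_0[OF P'(1)])
  next
    case (insert i I)
    then have i: "i \<le> n" and I: "I \<subseteq> {..n}" by auto
    have in_car: "(-1) ^ j \<odot>\<^bsub>M\<^esub> d j v \<in> carrier M" if "j \<le> n" for j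
      unfolding e[OF that] P'(2)[symmetric] using t[OF that] by blast
    have "finsum M (\<lambda>i. (-1) ^ i \<odot>\<^bsub>M\<^esub> d i v) (insert i I)
        = (-1) ^ i \<odot>\<^bsub>M\<^esub> d i v \<oplus>\<^bsub>M\<^esub> finsum M (\<lambda>i. (-1) ^ i \<odot>\<^bsub>M\<^esub> d i v) I"
      by (rule M.finsum_insert) (use insert I in_car in auto)
    also have "\<dots> = f (pscale ((-1) ^ i) (g i) + (\<Sum>i\<in>I. pscale ((-1) ^ i) (g i)))"
      unfolding e[OF i] using insert.IH[OF I] P'(3)[OF t[OF i]] by simp
    finally show ?case using insert.IH[OF I] insert.hyps t[OF i] pm.subspace_add[OF P'(1)] by simp
  qed
  from this[of "{..n}"] show ?thesis unfolding alt_sum_def by simp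
qed


lemma a_r_coset_carrier [simp]: "N +>\<^bsub>M\<lparr>carrier := C\<rparr>\<^esub> x = N +>\<^bsub>M\<^esub> x"
  by (simp add: a_r_coset_def r_coset_def)

lemma presents_cycles:
  assumes P: "\<And>n. presents (Z n) (f n) (ch C n) (K n)"
    and d: "\<And>n z. z \<in> Z (Suc n) \<Longrightarrow> d n z \<in> Z n \<and> bd C n (f (Suc n) z) = f n (d n z)"
    and lin: "\<And>n. Vector_Spaces.linear pscale pscale (d n)"
    and c: "\<And>n. cyc n = (case n of 0 \<Rightarrow> Z 0 | Suc m \<Rightarrow> {z \<in> Z (Suc m). d m z \<in> K m})"
  shows "cycles C n = f n ` cyc n" "pm.subspace (cyc n)" "cyc n \<subseteq> Z n"
proof -
  note P' = presentsD[OF P]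
  show "cyc n \<subseteq> Z n" unfolding c by (cases n) auto
  show "cycles C n = f n ` cyc n"
  proof (cases n)
    case 0
    then show ?thesis unfolding c using P'(2)[of 0] by simp
  next
    case (Suc m)
    have "d m z \<in> K m \<longleftrightarrow> bd C m (f (Suc m) z) = \<zero>\<^bsub>ch C m\<^esub>" if "z \<in> Z (Suc m)" for z
      using d[OF that] P'(6)[of "d m z" m] by simp
    then show ?thesis unfolding c Suc unfolding cycles.simps P'(2)[of "Suc m", symmetric] by auto
  qed
  show "pm.subspace (cyc n)"
  proof (cases n)
    case 0
    then show ?thesis unfolding c using P'(1)[of 0] by simp
  next
    case (Suc m)
    interpret d: Vector_Spaces.linear pscale pscale "d m" by (rule lin)
    note Ks = presents_kernel_subspace(1)[OF P[of m]]
    show ?thesis unfolding c Suc nat.case pm.subspace_def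
      using pm.subspace_0[OF P'(1)] pm.subspace_add[OF P'(1)] pm.subspace_scale[OF P'(1)]
        pm.subspace_0[OF Ks] pm.subspace_add[OF Ks] pm.subspace_scale[OF Ks]
      by (simp add: d.add d.scale)
  qed
qed

text \<open>In a complex of presented modules a chain is a cycle when its differential lies in the
  kernel one degree below, and the boundaries are enlarged by \<open>K n\<close>. Accordingly
  \<open>d\<close> squares to zero modulo the kernels.\<close>

lemma presents_homology:
  assumes P: "\<And>n. presents (Z n) (f n) (ch C n) (K n)"
    and d: "\<And>n z. z \<in> Z (Suc n) \<Longrightarrow> d n z \<in> Z n \<and> bd C n (f (Suc n) z) = f n (d n z)"
    and lin: "\<And>n. Vector_Spaces.linear pscale pscale (d n)"
    and dd: "\<And>n z. z \<in> Z (Suc (Suc n)) \<Longrightarrow> d n (d (Suc n) z) \<in> K n"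
    and c: "\<And>n. cyc n = (case n of 0 \<Rightarrow> Z 0 | Suc m \<Rightarrow> {z \<in> Z (Suc m). d m z \<in> K m})"
  shows "presents (cyc n) (\<lambda>z. boundaries C n +>\<^bsub>ch C n\<^esub> f n z) (homology C n)
    {d n y + k | y k. y \<in> Z (Suc n) \<and> k \<in> K n}"
proof -
  note P' = presentsD[OF P]
  note cyc = presents_cycles[OF P d lin c, where n = n]
  note S = presents_sub[OF P cyc(2,3,1)]
  let ?B = "{d n y + k | y k. y \<in> Z (Suc n) \<and> k \<in> K n}"
  interpret d: Vector_Spaces.linear pscale pscale "d n" by (rule lin)
  note Ks = presents_kernel_subspace[OF P]
  have KK: "k \<in> K n \<Longrightarrow> f n k = \<zero>\<^bsub>ch C n\<^esub>" for k using P'(6) by blast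
  have B: "boundaries C n = f n ` ?B"
  proof -
    have e: "f n (d n y + k) = bd C n (f (Suc n) y)" if "y \<in> Z (Suc n)" "k \<in> K n" for y k
    proof -
      have "d n y \<in> Z n" "k \<in> Z n" using d that Ks(2) by auto
      then show ?thesis using presents_eq_iff[OF P, of "d n y + k" n "d n y"] d[OF that(1)] that(2)
        pm.subspace_add[OF P'(1)] by simp
    qed
    have "boundaries C n = (\<lambda>y. bd C n (f (Suc n) y)) ` Z (Suc n)"
      unfolding boundaries_def P'(2)[symmetric] image_image ..
    also have "\<dots> = f n ` ?B"
    proof (intro equalityI subsetI)
      fix v assume "v \<in> (\<lambda>y. bd C n (f (Suc n) y)) ` Z (Suc n)"
      then obtain y where y: "y \<in> Z (Suc n)" "v = f n (d n y + 0)"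
        using e[OF _ pm.subspace_0[OF Ks(1)]] by auto
      then show "v \<in> f n ` ?B" using pm.subspace_0[OF Ks(1)] by blast
    next
      fix v assume "v \<in> f n ` ?B"
      then obtain y k where "v = f n (d n y + k)" "y \<in> Z (Suc n)" "k \<in> K n" by blast
      then show "v \<in> (\<lambda>y. bd C n (f (Suc n) y)) ` Z (Suc n)" using e by auto
    qed
    finally show ?thesis .
  qed
  have subB: "pm.subspace ?B"
  proof -
    have "?B = {x + y |x y. x \<in> d n ` Z (Suc n) \<and> y \<in> K n}" by blast
    then show ?thesis
      using pm.subspace_sums[OF d.subspace_image[OF P'(1)] Ks(1)] by simp
  qed
  have KB: "cyc n \<inter> K n \<subseteq> ?B"
    using d.zero pm.subspace_0[OF P'(1)] by force
  have Bc: "?B \<subseteq> cyc n"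
  proof
    fix v assume "v \<in> ?B"
    then obtain y k where v: "v = d n y + k" "y \<in> Z (Suc n)" "k \<in> K n" by blast
    then have "d n y \<in> Z n" "k \<in> Z n" using d Ks(2) by auto
    then have vZ: "d n y \<in> Z n" "k \<in> Z n" "v \<in> Z n" using pm.subspace_add[OF P'(1)[of n]] v(1) by simp_all
    show "v \<in> cyc n"
    proof (cases n)
      case (Suc m)
      interpret dm: Vector_Spaces.linear pscale pscale "d m" by (rule lin)
      \<comment> \<open>The elements \<open>k\<close> and 0 have the same class, hence so have their
        differentials: \<open>d\<close> maps kernels to kernels.\<close>
      have "f m (d m k) = f m (d m 0)"
        using d[of k m] d[of 0 m] vZ(2) KK[OF v(3)] P'(5)[of n] pm.subspace_0[OF P'(1)] unfolding Suc by simp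
      then have "d m k \<in> K m" using presents_eq_iff[OF P, of "d m k" m 0] d[of k m] vZ(2) pm.subspace_0[OF P'(1)[of m]]
        unfolding Suc by (simp add: dm.zero)
      moreover have "d m (d n y) \<in> K m" using dd[of y m] v(2) unfolding Suc by simp
      ultimately have "d m v \<in> K m" unfolding v(1) dm.add using pm.subspace_add[OF Ks(1)] by blast
      then show ?thesis using vZ(3) unfolding c Suc by simp
    qed (use vZ(3) c in simp)
  qed
  show ?thesis
    using presents_quot[OF S subB KB Bc B] unfolding homology_def by simp
qed


subsection \<open>Homology of simplicial sets\<close>

lemma presents_free_mod: "presents (chain_set S :: ('x \<Rightarrow>\<^sub>0 'k::field) set) Poly_Mapping.lookup (free_mod S) {0}"
proof -
  have "Poly_Mapping.lookup ` chain_set S = carrier (free_mod S :: ('k, 'x \<Rightarrow> 'k) module)"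
  proof (intro equalityI subsetI)
    fix c assume "c \<in> carrier (free_mod S :: ('k, 'x \<Rightarrow> 'k) module)"
    then have c: "finite {x. c x \<noteq> 0}" "{x. c x \<noteq> 0} \<subseteq> S" by (simp_all add: free_mod_def)
    then have l: "Poly_Mapping.lookup (Abs_poly_mapping c) = c" by (intro Abs_poly_mapping_inverse) simp
    then have "Poly_Mapping.keys (Abs_poly_mapping c) \<subseteq> S"
      using c(2) by (auto simp: in_keys_iff)
    then show "c \<in> Poly_Mapping.lookup ` chain_set S" using l by (intro image_eqI[of _ _ "Abs_poly_mapping c"]) simp_all
  qed (auto simp: free_mod_def in_keys_iff subset_iff finite_lookup)
  moreover have "z = 0" if "\<forall>x. Poly_Mapping.lookup z x = 0" for z :: "'x \<Rightarrow>\<^sub>0 'k"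
    using that by (intro poly_mapping_eqI) simp
  ultimately show ?thesis
    unfolding presents_def using subspace_chain_set[of S]
    by (auto simp: free_mod_def plus_poly_mapping.rep_eq fun_eq_iff lookup_add)
qed

lemma pushforward_lookup:
  "pushforward f (Poly_Mapping.lookup z) = Poly_Mapping.lookup (lift (\<lambda>x. sing (f x)) z)"
proof
  fix y
  have "pushforward f (Poly_Mapping.lookup z) y
      = (\<Sum>x\<in>Poly_Mapping.keys z. if f x = y then Poly_Mapping.lookup z x else 0)"
  proof -
    have "{x. Poly_Mapping.lookup z x \<noteq> 0 \<and> f x = y} = {x \<in> Poly_Mapping.keys z. f x = y}"
      by (auto simp: in_keys_iff)
    then show ?thesis unfolding pushforward_def by (simp add: sum.inter_filter)
  qed
  also have "\<dots> = Poly_Mapping.lookup (lift (\<lambda>x. sing (f x)) z) y"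
    unfolding lift_def lookup_sum by (intro sum.cong) (auto simp: lookup_single when_def)
  finally show "pushforward f (Poly_Mapping.lookup z) y = Poly_Mapping.lookup (lift (\<lambda>x. sing (f x)) z) y" .
qed

definition cyc :: "'y sset \<Rightarrow> nat \<Rightarrow> ('y \<Rightarrow>\<^sub>0 'k::field) set" where
  "cyc Y q = {z. Poly_Mapping.keys z \<subseteq> simplices Y q \<and> lift (bds Y q) z = 0}"

definition bnd :: "'y sset \<Rightarrow> nat \<Rightarrow> ('y \<Rightarrow>\<^sub>0 'k::field) set" where
  "bnd Y q = lift (bds Y (Suc q)) ` chain_set (simplices Y (Suc q))"

definition cls :: "'y sset \<Rightarrow> nat \<Rightarrow> ('y \<Rightarrow>\<^sub>0 'k::field) \<Rightarrow> ('y \<Rightarrow> 'k) set" where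
  "cls Y q z = boundaries (chains Y) q +>\<^bsub>ch (chains Y) q\<^esub> Poly_Mapping.lookup z"

lemma keys_lift_bds:
  assumes "simplicial_set Y" "Poly_Mapping.keys z \<subseteq> simplices Y (Suc n)"
  shows "Poly_Mapping.keys (lift (bds Y (Suc n)) z :: _ \<Rightarrow>\<^sub>0 'k::field) \<subseteq> simplices Y n"
  by (rule keys_lift_subset, rule keys_bds[OF assms(1)]) (use assms(2) in auto)

lemma bd_chains:
  assumes Y: "simplicial_set Y" and z: "Poly_Mapping.keys z \<subseteq> simplices Y (Suc n)"
  shows "bd (chains Y) n (Poly_Mapping.lookup z) = Poly_Mapping.lookup (lift (bds Y (Suc n)) z :: _ \<Rightarrow>\<^sub>0 'k::field)"
proof -
  have "bd (chains Y) n (Poly_Mapping.lookup z)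
    = Poly_Mapping.lookup (\<Sum>i\<le>Suc n. pscale ((-1) ^ i) (lift (\<lambda>x. sing (act Y (Suc n) x (coface n i))) z))"
    unfolding chains_def ch_complex.simps
  proof (rule presents_alt_sum[OF presents_free_mod])
    fix i assume i: "i \<le> Suc n"
    have "act Y (Suc n) x (coface n i) \<in> simplices Y n" if "x \<in> Poly_Mapping.keys z" for x
      using simplicial_setD(1)[OF Y _ coface_ops[OF i]] z that by blast
    then show "lift (\<lambda>x. sing (act Y (Suc n) x (coface n i))) z \<in> chain_set (simplices Y n)"
      using keys_lift_subset[of z "\<lambda>x. sing (act Y (Suc n) x (coface n i))" "simplices Y n"] by simp
    show "pushforward (\<lambda>x. act Y (Suc n) x (coface n i)) (Poly_Mapping.lookup z)
      = Poly_Mapping.lookup (lift (\<lambda>x. sing (act Y (Suc n) x (coface n i))) z)"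
      by (rule pushforward_lookup)
  qed
  also have "(\<Sum>i\<le>Suc n. pscale ((-1) ^ i) (lift (\<lambda>x. sing (act Y (Suc n) x (coface n i))) z)) = lift (bds Y (Suc n)) z"
    unfolding bds_def nat.case lift_fun_sum lift_fun_scale ..
  finally show ?thesis .
qed

lemma presents_sset_homology:
  assumes Y: "simplicial_set Y"
  shows "presents (cyc Y q) (cls Y q) (sset_homology Y q :: ('k::field, _) module) (bnd Y q)"
    and "boundaries (chains Y) q = Poly_Mapping.lookup ` (bnd Y q :: (_ \<Rightarrow>\<^sub>0 'k) set)"
proof -
  let ?Z = "\<lambda>n. chain_set (simplices Y n) :: (_ \<Rightarrow>\<^sub>0 'k) set"
  have P: "presents (?Z n) Poly_Mapping.lookup (ch (chains Y) n) {0}" for n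
    unfolding chains_def by (simp add: presents_free_mod)
  have d: "lift (bds Y (Suc n)) z \<in> ?Z n \<and>
      bd (chains Y) n (Poly_Mapping.lookup z) = Poly_Mapping.lookup (lift (bds Y (Suc n)) z)"
    if "z \<in> ?Z (Suc n)" for n z
    using that keys_lift_bds[OF Y, of z n] bd_chains[OF Y, of z n] by simp
  have dd: "lift (bds Y (Suc n)) (lift (bds Y (Suc (Suc n))) z) \<in> {0}" if "z \<in> ?Z (Suc (Suc n))" for n z
    using lift_bds_bds[OF Y, of z "Suc (Suc n)"] that by simp
  have c: "cyc Y n = (case n of 0 \<Rightarrow> ?Z 0 | Suc m \<Rightarrow> {z \<in> ?Z (Suc m). lift (bds Y (Suc m)) z \<in> {0}})" for n
    by (cases n) (auto simp: cyc_def)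
  have b: "bnd Y q = {lift (bds Y (Suc q)) y + k | y k. y \<in> ?Z (Suc q) \<and> k \<in> {0}}"
    by (auto simp: bnd_def)
  show "presents (cyc Y q) (cls Y q) (sset_homology Y q :: ('k::field, _) module) (bnd Y q)"
    using presents_homology[where f = "\<lambda>n. Poly_Mapping.lookup" and d = "\<lambda>n. lift (bds Y (Suc n))"
        and cyc = "cyc Y" and n = q, OF P d lift_linear dd c]
    unfolding b cls_def[abs_def] by simp
  show "boundaries (chains Y) q = Poly_Mapping.lookup ` (bnd Y q :: (_ \<Rightarrow>\<^sub>0 'k) set)"
    unfolding boundaries_def bnd_def presentsD(2)[OF P, symmetric] image_image
    by (rule image_cong) (use d in auto)
qed

lemma cyc_chain: "z \<in> cyc Y q \<Longrightarrow> Poly_Mapping.keys z \<subseteq> simplices Y q"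
  by (simp add: cyc_def)

lemma homology_map_cls:
  assumes X: "simplicial_set X" and Y: "simplicial_set Y"
    and k: "\<And>x. x \<in> simplices X q \<Longrightarrow> f q x \<in> simplices Y q"
    and b: "\<And>z. z \<in> (bnd X q :: (_ \<Rightarrow>\<^sub>0 'k) set) \<Longrightarrow> lift (\<lambda>x. sing (f q x)) z \<in> bnd Y q"
    and z: "z \<in> (cyc X q :: (_ \<Rightarrow>\<^sub>0 'k::field) set)"
  shows "homology_map Y f q (cls X q z) = cls Y q (lift (\<lambda>x. sing (f q x)) z)"
proof -
  let ?g = "lift (\<lambda>x. sing (f q x)) :: (_ \<Rightarrow>\<^sub>0 'k) \<Rightarrow> _"
  note PX = presents_sset_homology[OF X] and PY = presents_sset_homology[OF Y]
  note sX = presents_kernel_subspace[OF PX(1)] and sY = presents_kernel_subspace[OF PY(1)]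
  have P: "presents (chain_set (simplices W n)) Poly_Mapping.lookup (ch (chains W) n :: ('k, _) module) {0}" for W :: "'w sset" and n
    unfolding chains_def by (simp add: presents_free_mod)
  have bc: "bnd W q \<subseteq> chain_set (simplices W q)" if "simplicial_set W" for W :: "'w sset"
    using presents_kernel_subspace(2)[OF presents_sset_homology(1)[OF that]] cyc_chain by fast
  show ?thesis unfolding homology_map_def cls_def
  proof (rule presents_quot_map[where f = Poly_Mapping.lookup, OF P _ bc[OF X] PX(2) P sY(1) _ bc[OF Y] PY(2)])
    show "0 \<in> bnd X q" "{0} \<subseteq> bnd Y q" using pm.subspace_0[OF sX(1)] pm.subspace_0[OF sY(1)] by auto
    show "pushforward (f q) (Poly_Mapping.lookup w) = Poly_Mapping.lookup (?g w)" for w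
      by (rule pushforward_lookup)
    show "?g w \<in> chain_set (simplices Y q)" if "w \<in> chain_set (simplices X q)" for w
      using keys_lift_subset[of w "\<lambda>x. sing (f q x)" "simplices Y q"] that k by auto
    show "?g (x + y) = ?g x + ?g y" for x y by (rule lift_add)
    show "?g w \<in> bnd Y q" if "w \<in> bnd X q" for w using b[OF that] .
    show "z \<in> chain_set (simplices X q)" using cyc_chain[OF z] by simp
  qed
qed


section \<open>The Reeb complexes in terms of chains\<close>

text \<open>\<open>D\<close> is the preimage of the span. The last clause, its minimality, acts as
  an induction principle: inclusions of \<open>D\<close> are checked on \<open>K\<close> and on the
  generators \<open>A\<close>.\<close>

lemma presents_span:
  assumes P: "presents Z f M K" and A: "A \<subseteq> Z"
    and D: "D = {z \<in> Z. f z \<in> LinearCombinations.module.span class_ring M (f ` A)}"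
  shows "pm.subspace D" "K \<subseteq> D" "D \<subseteq> Z" "A \<subseteq> D"
    "LinearCombinations.module.span class_ring M (f ` A) = f ` D"
    "\<And>W. pm.subspace W \<Longrightarrow> K \<subseteq> W \<Longrightarrow> W \<subseteq> Z \<Longrightarrow> A \<subseteq> W \<Longrightarrow> D \<subseteq> W"
proof -
  interpret M: Module.module class_ring M by (rule presents_module[OF P])
  note P' = presentsD[OF P]
  have AM: "f ` A \<subseteq> carrier M" using A P'(2) by auto
  have sub: "LinearCombinations.submodule class_ring (M.span (f ` A)) M" by (rule M.span_is_submodule[OF AM])
  have add: "v \<oplus>\<^bsub>M\<^esub> w \<in> M.span (f ` A)" if "v \<in> M.span (f ` A)" "w \<in> M.span (f ` A)" for v w
    using sub that unfolding LinearCombinations.submodule_def by blast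
  have sc: "c \<odot>\<^bsub>M\<^esub> v \<in> M.span (f ` A)" if "v \<in> M.span (f ` A)" for c v
    using sub that unfolding LinearCombinations.submodule_def by simp
  have zero: "\<zero>\<^bsub>M\<^esub> \<in> M.span (f ` A)" using sub unfolding LinearCombinations.submodule_def by blast
  have 0: "0 \<in> Z" by (rule pm.subspace_0[OF P'(1)])
  show "pm.subspace D" unfolding pm.subspace_def D
    using 0 P'(5) zero add sc pm.subspace_add[OF P'(1)] pm.subspace_scale[OF P'(1)] by (simp add: P'(3,4))
  show "K \<subseteq> D" unfolding D using P'(6) zero by auto
  show "D \<subseteq> Z" unfolding D by blast
  show "A \<subseteq> D" unfolding D using A M.in_own_span[OF AM] by blast
  have "M.span (f ` A) \<subseteq> f ` Z" unfolding P'(2) by (rule M.span_is_subset2[OF AM])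
  then show "M.span (f ` A) = f ` D" unfolding D by blast
  fix W assume W: "pm.subspace W" "K \<subseteq> W" "W \<subseteq> Z" "A \<subseteq> W"
  have "LinearCombinations.submodule class_ring (f ` W) M"
  proof (rule LinearCombinations.submodule.intro)
    show "Module.module class_ring M" by (rule presents_module[OF P])
    show "f ` W \<subseteq> carrier M" using W(3) P'(2) by auto
    show "\<zero>\<^bsub>M\<^esub> \<in> f ` W" unfolding P'(5)[symmetric] by (rule imageI[OF pm.subspace_0[OF W(1)]])
    fix v assume "v \<in> f ` W"
    then obtain x where x: "x \<in> W" "v = f x" by blast
    then have xZ: "x \<in> Z" using W(3) by blast
    show "c \<odot>\<^bsub>M\<^esub> v \<in> f ` W" for c
      unfolding x(2) P'(4)[OF xZ, symmetric] by (rule imageI[OF pm.subspace_scale[OF W(1) x(1)]])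
    fix w assume "w \<in> f ` W"
    then obtain y where y: "y \<in> W" "w = f y" by blast
    then have yZ: "y \<in> Z" using W(3) by blast
    show "v \<oplus>\<^bsub>M\<^esub> w \<in> f ` W"
      unfolding x(2) y(2) P'(3)[OF xZ yZ, symmetric] by (rule imageI[OF pm.subspace_add[OF W(1) x(1) y(1)]])
  qed
  then have sW: "M.span (f ` A) \<subseteq> f ` W" using W(4) by (intro M.span_is_subset) auto
  show "D \<subseteq> W"
  proof
    fix z assume "z \<in> D"
    then have z: "z \<in> Z" "f z \<in> f ` W" using sW unfolding D by auto
    then obtain w where w: "w \<in> W" "f z = f w" by blast
    then have "z - w \<in> K" using presents_eq_iff[OF P z(1)] W(3) by blast
    then have "(z - w) + w \<in> W" using W(1,2) w(1) pm.subspace_add by blast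
    then show "z \<in> W" by simp
  qed
qed

section \<open>Functoriality of the horizontal operators on chains and homology classes\<close>

lemma hor_op_hor_op:
  assumes s: "s \<in> simplices (sections X h p) q" and \<alpha>: "\<alpha> \<in> ops p' p" and \<beta>: "\<beta> \<in> ops p'' p'"
  shows "hor_op \<beta> q (hor_op \<alpha> q s) = hor_op (op_comp \<alpha> \<beta>) q s"
proof (rule sections_eqI)
  note c = op_comp_ops[OF \<alpha> \<beta>]
  note a = hor_op_simplices[OF s \<alpha>]
  show "hor_op \<beta> q (hor_op \<alpha> q s) \<in> simplices (sections X h p'') q" by (rule hor_op_simplices[OF a \<beta>])
  show "hor_op (op_comp \<alpha> \<beta>) q s \<in> simplices (sections X h p'') q" by (rule hor_op_simplices[OF s c])
  obtain a \<rho> where sa: "s = (a, \<rho>)" "length a = Suc p" using s by (rule sections_cases)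
  show "fst (hor_op \<beta> q (hor_op \<alpha> q s)) = fst (hor_op (op_comp \<alpha> \<beta>) q s)"
    unfolding fst_hor_op sa fst_conv by (rule op_comp_comp[OF \<alpha> \<beta>])
  fix l assume l: "l \<in> grid p'' q"
  have l': "map (\<lambda>(e, v). (\<beta> ! e, v)) l \<in> grid p' q"
  proof -
    have "map (\<lambda>(e, v). (\<beta> ! e, op_id q ! v)) l = map (\<lambda>(e, v). (\<beta> ! e, v)) l"
      using l by (auto simp: grid_def op_id_def simp del: upt_Suc)
    then show ?thesis using grid_map[OF l \<beta> op_id_ops[of q]] by (simp only:)
  qed
  have "op_comp \<alpha> \<beta> ! fst y = \<alpha> ! (\<beta> ! fst y)" if "y \<in> set l" for y
    using that l \<beta> by (auto simp: op_comp_def grid_def ops_def)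
  then have M: "map (\<lambda>(e, v). (\<alpha> ! e, v)) (map (\<lambda>(e, v). (\<beta> ! e, v)) l) = map (\<lambda>(e, v). (op_comp \<alpha> \<beta> ! e, v)) l"
    by auto
  show "sev (snd (hor_op \<beta> q (hor_op \<alpha> q s))) l = sev (snd (hor_op (op_comp \<alpha> \<beta>) q s)) l"
    unfolding sev_hor_op[OF a \<beta> l] sev_hor_op[OF s \<alpha> l'] sev_hor_op[OF s c l] M ..
qed

lemma horc_horc:
  assumes "Poly_Mapping.keys z \<subseteq> simplices (sections X h p) q" "\<alpha> \<in> ops p' p" "\<beta> \<in> ops p'' p'"
  shows "horc \<beta> q (horc \<alpha> q z) = horc (op_comp \<alpha> \<beta>) q z"
  unfolding lift_lift lift_sing
  by (rule lift_cong) (simp add: hor_op_hor_op[OF subsetD[OF assms(1)] assms(2,3)])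

lemma hor_op_id:
  assumes s: "s \<in> simplices (sections X h p) q"
  shows "hor_op (op_id p) q s = s"
proof (rule sections_eqI)
  show "hor_op (op_id p) q s \<in> simplices (sections X h p) q" by (rule hor_op_simplices[OF s op_id_ops])
  obtain a \<rho> where sa: "s = (a, \<rho>)" "length a = Suc p" using s by (rule sections_cases)
  show "fst (hor_op (op_id p) q s) = fst s" unfolding fst_hor_op using op_comp_op_id[OF sa(2)] sa(1) by simp
  fix l assume l: "l \<in> grid p q"
  have "map (\<lambda>(e, v). (op_id p ! e, v)) l = l"
    using l by (auto simp: grid_def op_id_def simp del: upt_Suc intro!: map_idI)
  then show "sev (snd (hor_op (op_id p) q s)) l = sev (snd s) l" unfolding sev_hor_op[OF s op_id_ops l] by simp
qed (rule s)

lemma horc_id: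
  assumes "Poly_Mapping.keys z \<subseteq> simplices (sections X h p) q"
  shows "horc (op_id p) q z = z"
proof -
  have "horc (op_id p) q z = lift sing z" by (rule lift_cong) (simp add: hor_op_id[OF subsetD[OF assms]])
  then show ?thesis by simp
qed

lemma horc_cyc:
  assumes "z \<in> cyc (sections X h p) q" "\<alpha> \<in> ops p' p"
  shows "horc \<alpha> q z \<in> cyc (sections X h p') q"
  using assms keys_horc[of z X h p q \<alpha> p'] bds_horc[of z X h p q \<alpha> p'] by (simp add: cyc_def)

lemma horc_bnd:
  assumes "z \<in> bnd (sections X h p) q" "\<alpha> \<in> ops p' p"
  shows "horc \<alpha> q z \<in> bnd (sections X h p') q"
proof -
  obtain y where y: "z = lift (bds (sections X h p) (Suc q)) y" "Poly_Mapping.keys y \<subseteq> simplices (sections X h p) (Suc q)"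
    using assms(1) by (auto simp: bnd_def)
  have "horc \<alpha> q z = lift (bds (sections X h p') (Suc q)) (horc \<alpha> (Suc q) y)"
    unfolding bds_horc[OF y(2) assms(2)] y(1) by simp
  then show ?thesis unfolding bnd_def using keys_horc[OF y(2) assms(2)] by blast
qed

lemma homology_map_hor_op:
  assumes "z \<in> cyc (sections X h p) q" "\<alpha> \<in> ops p' p"
  shows "homology_map (sections X h p') (hor_op \<alpha>) q (cls (sections X h p) q z) = cls (sections X h p') q (horc \<alpha> q z)"
proof (rule homology_map_cls[OF simplicial_set_sections simplicial_set_sections])
  show "hor_op \<alpha> q s \<in> simplices (sections X h p') q" if "s \<in> simplices (sections X h p) q" for s
    by (rule hor_op_simplices[OF that assms(2)])
  show "horc \<alpha> q z \<in> bnd (sections X h p') q" if "z \<in> bnd (sections X h p) q" for z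
    by (rule horc_bnd[OF that assms(2)])
qed (rule assms(1))

lemmas presents_sections = presents_sset_homology(1)[OF simplicial_set_sections]

text \<open>The horizontal differential before passing to homology classes.\<close>

definition hbd :: "nat \<Rightarrow> nat \<Rightarrow> (real list \<times> 'x prism \<Rightarrow>\<^sub>0 'k::field) \<Rightarrow> (real list \<times> 'x prism \<Rightarrow>\<^sub>0 'k)" where
  "hbd p q = lift (\<lambda>s. \<Sum>i\<le>Suc p. pscale ((-1) ^ i) (sing (hor_op (coface p i) q s)))"

lemma hbd_eq: "hbd p q z = (\<Sum>i\<le>Suc p. pscale ((-1) ^ i) (horc (coface p i) q z))"
  unfolding hbd_def lift_fun_sum lift_fun_scale ..

lemma hbd_linear: "Vector_Spaces.linear pscale pscale (hbd p q)"
  unfolding hbd_def by (rule lift_linear)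

lemma hbd_0: "hbd 0 q z = horc (coface 0 0) q z - horc (coface 0 (Suc 0)) q z"
  by (simp add: hbd_eq)

lemma hbd_1: "hbd (Suc 0) q z = horc (coface (Suc 0) 0) q z - horc (coface (Suc 0) (Suc 0)) q z
    + horc (coface (Suc 0) (Suc (Suc 0))) q z"
  by (simp add: hbd_eq)

lemma hbd_cyc:
  assumes "z \<in> cyc (sections X h (Suc p)) q" shows "hbd p q z \<in> cyc (sections X h p) q"
  unfolding hbd_eq
  by (intro pm.subspace_sum[OF presentsD(1)[OF presents_sections]]
      pm.subspace_scale[OF presentsD(1)[OF presents_sections]] horc_cyc[OF assms] coface_ops) simp

lemma hbd_bnd:
  assumes "z \<in> bnd (sections X h (Suc p)) q" shows "hbd p q z \<in> bnd (sections X h p) q"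
proof -
  note S = presents_kernel_subspace(1)[OF presents_sections]
  show ?thesis unfolding hbd_eq
    by (intro pm.subspace_sum[OF S] pm.subspace_scale[OF S] horc_bnd[OF assms] coface_ops) simp
qed

definition degs :: "'x sset \<Rightarrow> (nat \<Rightarrow> 'x \<Rightarrow> real list) \<Rightarrow> nat \<Rightarrow> nat \<Rightarrow> (real list \<times> 'x prism \<Rightarrow>\<^sub>0 'k::field) set" where
  "degs X h q p = (\<Union>j<p. horc (codegen (p - 1) j) q ` cyc (sections X h (p - 1)) q)"

text \<open>Degenerate classes seen on cycles: the full preimage of \<open>degenerate_span\<close>,
  so it contains the boundaries of the section space besides the generators
  \<open>degs\<close>.\<close>

definition degK :: "'x sset \<Rightarrow> (nat \<Rightarrow> 'x \<Rightarrow> real list) \<Rightarrow> nat \<Rightarrow> nat \<Rightarrow> (real list \<times> 'x prism \<Rightarrow>\<^sub>0 'k::field) set" where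
  "degK X h q p = {z \<in> cyc (sections X h p) q. cls (sections X h p) q z \<in> degenerate_span X h q p}"

lemma codegen_ops': "j < p \<Longrightarrow> codegen (p - 1) j \<in> ops p (p - 1)"
  using codegen_ops[of j "p - 1"] by simp

lemma degs_cyc: "degs X h q p \<subseteq> cyc (sections X h p) q"
  unfolding degs_def using horc_cyc codegen_ops' by blast

lemma degenerate_span_eq:
  "degenerate_span X h q p
    = LinearCombinations.module.span class_ring (sset_homology (sections X h p) q :: ('k::field, _) module)
        (cls (sections X h p) q ` degs X h q p)"
proof -
  have "homology_map (sections X h p) (hor_op (codegen (p - 1) j)) q ` carrier (sset_homology (sections X h (p - 1)) q)
      = (cls (sections X h p) q ` horc (codegen (p - 1) j) q ` cyc (sections X h (p - 1)) q :: (_ \<Rightarrow> 'k) set set)"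
    if "j < p" for j
    unfolding presentsD(2)[OF presents_sections, symmetric] image_image
    by (rule image_cong[OF refl homology_map_hor_op]) (simp_all only: codegen_ops'[OF that])
  then have "(\<Union>j<p. homology_map (sections X h p) (hor_op (codegen (p - 1) j)) q ` carrier (sset_homology (sections X h (p - 1)) q))
      = (cls (sections X h p) q ` degs X h q p :: (_ \<Rightarrow> 'k) set set)"
    unfolding degs_def image_UN by (intro SUP_cong) auto
  then show ?thesis unfolding degenerate_span_def by simp
qed

lemma degK:
  fixes W :: "(real list \<times> 'x prism \<Rightarrow>\<^sub>0 'k::field) set"
  shows "pm.subspace (degK X h q p :: (real list \<times> 'x prism \<Rightarrow>\<^sub>0 'k::field) set)"
    "bnd (sections X h p) q \<subseteq> (degK X h q p :: (real list \<times> 'x prism \<Rightarrow>\<^sub>0 'k) set)"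
    "degK X h q p \<subseteq> (cyc (sections X h p) q :: (real list \<times> 'x prism \<Rightarrow>\<^sub>0 'k) set)"
    "degs X h q p \<subseteq> (degK X h q p :: (real list \<times> 'x prism \<Rightarrow>\<^sub>0 'k) set)"
    "degenerate_span X h q p = cls (sections X h p) q ` (degK X h q p :: (real list \<times> 'x prism \<Rightarrow>\<^sub>0 'k) set)"
    "pm.subspace W \<Longrightarrow> bnd (sections X h p) q \<subseteq> W \<Longrightarrow> W \<subseteq> cyc (sections X h p) q \<Longrightarrow>
      degs X h q p \<subseteq> W \<Longrightarrow> degK X h q p \<subseteq> W"
proof -
  note * = presents_span[OF presents_sections degs_cyc degK_def[unfolded degenerate_span_eq]]
  show "pm.subspace (degK X h q p :: (real list \<times> 'x prism \<Rightarrow>\<^sub>0 'k::field) set)"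
    "bnd (sections X h p) q \<subseteq> (degK X h q p :: (real list \<times> 'x prism \<Rightarrow>\<^sub>0 'k) set)"
    "degK X h q p \<subseteq> (cyc (sections X h p) q :: (real list \<times> 'x prism \<Rightarrow>\<^sub>0 'k) set)"
    "degs X h q p \<subseteq> (degK X h q p :: (real list \<times> 'x prism \<Rightarrow>\<^sub>0 'k) set)"
    by (fact *)+
  show "degenerate_span X h q p = cls (sections X h p) q ` (degK X h q p :: (real list \<times> 'x prism \<Rightarrow>\<^sub>0 'k) set)"
    unfolding degenerate_span_eq by (fact *)
  show "pm.subspace W \<Longrightarrow> bnd (sections X h p) q \<subseteq> W \<Longrightarrow> W \<subseteq> cyc (sections X h p) q \<Longrightarrow>
      degs X h q p \<subseteq> W \<Longrightarrow> degK X h q p \<subseteq> W"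
    by (fact *)
qed

text \<open>No degeneracy ends in degree 0, so only the class zero is degenerate there.\<close>

lemma degK_0: "degK X h q 0 = (bnd (sections X h 0) q :: (real list \<times> 'x prism \<Rightarrow>\<^sub>0 'k::field) set)"
proof
  note S = presents_kernel_subspace[OF presents_sections]
  show "degK X h q 0 \<subseteq> (bnd (sections X h 0) q :: (real list \<times> 'x prism \<Rightarrow>\<^sub>0 'k::field) set)"
    by (rule degK(6)[OF S(1) subset_refl S(2)]) (simp add: degs_def)
qed (rule degK(2))

lemma degK_codegen:
  assumes "j \<le> p" "c \<in> cyc (sections X h p) q"
  shows "horc (codegen p j) q c \<in> degK X h q (Suc p)"
proof -
  have "horc (codegen p j) q c \<in> degs X h q (Suc p)" unfolding degs_def using assms by auto
  then show ?thesis using degK(4) by blast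
qed

text \<open>By \<open>degenerate_cycle\<close> such a cycle is a boundary plus degeneracies of
  cycles.\<close>

lemma repeated_degK:
  assumes z: "z \<in> cyc (sections X h (Suc p)) q"
    and r: "\<And>s. s \<in> Poly_Mapping.keys z \<Longrightarrow> rep (fst s)"
  shows "z \<in> (degK X h q (Suc p) :: (real list \<times> 'x prism \<Rightarrow>\<^sub>0 'k::field) set)"
proof -
  let ?Y = "sections X h (Suc p)" and ?K = "degK X h q (Suc p) :: (real list \<times> 'x prism \<Rightarrow>\<^sub>0 'k) set"
  have z': "Poly_Mapping.keys z \<subseteq> simplices ?Y q" "lift (bds ?Y q) z = 0" using z by (auto simp: cyc_def)
  show ?thesis
  proof (rule degenerate_cycle[OF z'(1) r z'(2)])
    fix t c
    assume t: "Poly_Mapping.keys t \<subseteq> simplices ?Y (Suc q)"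
      and c: "\<And>j. j \<le> p \<Longrightarrow> Poly_Mapping.keys (c j) \<subseteq> simplices (sections X h p) q"
        "\<And>j. j \<le> p \<Longrightarrow> lift (bds (sections X h p) q) (c j) = 0"
      and eq: "z = lift (bds ?Y (Suc q)) t + (\<Sum>j\<le>p. horc (codegen p j) q (c j))"
    have "lift (bds ?Y (Suc q)) t \<in> ?K" using degK(2) t unfolding bnd_def by blast
    moreover have "(\<Sum>j\<le>p. horc (codegen p j) q (c j)) \<in> ?K"
      by (rule pm.subspace_sum[OF degK(1)], rule degK_codegen) (use c in \<open>auto simp: cyc_def\<close>)
    ultimately show "z \<in> ?K" unfolding eq using pm.subspace_add[OF degK(1)] by blast
  qed
qed

context subdivided_height
begin

text \<open>From degree 2 on all sections lie over sequences with a repetition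
  (\<open>rep_sections\<close>), so the Reeb complexes vanish there.\<close>

lemma degK_all:
  "degK X h q (Suc (Suc p)) = (cyc (sections X h (Suc (Suc p))) q :: (real list \<times> 'x prism \<Rightarrow>\<^sub>0 'k::field) set)"
proof
  show "cyc (sections X h (Suc (Suc p))) q \<subseteq> (degK X h q (Suc (Suc p)) :: (real list \<times> 'x prism \<Rightarrow>\<^sub>0 'k) set)"
    using repeated_degK rep_sections cyc_chain by (intro subsetI repeated_degK) blast+
qed (rule degK(3))

lemma hbd_codegen_0:
  assumes "c \<in> cyc (sections X h 0) q"
  shows "hbd 0 q (horc (codegen 0 0) q c) = 0"
proof -
  note k = cyc_chain[OF assms]
  have "horc (coface 0 i) q (horc (codegen 0 0) q c) = c" if "i \<le> Suc 0" for i
  proof -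
    have "op_comp (codegen 0 0) (coface 0 i) = op_id 0"
      using that by (auto simp: op_comp_def codegen_def coface_def op_id_def le_Suc_eq)
    then show ?thesis
      unfolding horc_horc[OF k codegen_ops[OF le_refl] coface_ops[OF that]] using horc_id[OF k] by simp
  qed
  then show ?thesis by (simp add: hbd_0)
qed

text \<open>Of the three faces of a degenerate element two are \<open>c\<close> itself with opposite
  signs; the third is the degeneracy of the face with index \<open>Suc 0 - j\<close>.\<close>

lemma hbd_codegen_1:
  assumes c: "c \<in> cyc (sections X h (Suc 0)) q" and j: "j \<le> Suc 0"
  shows "hbd (Suc 0) q (horc (codegen (Suc 0) j) q c) = horc (codegen 0 0) q (horc (coface 0 (Suc 0 - j)) q c)"
proof -
  note k = cyc_chain[OF c]
  have co: "coface 0 (Suc 0 - j) \<in> ops 0 (Suc 0)" by (rule coface_ops) simp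
  have "horc (codegen 0 0) q (horc (coface 0 (Suc 0 - j)) q c) = horc (op_comp (coface 0 (Suc 0 - j)) (codegen 0 0)) q c"
    by (rule horc_horc[OF k co codegen_ops[OF le_refl]])
  moreover have "horc (coface (Suc 0) i) q (horc (codegen (Suc 0) j) q c) = horc (op_comp (codegen (Suc 0) j) (coface (Suc 0) i)) q c"
    if "i \<le> Suc (Suc 0)" for i
    by (rule horc_horc[OF k codegen_ops[OF j] coface_ops[OF that]])
  moreover consider "j = 0" | "j = Suc 0" using j by linarith
  then have "horc (op_comp (codegen (Suc 0) j) (coface (Suc 0) 0)) q c
      - horc (op_comp (codegen (Suc 0) j) (coface (Suc 0) (Suc 0))) q c
      + horc (op_comp (codegen (Suc 0) j) (coface (Suc 0) (Suc (Suc 0)))) q c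
    = horc (op_comp (coface 0 (Suc 0 - j)) (codegen 0 0)) q c"
    by cases (simp_all add: op_comp_def codegen_def coface_def)
  ultimately show ?thesis by (simp only: hbd_1 le0 le_SucI le_refl)
qed

text \<open>By the minimality of \<open>degK\<close> the claim reduces to boundaries and to
  degeneracies of cycles.\<close>

lemma hbd_degK:
  assumes z: "z \<in> degK X h q (Suc p)"
  shows "hbd p q z \<in> (degK X h q p :: (real list \<times> 'x prism \<Rightarrow>\<^sub>0 'k::field) set)"
proof -
  let ?Y = "sections X h (Suc p)" and ?K = "degK X h q p :: (real list \<times> 'x prism \<Rightarrow>\<^sub>0 'k) set"
  interpret d: Vector_Spaces.linear pscale pscale "hbd p q :: (real list \<times> 'x prism \<Rightarrow>\<^sub>0 'k) \<Rightarrow> _" by (rule hbd_linear)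
  let ?W = "{z \<in> cyc ?Y q. hbd p q z \<in> ?K}"
  note S = presents_kernel_subspace[OF presents_sections] and Z = presentsD(1)[OF presents_sections]
  have "degK X h q (Suc p) \<subseteq> ?W"
  proof (rule degK(6))
    show "pm.subspace ?W" unfolding pm.subspace_def
      by (simp add: d.zero d.add d.scale pm.subspace_0[OF Z] pm.subspace_add[OF Z] pm.subspace_scale[OF Z]
        pm.subspace_0[OF degK(1)] pm.subspace_add[OF degK(1)] pm.subspace_scale[OF degK(1)])
    show "bnd ?Y q \<subseteq> ?W" using S(2) hbd_bnd degK(2) by fast
    show "?W \<subseteq> cyc ?Y q" by blast
    show "degs X h q (Suc p) \<subseteq> ?W"
    proof
      fix w :: "real list \<times> 'x prism \<Rightarrow>\<^sub>0 'k" assume w: "w \<in> degs X h q (Suc p)"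
      then obtain j c where jc: "j \<le> p" "c \<in> cyc (sections X h p) q" "w = horc (codegen p j) q c"
        unfolding degs_def by (auto simp: less_Suc_eq_le)
      have wc: "w \<in> cyc ?Y q" using w degs_cyc by blast
      \<comment> \<open>For larger \<open>p\<close> every cycle in the target is degenerate by
        \<open>degK_all\<close>, so the simplicial identities are invoked for \<open>p = 0\<close>
        and \<open>p = 1\<close> alone.\<close>
      consider "p = 0" | "p = Suc 0" | p' where "p = Suc (Suc p')"
        using not0_implies_Suc[of p] not0_implies_Suc[of "p - 1"] by fastforce
      then have "hbd p q w \<in> ?K"
      proof cases
        case 1
        then show ?thesis using hbd_codegen_0[of c q] jc pm.subspace_0[OF degK(1)] by simp
      next
        case 2
        have "hbd (Suc 0) q w = horc (codegen 0 0) q (horc (coface 0 (Suc 0 - j)) q c)"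
          using hbd_codegen_1[of c q j] jc unfolding 2 by simp
        moreover have "horc (coface 0 (Suc 0 - j)) q c \<in> cyc (sections X h 0) q"
          by (rule horc_cyc[OF jc(2)[unfolded 2] coface_ops]) simp
        ultimately show ?thesis unfolding 2 using degK_codegen[of 0 0] by simp
      next
        case 3
        then show ?thesis using hbd_cyc[OF wc] degK_all by blast
      qed
      with wc show "w \<in> ?W" by blast
    qed
  qed
  then show ?thesis using z by blast
qed

definition rcls :: "nat \<Rightarrow> nat \<Rightarrow> (real list \<times> 'x prism \<Rightarrow>\<^sub>0 'k::field) \<Rightarrow> (real list \<times> 'x prism \<Rightarrow> 'k) set set" where
  "rcls q p z = degenerate_span X h q p +>\<^bsub>sset_homology (sections X h p) q\<^esub> cls (sections X h p) q z"

definition rcyc :: "nat \<Rightarrow> nat \<Rightarrow> (real list \<times> 'x prism \<Rightarrow>\<^sub>0 'k::field) set" where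
  "rcyc q p = (case p of 0 \<Rightarrow> cyc S0 q | Suc m \<Rightarrow> {z \<in> cyc (sections X h (Suc m)) q. hbd m q z \<in> degK X h q m})"

lemma presents_reeb:
  obtains f where "presents (rcyc q p) f (homology (reeb_complex X h q :: ('k::field, _) ch_complex) p)
    {hbd p q y + k | y k. y \<in> cyc (sections X h (Suc p)) q \<and> k \<in> degK X h q p}"
proof -
  let ?C = "reeb_complex X h q :: ('k::field, _) ch_complex"
  let ?Z = "\<lambda>p. cyc (sections X h p) q :: (real list \<times> 'x prism \<Rightarrow>\<^sub>0 'k) set"
  have P: "presents (?Z p) (rcls q p) (ch ?C p) (degK X h q p)" for p
    using presents_quot[OF presents_sections degK(1-3,5)]
    by (simp add: reeb_complex_def rcls_def[abs_def])
  have d: "hbd p q z \<in> ?Z p \<and> bd ?C p (rcls q (Suc p) z) = rcls q p (hbd p q z)" if z: "z \<in> ?Z (Suc p)" for p z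
  proof
    show "hbd p q z \<in> ?Z p" by (rule hbd_cyc[OF z])
    show "bd ?C p (rcls q (Suc p) z) = rcls q p (hbd p q z)"
      unfolding reeb_complex_def ch_complex.simps rcls_def
    proof (rule presents_quot_map[OF presents_sections _ degK(3,5) presents_sections degK(1,2,3,5) _ _ _ _ z])
      show "0 \<in> degK X h q (Suc p)" by (rule pm.subspace_0[OF degK(1)])
      fix w :: "real list \<times> 'x prism \<Rightarrow>\<^sub>0 'k" assume w: "w \<in> ?Z (Suc p)"
      show "alt_sum (sset_homology (sections X h p) q)
          (\<lambda>i. homology_map (sections X h p) (hor_op (coface p i)) q) (Suc p) (cls (sections X h (Suc p)) q w)
        = cls (sections X h p) q (hbd p q w)"
        unfolding hbd_eq
        by (rule presents_alt_sum[OF presents_sections])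
          (use horc_cyc[OF w coface_ops] homology_map_hor_op[OF w coface_ops] in auto)
      show "hbd p q w \<in> ?Z p" by (rule hbd_cyc[OF w])
    next
      interpret l: Vector_Spaces.linear pscale pscale "hbd p q :: (real list \<times> 'x prism \<Rightarrow>\<^sub>0 'k) \<Rightarrow> _" by (rule hbd_linear)
      show "hbd p q (x + y) = hbd p q x + (hbd p q y :: real list \<times> 'x prism \<Rightarrow>\<^sub>0 'k)" for x y by (rule l.add)
      show "hbd p q w \<in> degK X h q p" if "w \<in> degK X h q (Suc p)" for w :: "real list \<times> 'x prism \<Rightarrow>\<^sub>0 'k"
        by (rule hbd_degK[OF that])
    qed
  qed
  \<comment> \<open>A cycle in degree 2 or more is degenerate by \<open>degK_all\<close>, and
    \<open>hbd\<close> preserves degenerate cycles; this replaces the simplicial identities.\<close>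
  have dd: "hbd p q (hbd (Suc p) q z) \<in> degK X h q p" if "z \<in> ?Z (Suc (Suc p))" for p z
    using hbd_degK[OF hbd_degK] that degK_all by blast
  show ?thesis
    by (rule that, rule presents_homology[where d = "\<lambda>p. hbd p q", OF P d hbd_linear dd])
      (auto simp: rcyc_def split: nat.split)
qed

end


lemma cyc_bnd_subspace:
  assumes "simplicial_set Y"
  shows "pm.subspace (cyc Y q :: (_ \<Rightarrow>\<^sub>0 'k::field) set)" "pm.subspace (bnd Y q :: (_ \<Rightarrow>\<^sub>0 'k) set)"
    "bnd Y q \<subseteq> (cyc Y q :: (_ \<Rightarrow>\<^sub>0 'k) set)"
  using presentsD(1)[OF presents_sset_homology(1)[OF assms]] presents_kernel_subspace[OF presents_sset_homology(1)[OF assms]]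
  by auto

lemmas sections_subspace = cyc_bnd_subspace[OF simplicial_set_sections]

section \<open>The homology of the Reeb complexes in each degree\<close>

context subdivided_height
begin

lemma DD_hbd: "DD q = hbd 0 q"
  by (rule ext) (simp add: DD_def hbd_0)

lemma DD_linear: "Vector_Spaces.linear pscale pscale (DD q)"
  unfolding DD_hbd by (rule hbd_linear)

lemma presents_reeb_0:
  obtains f where "presents (cyc S0 q) f (homology (reeb_complex X h q :: ('k::field, _) ch_complex) 0)
    {DD q y + k | y k. y \<in> cyc S1 q \<and> k \<in> bnd S0 q}"
proof (rule presents_reeb[of q 0])
  fix f assume "presents (rcyc q 0) f (homology (reeb_complex X h q :: ('k::field, _) ch_complex) 0)
    {hbd 0 q y + k | y k. y \<in> cyc S1 q \<and> k \<in> degK X h q 0}"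
  then show thesis using that unfolding rcyc_def nat.case degK_0 DD_hbd by blast
qed

text \<open>A presentation of \<open>K\<close> with kernel \<open>K\<close> expresses that the
  module is zero.\<close>

lemma presents_reeb_ge2:
  obtains f and K :: "(real list \<times> 'x prism \<Rightarrow>\<^sub>0 'k::field) set"
    where "presents K f (homology (reeb_complex X h q) (Suc (Suc p))) K"
proof (rule presents_reeb[of q "Suc (Suc p)"])
  let ?K = "{hbd (Suc (Suc p)) q y + k | y k. y \<in> cyc (sections X h (Suc (Suc (Suc p)))) q \<and> k \<in> degK X h q (Suc (Suc p))} :: (real list \<times> 'x prism \<Rightarrow>\<^sub>0 'k) set"
  fix f assume P: "presents (rcyc q (Suc (Suc p))) f (homology (reeb_complex X h q :: ('k::field, _) ch_complex) (Suc (Suc p))) ?K"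
  interpret l: Vector_Spaces.linear pscale pscale "hbd (Suc (Suc p)) q :: (real list \<times> 'x prism \<Rightarrow>\<^sub>0 'k) \<Rightarrow> _" by (rule hbd_linear)
  have "rcyc q (Suc (Suc p)) \<subseteq> ?K"
  proof
    fix z :: "real list \<times> 'x prism \<Rightarrow>\<^sub>0 'k" assume "z \<in> rcyc q (Suc (Suc p))"
    then have "z \<in> degK X h q (Suc (Suc p))" unfolding degK_all rcyc_def by simp
    moreover have "z = hbd (Suc (Suc p)) q 0 + z" by (simp add: l.zero)
    ultimately show "z \<in> ?K" using pm.subspace_0[OF sections_subspace(1)] by blast
  qed
  then have e: "rcyc q (Suc (Suc p)) = ?K" using presents_kernel_subspace(2)[OF P] by (rule equalityI)
  from P[unfolded e] show thesis by (rule that)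
qed

text \<open>Strict representatives for the kernel of the map that \<open>DD\<close> induces from the
  homology of \<open>S1\<close> to that of \<open>S0\<close>.\<close>

definition scyc :: "nat \<Rightarrow> (real list \<times> 'x prism \<Rightarrow>\<^sub>0 'k::field) set" where
  "scyc q = {z. Poly_Mapping.keys z \<subseteq> SS q \<and> lift (bds S1 q) z = 0 \<and> DD q z \<in> bnd S0 q}"

definition sbnd :: "nat \<Rightarrow> (real list \<times> 'x prism \<Rightarrow>\<^sub>0 'k::field) set" where
  "sbnd q = lift (bds S1 (Suc q)) ` chain_set (SS (Suc q))"

abbreviation (input) strict :: "real list \<Rightarrow> bool" where
  "strict \<equiv> \<lambda>a. a ! 0 < a ! Suc 0"

lemma SS_S1: "SS q \<subseteq> simplices S1 q"
  by (auto simp: SS_def)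

lemma restr_linear: "Vector_Spaces.linear pscale pscale (restr P)"
  unfolding restr_def by (rule lift_linear)

lemma restr_SS:
  assumes "Poly_Mapping.keys z \<subseteq> SS q" shows "restr strict z = z"
  by (rule restr_id) (use assms in \<open>auto simp: SS_def\<close>)

lemma keys_restr_SS:
  assumes "Poly_Mapping.keys z \<subseteq> simplices S1 q" shows "Poly_Mapping.keys (restr strict z) \<subseteq> SS q"
proof
  fix s assume "s \<in> Poly_Mapping.keys (restr strict z)"
  from keys_restr[OF this] show "s \<in> SS q" using assms by (auto simp: SS_def)
qed

lemma restr_cyc:
  assumes "z \<in> cyc (sections X h p) q" shows "restr P z \<in> cyc (sections X h p) q"
proof -
  have "Poly_Mapping.keys (restr P z) \<subseteq> Poly_Mapping.keys z" using keys_restr by blast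
  moreover have "lift (bds (sections X h p) q) (restr P z) = 0"
    using bds_restr[OF cyc_chain[OF assms], of P] assms by (simp add: cyc_def restr_def)
  ultimately show ?thesis using cyc_chain[OF assms] by (simp add: cyc_def subset_trans)
qed

lemma nonstrict_rep:
  assumes "s \<in> simplices S1 q" "\<not> strict (fst s)" shows "rep (fst s)"
proof -
  obtain a \<rho> where s: "s = (a, \<rho>)" "length a = Suc (Suc 0)" "sorted a" using assms(1) by (rule sections_cases)
  have "a ! 0 \<le> a ! Suc 0" using s by (intro sorted_nth_mono) simp_all
  then show ?thesis using assms(2) s unfolding rep_def by (intro exI[of _ 0]) simp
qed

lemma sbnd_subspace: "pm.subspace (sbnd q :: (real list \<times> 'x prism \<Rightarrow>\<^sub>0 'k::field) set)"
  unfolding sbnd_def by (rule lift.subspace_image[OF subspace_chain_set])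

lemma sbnd_bnd: "sbnd q \<subseteq> (bnd S1 q :: (real list \<times> 'x prism \<Rightarrow>\<^sub>0 'k::field) set)"
  unfolding sbnd_def bnd_def using SS_S1 by blast

text \<open>Degeneracies from degree 0 lie over pairs with equal entries and are removed, while
  boundaries restrict to boundaries of strict chains.\<close>

lemma restr_degK:
  assumes "z \<in> degK X h q (Suc 0)"
  shows "restr strict z \<in> (sbnd q :: (real list \<times> 'x prism \<Rightarrow>\<^sub>0 'k::field) set)"
proof -
  interpret l: Vector_Spaces.linear pscale pscale "restr strict :: (real list \<times> 'x prism \<Rightarrow>\<^sub>0 'k) \<Rightarrow> _" by (rule restr_linear)
  let ?W = "{z \<in> cyc S1 q. restr strict z \<in> (sbnd q :: (real list \<times> 'x prism \<Rightarrow>\<^sub>0 'k) set)}"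
  have "degK X h q (Suc 0) \<subseteq> ?W"
  proof (rule degK(6))
    show "pm.subspace ?W" unfolding pm.subspace_def
      by (simp add: l.zero l.add l.scale pm.subspace_0[OF sections_subspace(1)] pm.subspace_add[OF sections_subspace(1)]
          pm.subspace_scale[OF sections_subspace(1)] pm.subspace_0[OF sbnd_subspace]
          pm.subspace_add[OF sbnd_subspace] pm.subspace_scale[OF sbnd_subspace])
    show "?W \<subseteq> cyc S1 q" by blast
    show "bnd S1 q \<subseteq> ?W"
    proof
      fix z :: "real list \<times> 'x prism \<Rightarrow>\<^sub>0 'k" assume z: "z \<in> bnd S1 q"
      then obtain y where y: "z = lift (bds S1 (Suc q)) y" "Poly_Mapping.keys y \<subseteq> simplices S1 (Suc q)"
        by (auto simp: bnd_def)
      have "restr strict z = lift (bds S1 (Suc q)) (restr strict y)" unfolding y(1) bds_restr[OF y(2)] ..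
      then have "restr strict z \<in> sbnd q" unfolding sbnd_def using keys_restr_SS[OF y(2)] by blast
      then show "z \<in> ?W" using z sections_subspace(3) by blast
    qed
    show "degs X h q (Suc 0) \<subseteq> ?W"
    proof
      fix z :: "real list \<times> 'x prism \<Rightarrow>\<^sub>0 'k" assume z: "z \<in> degs X h q (Suc 0)"
      then obtain c where c: "z = horc (codegen 0 0) q c" "c \<in> cyc S0 q" by (auto simp: degs_def)
      have "restr strict z = 0"
      proof (rule restr_zero)
        fix s assume "s \<in> Poly_Mapping.keys z"
        then obtain s' where "s = hor_op (codegen 0 0) q s'" unfolding c(1) by (rule in_keys_lift) auto
        then have "fst s = op_comp (fst s') (codegen 0 0)" by (simp add: fst_hor_op)
        then show "\<not> strict (fst s)" by (simp add: op_comp_def codegen_def)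
      qed
      then show "z \<in> ?W" using subsetD[OF degs_cyc z] pm.subspace_0[OF sbnd_subspace] by simp
    qed
  qed
  then show ?thesis using assms by blast
qed

text \<open>The part of a cycle over pairs with equal entries is degenerate, so removing it keeps
  the class; by \<open>hbd_degK\<close> it also changes \<open>DD\<close> only by a
  boundary.\<close>

lemma presents_reeb_1:
  obtains f where "presents (scyc q) f (homology (reeb_complex X h q :: ('k::field, _) ch_complex) (Suc 0)) (sbnd q)"
proof (rule presents_reeb[of q "Suc 0"])
  interpret l: Vector_Spaces.linear pscale pscale "hbd (Suc 0) q :: (real list \<times> 'x prism \<Rightarrow>\<^sub>0 'k) \<Rightarrow> _" by (rule hbd_linear)
  interpret D: Vector_Spaces.linear pscale pscale "DD q :: (real list \<times> 'x prism \<Rightarrow>\<^sub>0 'k) \<Rightarrow> _" by (rule DD_linear)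
  let ?K = "{hbd (Suc 0) q y + k | y k. y \<in> cyc (sections X h (Suc (Suc 0))) q \<and> k \<in> degK X h q (Suc 0)} :: (real list \<times> 'x prism \<Rightarrow>\<^sub>0 'k) set"
  let ?K1 = "degK X h q (Suc 0) :: (real list \<times> 'x prism \<Rightarrow>\<^sub>0 'k) set"
  fix f assume P: "presents (rcyc q (Suc 0)) f (homology (reeb_complex X h q :: ('k::field, _) ch_complex) (Suc 0)) ?K"
  \<comment> \<open>What comes from degree 2 is degenerate there, hence has degenerate image and
    adds nothing to the kernel.\<close>
  have K: "?K = ?K1"
  proof (intro equalityI subsetI)
    fix z assume "z \<in> ?K"
    then obtain y k where z: "z = hbd (Suc 0) q y + k" "y \<in> degK X h q (Suc (Suc 0))" "k \<in> ?K1"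
      unfolding degK_all by blast
    then show "z \<in> ?K1" using hbd_degK[OF z(2)] pm.subspace_add[OF degK(1)] by blast
  next
    fix z assume "z \<in> ?K1"
    moreover have "z = hbd (Suc 0) q 0 + z" by (simp add: l.zero)
    ultimately show "z \<in> ?K" using pm.subspace_0[OF sections_subspace(1)] by blast
  qed
  have R: "rcyc q (Suc 0) = {z \<in> cyc S1 q. DD q z \<in> bnd S0 q}"
    by (simp add: rcyc_def degK_0 DD_hbd)
  have DK: "DD q z \<in> bnd S0 q" if "z \<in> ?K1" for z
    using hbd_degK[OF that] unfolding degK_0 DD_hbd .
  have S: "scyc q = {z \<in> rcyc q (Suc 0). Poly_Mapping.keys z \<subseteq> SS q}"
    unfolding R scyc_def cyc_def using SS_S1 by blast
  have "presents (scyc q) f (homology (reeb_complex X h q :: ('k::field, _) ch_complex) (Suc 0)) (scyc q \<inter> ?K)"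
  proof (rule presents_restrict[OF P])
    show "scyc q \<subseteq> rcyc q (Suc 0)" unfolding S by blast
    have "(scyc q :: (_ \<Rightarrow>\<^sub>0 'k) set) = rcyc q (Suc 0) \<inter> chain_set (SS q)" unfolding S by blast
    then show "pm.subspace (scyc q :: (_ \<Rightarrow>\<^sub>0 'k) set)"
      using pm.subspace_inter[OF presentsD(1)[OF P] subspace_chain_set] by simp
    fix z :: "real list \<times> 'x prism \<Rightarrow>\<^sub>0 'k" assume "z \<in> rcyc q (Suc 0)"
    then have z: "z \<in> cyc S1 q" "DD q z \<in> bnd S0 q" unfolding R by auto
    let ?r = "restr (\<lambda>a. \<not> strict a) z"
    have zr: "z - restr strict z = ?r" unfolding diff_eq_eq using restr_split[of strict z] by (simp add: add.commute)
    have "?r \<in> ?K1"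
    proof (rule repeated_degK[OF restr_cyc[OF z(1)]])
      fix s assume "s \<in> Poly_Mapping.keys ?r"
      from keys_restr[OF this] show "rep (fst s)" using nonstrict_rep[OF subsetD[OF cyc_chain[OF z(1)]]] by blast
    qed
    moreover have "DD q (restr strict z) \<in> bnd S0 q"
    proof -
      have "restr strict z = z - ?r" using zr by (simp add: algebra_simps)
      then show ?thesis using D.diff[of z ?r] pm.subspace_diff[OF sections_subspace(2) z(2) DK[OF \<open>?r \<in> ?K1\<close>]] by simp
    qed
    then have "restr strict z \<in> scyc q"
      unfolding S R using restr_cyc[OF z(1)] keys_restr_SS[OF cyc_chain[OF z(1)]] by blast
    ultimately show "\<exists>z'\<in>scyc q. z - z' \<in> ?K" unfolding K by (intro bexI[of _ "restr strict z"]) (simp_all only: zr)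
  qed
  moreover have "scyc q \<inter> ?K = sbnd q"
  proof (intro equalityI subsetI)
    fix z assume "z \<in> scyc q \<inter> ?K"
    then have "z \<in> ?K1" "Poly_Mapping.keys z \<subseteq> SS q" unfolding K S by auto
    then show "z \<in> sbnd q" using restr_degK[of z q] restr_SS[of z q] by simp
  next
    fix z :: "real list \<times> 'x prism \<Rightarrow>\<^sub>0 'k" assume z: "z \<in> sbnd q"
    then have b: "z \<in> bnd S1 q" using sbnd_bnd by blast
    obtain t where t: "z = lift (bds S1 (Suc q)) t" "Poly_Mapping.keys t \<subseteq> SS (Suc q)" using z by (auto simp: sbnd_def)
    have t1: "Poly_Mapping.keys t \<subseteq> simplices S1 (Suc q)" using t(2) SS_S1 by blast
    have e: "restr strict z = z" unfolding t(1) bds_restr[OF t1, symmetric] restr_SS[OF t(2)] ..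
    have zc: "z \<in> cyc S1 q" using b sections_subspace(3) by blast
    have "Poly_Mapping.keys z \<subseteq> SS q" using keys_restr_SS[OF cyc_chain[OF zc]] unfolding e .
    moreover have "z \<in> ?K1" using b degK(2) by blast
    ultimately show "z \<in> scyc q \<inter> ?K"
      unfolding K S R using DK zc by blast
  qed
  ultimately show thesis using that by simp
qed

end


section \<open>Comparison with the homology of \<open>X\<close>\<close>

text \<open>An isomorphism induced by an additive relation instead of a map. As with connecting
  homomorphisms, passing between the two sides involves auxiliary chains that are not unique;
  \<open>R\<close> leaves them free, and \<open>ker\<close> makes the resulting class independent of
  them.\<close>

lemma presents_transport:
  assumes P: "presents Z f M K" and V: "pm.subspace V"
    and total: "\<And>v. v \<in> V \<Longrightarrow> \<exists>z\<in>Z. R v z" and onto: "\<And>z. z \<in> Z \<Longrightarrow> \<exists>v\<in>V. R v z"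
    and add: "\<And>v w x y. R v x \<Longrightarrow> R w y \<Longrightarrow> R (v + w) (x + y)"
    and scale: "\<And>r v x. R v x \<Longrightarrow> R (pscale r v) (pscale r x)"
    and ker: "\<And>v z. v \<in> V \<Longrightarrow> z \<in> Z \<Longrightarrow> R v z \<Longrightarrow> v \<in> K' \<longleftrightarrow> z \<in> K" and K': "K' \<subseteq> V"
  obtains g where "presents V g M K'"
proof -
  note P' = presentsD[OF P]
  have 0: "0 \<in> V" "0 \<in> Z" using pm.subspace_0[OF V] pm.subspace_0[OF P'(1)] by auto
  have R0: "R 0 0" using scale[of _ _ 0] total[OF 0(1)] by auto
  have uniq: "f x = f y" if "R v x" "R v y" "x \<in> Z" "y \<in> Z" for v x y
  proof -
    \<comment> \<open>The difference of two partners of \<open>v\<close> is related to 0, hence lies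
      in \<open>K\<close> by \<open>ker\<close>.\<close>
    have "R (v + pscale (- 1) v) (x + pscale (- 1) y)" by (intro add scale that)
    then have "R 0 (x - y)" by simp
    moreover have "x - y \<in> Z" using pm.subspace_diff[OF P'(1)] that by blast
    moreover have "0 \<in> K'" using ker[OF 0 R0] pm.subspace_0[OF presents_kernel_subspace(1)[OF P]] by blast
    ultimately have "x - y \<in> K" using ker 0(1) by blast
    then show ?thesis using presents_eq_iff[OF P that(3,4)] by blast
  qed
  define g where "g v = f (SOME z. z \<in> Z \<and> R v z)" for v
  have g: "g v = f z" if "R v z" "z \<in> Z" for v z
  proof -
    have "(SOME z. z \<in> Z \<and> R v z) \<in> Z \<and> R v (SOME z. z \<in> Z \<and> R v z)" by (rule someI[of _ z]) (use that in simp)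
    then show ?thesis unfolding g_def using uniq that by blast
  qed
  have "presents V g M K'" unfolding presents_def
  proof (intro conjI ballI allI)
    show "pm.subspace V" by (rule V)
    show "g ` V = carrier M"
    proof (intro equalityI subsetI)
      fix m assume "m \<in> g ` V"
      then obtain v where "m = g v" "v \<in> V" by blast
      then obtain z where z: "z \<in> Z" "R v z" using total by blast
      show "m \<in> carrier M" unfolding \<open>m = g v\<close> g[OF z(2,1)] P'(2)[symmetric] by (rule imageI[OF z(1)])
    next
      fix m assume "m \<in> carrier M"
      then obtain z where z: "z \<in> Z" "m = f z" using P'(2) by auto
      then obtain v where v: "v \<in> V" "R v z" using onto by blast
      show "m \<in> g ` V" unfolding z(2) g[OF v(2) z(1), symmetric] by (rule imageI[OF v(1)])
    qed
    show "g 0 = \<zero>\<^bsub>M\<^esub>" using g[OF R0 0(2)] P'(5) by simp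
    show "K' = {v \<in> V. g v = \<zero>\<^bsub>M\<^esub>}"
    proof -
      have "v \<in> K' \<longleftrightarrow> g v = \<zero>\<^bsub>M\<^esub>" if v: "v \<in> V" for v
      proof -
        obtain z where z: "z \<in> Z" "R v z" using total[OF v] by blast
        show ?thesis using ker[OF v z] g[OF z(2,1)] P'(6) z(1) by simp
      qed
      then show ?thesis using K' by blast
    qed
    fix v assume v: "v \<in> V"
    obtain x where x: "x \<in> Z" "R v x" using total[OF v] by blast
    show "g (pscale r v) = r \<odot>\<^bsub>M\<^esub> g v" for r
      using g[OF scale[OF x(2)] pm.subspace_scale[OF P'(1) x(1)]] g[OF x(2,1)] P'(4)[OF x(1)] by simp
    fix w assume w: "w \<in> V"
    obtain y where y: "y \<in> Z" "R w y" using total[OF w] by blast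
    show "g (v + w) = g v \<oplus>\<^bsub>M\<^esub> g w"
      using g[OF add[OF x(2) y(2)] pm.subspace_add[OF P'(1) x(1) y(1)]] g[OF x(2,1)] g[OF y(2,1)] P'(3)[OF x(1) y(1)] by simp
  qed
  then show ?thesis using that by blast
qed

lemma presents_dir_sum:
  assumes I: "finite I" and V: "pm.subspace V"
    and car: "\<And>i v. i \<in> I \<Longrightarrow> v \<in> V \<Longrightarrow> g i v \<in> carrier (M i)"
    and add: "\<And>i v w. i \<in> I \<Longrightarrow> v \<in> V \<Longrightarrow> w \<in> V \<Longrightarrow> g i (v + w) = g i v \<oplus>\<^bsub>M i\<^esub> g i w"
    and scale: "\<And>i v r. i \<in> I \<Longrightarrow> v \<in> V \<Longrightarrow> g i (pscale r v) = r \<odot>\<^bsub>M i\<^esub> g i v"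
    and zero: "\<And>i. i \<in> I \<Longrightarrow> g i 0 = \<zero>\<^bsub>M i\<^esub>"
    and onto: "\<And>m. (\<And>i. i \<in> I \<Longrightarrow> m i \<in> carrier (M i)) \<Longrightarrow> \<exists>v\<in>V. \<forall>i\<in>I. g i v = m i"
    and K: "K = {v \<in> V. \<forall>i\<in>I. g i v = \<zero>\<^bsub>M i\<^esub>}"
  shows "presents V (\<lambda>v. \<lambda>i\<in>I. g i v) (dir_sum I M) K"
proof -
  have "(\<lambda>v. \<lambda>i\<in>I. g i v) ` V = carrier (dir_sum I M)"
  proof (intro equalityI subsetI)
    fix m assume m: "m \<in> carrier (dir_sum I M)"
    then have m': "m \<in> (\<Pi>\<^sub>E i\<in>I. carrier (M i))" by (simp add: dir_sum_def)
    then obtain v where v: "v \<in> V" "\<forall>i\<in>I. g i v = m i" using onto[of m] by (auto simp: PiE_iff)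
    have "m = (\<lambda>i\<in>I. g i v)" using m' v(2) by (auto simp: PiE_iff extensional_def fun_eq_iff)
    then show "m \<in> (\<lambda>v. \<lambda>i\<in>I. g i v) ` V" using v(1) by blast
  qed (use I car in \<open>auto simp: dir_sum_def\<close>)
  then show ?thesis unfolding presents_def
    by (auto simp: V K dir_sum_def add scale zero fun_eq_iff restrict_def)
qed

text \<open>Every subspace of a vector space is a direct summand; this is what splits the short
  exact sequences.\<close>

lemma subspace_projection:
  assumes "pm.subspace (U :: ('x \<Rightarrow>\<^sub>0 'k::field) set)"
  obtains \<pi> where "Vector_Spaces.linear pscale pscale \<pi>" "range \<pi> \<subseteq> U" "\<And>u. u \<in> U \<Longrightarrow> \<pi> u = u"
proof -
  interpret vector_space_pair "pscale :: 'k \<Rightarrow> ('x \<Rightarrow>\<^sub>0 'k) \<Rightarrow> _" "pscale :: 'k \<Rightarrow> ('x \<Rightarrow>\<^sub>0 'k) \<Rightarrow> _" ..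
  show ?thesis
    using linear_exists_left_inverse_on[OF pm.linear_id assms inj_on_id] that by auto
qed


context subdivided_height
begin

text \<open>Cycles homologous to level cycles. Modulo boundaries this is the image of the homology
  of the level simplices in the homology of X.\<close>

definition levX :: "nat \<Rightarrow> ('x \<Rightarrow>\<^sub>0 'k::field) set" where
  "levX n = {v. \<exists>l y. l \<in> cyc S0 n \<and> Poly_Mapping.keys y \<subseteq> simplices X (Suc n) \<and> v = nuc n l + lift (bds X (Suc n)) y}"

lemmas X_subspace = cyc_bnd_subspace[OF X]

lemma keys_Prc: "Poly_Mapping.keys s \<subseteq> simplices S1 q \<Longrightarrow> Poly_Mapping.keys (lift (Pr q) s) \<subseteq> simplices X (Suc q)"
  by (rule keys_lift_subset, rule keys_Pr) auto

lemma relX_Prc: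
  assumes "Poly_Mapping.keys s \<subseteq> SS q" shows "relX (Suc q) (lift (Pr q) s) = lift (Pr q) s"
  unfolding lift_lift by (rule lift_cong, rule relX_Pr) (use assms in auto)

lemma nuc_cyc: assumes "l \<in> cyc S0 n" shows "nuc n l \<in> cyc X n"
  using assms bds_nuc[of l n] keys_nuc[of l n] by (simp add: cyc_def)

text \<open>\<open>prism_surj\<close> lifted from the quotient: the remainder is killed by
  \<open>relX\<close>, hence a level chain.\<close>

lemma prism_decomposition:
  fixes z :: "'x \<Rightarrow>\<^sub>0 'k::field"
  assumes z: "Poly_Mapping.keys z \<subseteq> simplices X (Suc n)" and rel: "relX n (lift (bds X (Suc n)) z) = 0"
  obtains s y l where "Poly_Mapping.keys s \<subseteq> SS n" "lift (bds S1 n) s = 0"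
    "Poly_Mapping.keys y \<subseteq> simplices X (Suc (Suc n))" "Poly_Mapping.keys l \<subseteq> simplices S0 (Suc n)"
    "z = lift (Pr n) s + lift (bds X (Suc (Suc n))) y + nuc (Suc n) l"
proof (rule prism_surj[OF z rel])
  fix s y
  assume s: "Poly_Mapping.keys s \<subseteq> SS n" "lift (bds S1 n) s = 0"
    and y: "Poly_Mapping.keys y \<subseteq> simplices X (Suc (Suc n))"
    and eq: "relX (Suc n) z = lift (Pr n) s + relX (Suc n) (lift (bds X (Suc (Suc n))) y)"
  let ?r = "z - lift (Pr n) s - lift (bds X (Suc (Suc n))) y"
  have "Poly_Mapping.keys s \<subseteq> simplices S1 n" using s(1) SS_S1 by blast
  then have k: "Poly_Mapping.keys ?r \<subseteq> simplices X (Suc n)"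
    by (intro keys_diff_subset z keys_Prc keys_lift_bds[OF X y])
  have "relX (Suc n) ?r = 0" unfolding lift_diff relX_Prc[OF s(1)] eq by simp
  then obtain l where l: "Poly_Mapping.keys l \<subseteq> simplices S0 (Suc n)" "nuc (Suc n) l = ?r"
    using nuc_surj[OF k] by blast
  have "z = lift (Pr n) s + lift (bds X (Suc (Suc n))) y + nuc (Suc n) l" unfolding l(2) by simp
  then show thesis by (rule that[OF s y l(1)])
qed

lemma bds_Prc:
  assumes "Poly_Mapping.keys s \<subseteq> simplices S1 q" "lift (bds S1 q) s = 0"
  shows "lift (bds X (Suc q)) (lift (Pr q) s) = nuc q (DD q s)"
  using prism_X[OF assms(1)] unfolding assms(2) by simp

lemma keys_DD:
  assumes "Poly_Mapping.keys s \<subseteq> simplices S1 q" shows "Poly_Mapping.keys (DD q s) \<subseteq> simplices S0 q"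
  unfolding DD_def by (intro keys_diff_subset keys_horc[OF assms] coface_ops) simp_all


text \<open>Exactness at the homology of the level simplices: a level cycle bounds in X exactly if,
  up to a boundary, it is \<open>DD\<close> of a cycle of sections. The image is therefore the
  cokernel of \<open>DD\<close>, the Reeb homology in degree 0.\<close>

lemma presents_levX:
  obtains g where "presents (levX n) g (homology (reeb_complex X h n :: ('k::field, _) ch_complex) 0) (bnd X n)"
proof (rule presents_reeb_0)
  let ?K = "{DD n y + k | y k. y \<in> cyc S1 n \<and> k \<in> bnd S0 n} :: (real list \<times> 'x prism \<Rightarrow>\<^sub>0 'k) set"
  fix f assume P: "presents (cyc S0 n) f (homology (reeb_complex X h n :: ('k::field, _) ch_complex) 0) ?K"
  define R :: "('x \<Rightarrow>\<^sub>0 'k) \<Rightarrow> _" where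
    "R v l \<longleftrightarrow> l \<in> cyc S0 n \<and> (\<exists>y. Poly_Mapping.keys y \<subseteq> simplices X (Suc n) \<and> v = nuc n l + lift (bds X (Suc n)) y)" for v l
  have L: "levX n = {v. \<exists>l\<in>cyc S0 n. R v l}" unfolding levX_def R_def by blast
  have radd: "R (v + w) (x + y)" if vx: "R v x" and wy: "R w y" for v w x y
  proof -
    obtain a b where ab: "Poly_Mapping.keys a \<subseteq> simplices X (Suc n)" "v = nuc n x + lift (bds X (Suc n)) a"
      "Poly_Mapping.keys b \<subseteq> simplices X (Suc n)" "w = nuc n y + lift (bds X (Suc n)) b" "x \<in> cyc S0 n" "y \<in> cyc S0 n"
      using vx wy unfolding R_def by blast
    then have "v + w = nuc n (x + y) + lift (bds X (Suc n)) (a + b)" by (simp add: lift_add algebra_simps)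
    then show ?thesis unfolding R_def
      using keys_add_subset[OF ab(1,3)] pm.subspace_add[OF sections_subspace(1) ab(5,6)] by blast
  qed
  have rscale: "R (pscale r v) (pscale r x)" if vx: "R v x" for r v x
  proof -
    obtain a where ab: "Poly_Mapping.keys a \<subseteq> simplices X (Suc n)" "v = nuc n x + lift (bds X (Suc n)) a" "x \<in> cyc S0 n"
      using vx unfolding R_def by blast
    then have "pscale r v = nuc n (pscale r x) + lift (bds X (Suc n)) (pscale r a)"
      by (simp add: lift_scale pm.scale_right_distrib)
    then show ?thesis unfolding R_def
      using keys_pscale_subset[OF ab(1)] pm.subspace_scale[OF sections_subspace(1) ab(3)] by blast
  qed
  have R0: "R (lift (bds X (Suc n)) y) 0" if "Poly_Mapping.keys y \<subseteq> simplices X (Suc n)" for y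
    unfolding R_def using that pm.subspace_0[OF sections_subspace(1)] by (auto intro!: exI[of _ y])
  show thesis
  proof (rule presents_transport[OF P, of "levX n" R])
    show "pm.subspace (levX n :: ('x \<Rightarrow>\<^sub>0 'k) set)" unfolding pm.subspace_def
    proof (intro conjI ballI allI)
      show "0 \<in> (levX n :: ('x \<Rightarrow>\<^sub>0 'k) set)"
        unfolding L using R0[of 0] by (intro CollectI bexI[of _ 0] pm.subspace_0[OF sections_subspace(1)]) simp
    next
      fix x y :: "'x \<Rightarrow>\<^sub>0 'k" assume "x \<in> levX n" "y \<in> levX n"
      then show "x + y \<in> levX n" unfolding L using radd pm.subspace_add[OF sections_subspace(1)] by blast
    next
      fix r and x :: "'x \<Rightarrow>\<^sub>0 'k" assume "x \<in> levX n"
      then show "pscale r x \<in> levX n" unfolding L using rscale pm.subspace_scale[OF sections_subspace(1)] by blast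
    qed
    show "\<exists>z\<in>cyc S0 n. R v z" if "v \<in> levX n" for v using that unfolding L by blast
    show "\<exists>v\<in>levX n. R v z" if z: "z \<in> cyc S0 n" for z
    proof -
      have "R (nuc n z) z" unfolding R_def using z by (auto intro!: exI[of _ 0])
      then show ?thesis unfolding L using z by blast
    qed
    show "R (v + w) (x + y)" if "R v x" "R w y" for v w x y using radd that .
    show "R (pscale r v) (pscale r x)" if "R v x" for r v x using rscale that .
    show "bnd X n \<subseteq> (levX n :: ('x \<Rightarrow>\<^sub>0 'k) set)"
      unfolding L bnd_def by (auto intro!: bexI[of _ 0] R0 pm.subspace_0[OF sections_subspace(1)])
    fix v l assume l: "l \<in> cyc S0 n" and vl: "R v l"
    obtain y where y: "Poly_Mapping.keys y \<subseteq> simplices X (Suc n)" "v = nuc n l + lift (bds X (Suc n)) y"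
      using vl unfolding R_def by blast
    note kl = cyc_chain[OF l]
    show "v \<in> bnd X n \<longleftrightarrow> l \<in> ?K"
    proof
      assume "v \<in> bnd X n"
      then obtain y' where y': "Poly_Mapping.keys y' \<subseteq> simplices X (Suc n)" "v = lift (bds X (Suc n)) y'"
        unfolding bnd_def by blast
      \<comment> \<open>The boundary of \<open>y0\<close> is a level cycle, so \<open>y0\<close> is
        a relative cycle and can be decomposed by means of prisms.\<close>
      define y0 where "y0 = y' - y"
      have y0: "Poly_Mapping.keys y0 \<subseteq> simplices X (Suc n)" unfolding y0_def by (rule keys_diff_subset[OF y'(1) y(1)])
      have e: "lift (bds X (Suc n)) y0 = nuc n l" using y(2) y'(2) unfolding y0_def lift_diff by simp
      have "relX n (lift (bds X (Suc n)) y0) = 0" unfolding e by (rule relX_nuc[OF kl])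
      then show "l \<in> ?K"
      proof (rule prism_decomposition[OF y0])
        fix s w l2
        assume s: "Poly_Mapping.keys s \<subseteq> SS n" "lift (bds S1 n) s = 0"
          and w: "Poly_Mapping.keys w \<subseteq> simplices X (Suc (Suc n))"
          and l2: "Poly_Mapping.keys l2 \<subseteq> simplices S0 (Suc n)"
          and y0_eq: "y0 = lift (Pr n) s + lift (bds X (Suc (Suc n))) w + nuc (Suc n) l2"
        have s1: "Poly_Mapping.keys s \<subseteq> simplices S1 n" using s(1) SS_S1 by blast
        have "lift (bds X (Suc n)) (lift (bds X (Suc (Suc n))) w) = 0" using lift_bds_bds[OF X w] by simp
        then have "nuc n l = nuc n (DD n s) + nuc n (lift (bds S0 (Suc n)) l2)"
          unfolding e[symmetric] y0_eq lift_add bds_Prc[OF s1 s(2)] bds_nuc[OF l2] by simp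
        \<comment> \<open>Injectivity of \<open>nuc\<close> lifts the equation in X back to chains
          of sections.\<close>
        then have "nuc n (l - DD n s - lift (bds S0 (Suc n)) l2) = 0" by (simp add: lift_diff)
        moreover have "Poly_Mapping.keys (l - DD n s - lift (bds S0 (Suc n)) l2) \<subseteq> simplices S0 n"
          by (intro keys_diff_subset kl keys_DD[OF s1] keys_lift_bds[OF simplicial_set_sections l2])
        ultimately have "l - DD n s - lift (bds S0 (Suc n)) l2 = 0" by (intro nuc_inj)
        then have "l = DD n s + lift (bds S0 (Suc n)) l2" by (simp add: algebra_simps)
        moreover have "s \<in> cyc S1 n" using s1 s(2) by (simp add: cyc_def)
        moreover have "lift (bds S0 (Suc n)) l2 \<in> bnd S0 n" unfolding bnd_def using l2 by blast
        ultimately show "l \<in> ?K" by blast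
      qed
    next
      assume "l \<in> ?K"
      then obtain s l2 where s: "s \<in> cyc S1 n" and l2: "Poly_Mapping.keys l2 \<subseteq> simplices S0 (Suc n)"
        and eq: "l = DD n s + lift (bds S0 (Suc n)) l2"
        unfolding bnd_def by blast
      note s1 = cyc_chain[OF s]
      have "v = lift (bds X (Suc n)) (lift (Pr n) s + nuc (Suc n) l2 + y)"
        using s unfolding y(2) eq lift_add bds_nuc[OF l2] by (simp add: bds_Prc[OF s1] cyc_def)
      moreover have "Poly_Mapping.keys (lift (Pr n) s + nuc (Suc n) l2 + y) \<subseteq> simplices X (Suc n)"
        by (intro keys_add_subset keys_Prc[OF s1] keys_nuc[OF l2] y(1))
      ultimately show "v \<in> bnd X n" unfolding bnd_def by blast
    qed
  qed (rule that)
qed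


text \<open>Up to a boundary and a level chain, a cycle of X is the prism of a cycle
  \<open>s\<close> of sections, and closedness forces \<open>DD\<close> of \<open>s\<close> to be a
  boundary. The prism raises the dimension by one, hence the shift from \<open>m\<close> to
  \<open>Suc m\<close>.\<close>

lemma presents_cyc_levX:
  obtains g where "presents (cyc X (Suc m)) g (homology (reeb_complex X h m :: ('k::field, _) ch_complex) (Suc 0)) (levX (Suc m))"
proof (rule presents_reeb_1[of m])
  fix f assume P: "presents (scyc m) f (homology (reeb_complex X h m :: ('k::field, _) ch_complex) (Suc 0)) (sbnd m)"
  let ?b = "lift (bds X (Suc (Suc m))) :: ('x \<Rightarrow>\<^sub>0 'k) \<Rightarrow> _"
  interpret D: Vector_Spaces.linear pscale pscale "DD m :: (real list \<times> 'x prism \<Rightarrow>\<^sub>0 'k) \<Rightarrow> _" by (rule DD_linear)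
  define R :: "('x \<Rightarrow>\<^sub>0 'k) \<Rightarrow> _" where
    "R v s \<longleftrightarrow> (\<exists>y l. Poly_Mapping.keys y \<subseteq> simplices X (Suc (Suc m)) \<and> Poly_Mapping.keys l \<subseteq> simplices S0 (Suc m)
      \<and> v = lift (Pr m) s + ?b y + nuc (Suc m) l)" for v s
  have S: "Poly_Mapping.keys s \<subseteq> SS m" "Poly_Mapping.keys s \<subseteq> simplices S1 m" "lift (bds S1 m) s = 0" "DD m s \<in> bnd S0 m"
    if "s \<in> scyc m" for s :: "real list \<times> 'x prism \<Rightarrow>\<^sub>0 'k"
    using that SS_S1 unfolding scyc_def by auto
  have bb: "lift (bds X (Suc m)) (?b y) = 0" if "Poly_Mapping.keys y \<subseteq> simplices X (Suc (Suc m))" for y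
    using lift_bds_bds[OF X that] by simp
  show thesis
  proof (rule presents_transport[OF P X_subspace(1), of "Suc m" R])
    show "levX (Suc m) \<subseteq> (cyc X (Suc m) :: ('x \<Rightarrow>\<^sub>0 'k) set)"
    proof
      fix v :: "'x \<Rightarrow>\<^sub>0 'k" assume "v \<in> levX (Suc m)"
      then obtain l y where "l \<in> cyc S0 (Suc m)" "Poly_Mapping.keys y \<subseteq> simplices X (Suc (Suc m))" "v = nuc (Suc m) l + ?b y"
        unfolding levX_def by blast
      moreover from this have "?b y \<in> cyc X (Suc m)" using X_subspace(3) unfolding bnd_def by blast
      ultimately show "v \<in> cyc X (Suc m)" using pm.subspace_add[OF X_subspace(1) nuc_cyc] by blast
    qed
  next
    fix v w :: "'x \<Rightarrow>\<^sub>0 'k" and x y assume "R v x" "R w y"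
    then obtain a b c d where ab: "Poly_Mapping.keys a \<subseteq> simplices X (Suc (Suc m))" "Poly_Mapping.keys b \<subseteq> simplices S0 (Suc m)"
      "v = lift (Pr m) x + ?b a + nuc (Suc m) b" "Poly_Mapping.keys c \<subseteq> simplices X (Suc (Suc m))"
      "Poly_Mapping.keys d \<subseteq> simplices S0 (Suc m)" "w = lift (Pr m) y + ?b c + nuc (Suc m) d"
      unfolding R_def by blast
    have "v + w = lift (Pr m) (x + y) + ?b (a + c) + nuc (Suc m) (b + d)"
      unfolding ab(3,6) lift_add by (simp add: algebra_simps)
    then show "R (v + w) (x + y)" unfolding R_def using keys_add_subset[OF ab(1,4)] keys_add_subset[OF ab(2,5)] by blast
  next
    fix r and v :: "'x \<Rightarrow>\<^sub>0 'k" and x assume "R v x"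
    then obtain a b where ab: "Poly_Mapping.keys a \<subseteq> simplices X (Suc (Suc m))" "Poly_Mapping.keys b \<subseteq> simplices S0 (Suc m)"
      "v = lift (Pr m) x + ?b a + nuc (Suc m) b" unfolding R_def by blast
    have "pscale r v = lift (Pr m) (pscale r x) + ?b (pscale r a) + nuc (Suc m) (pscale r b)"
      unfolding ab(3) lift_scale by (simp add: pm.scale_right_distrib)
    then show "R (pscale r v) (pscale r x)" unfolding R_def using keys_pscale_subset[OF ab(1)] keys_pscale_subset[OF ab(2)] by blast
  next
    fix v :: "'x \<Rightarrow>\<^sub>0 'k" assume v: "v \<in> cyc X (Suc m)"
    then have "relX m (lift (bds X (Suc m)) v) = 0" by (simp add: cyc_def)
    then show "\<exists>s\<in>scyc m. R v s"
    proof (rule prism_decomposition[OF cyc_chain[OF v]])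
      fix s w l
      assume s: "Poly_Mapping.keys s \<subseteq> SS m" "lift (bds S1 m) s = 0"
        and w: "Poly_Mapping.keys w \<subseteq> simplices X (Suc (Suc m))"
        and l: "Poly_Mapping.keys l \<subseteq> simplices S0 (Suc m)"
        and eq: "v = lift (Pr m) s + ?b w + nuc (Suc m) l"
      have s1: "Poly_Mapping.keys s \<subseteq> simplices S1 m" using s(1) SS_S1 by blast
      have "lift (bds X (Suc m)) v = 0" using v by (simp add: cyc_def)
      \<comment> \<open>The boundary of \<open>v\<close> consists of the end of the prism and the
        boundary of the level chain.\<close>
      then have "nuc m (DD m s + lift (bds S0 (Suc m)) l) = 0"
        unfolding eq lift_add bds_Prc[OF s1 s(2)] bds_nuc[OF l] bb[OF w] by simp
      moreover have "Poly_Mapping.keys (DD m s + lift (bds S0 (Suc m)) l) \<subseteq> simplices S0 m"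
        by (intro keys_add_subset keys_DD[OF s1] keys_lift_bds[OF simplicial_set_sections l])
      ultimately have "DD m s + lift (bds S0 (Suc m)) l = 0" by (intro nuc_inj)
      then have "DD m s = - lift (bds S0 (Suc m)) l" by (rule eq_neg_iff_add_eq_0[THEN iffD2])
      moreover have "lift (bds S0 (Suc m)) l \<in> bnd S0 m" unfolding bnd_def using l by blast
      ultimately have "DD m s \<in> bnd S0 m" using pm.subspace_neg[OF sections_subspace(2)] by simp
      then have "s \<in> scyc m" unfolding scyc_def using s by blast
      moreover have "R v s" unfolding R_def using w l eq by blast
      ultimately show ?thesis by blast
    qed
  next
    fix s :: "real list \<times> 'x prism \<Rightarrow>\<^sub>0 'k" assume s: "s \<in> scyc m"
    obtain l where l: "Poly_Mapping.keys l \<subseteq> simplices S0 (Suc m)" "DD m s = lift (bds S0 (Suc m)) l"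
      using S(4)[OF s] unfolding bnd_def by blast
    \<comment> \<open>The prism of \<open>s\<close> is closed up by a level chain whose boundary is
      \<open>DD m s\<close>.\<close>
    let ?v = "lift (Pr m) s - nuc (Suc m) l"
    have "lift (bds X (Suc m)) ?v = 0"
      unfolding lift_diff bds_Prc[OF S(2,3)[OF s]] bds_nuc[OF l(1)] l(2) by simp
    moreover have "Poly_Mapping.keys ?v \<subseteq> simplices X (Suc m)"
      by (intro keys_diff_subset keys_Prc[OF S(2)[OF s]] keys_nuc[OF l(1)])
    ultimately have "?v \<in> cyc X (Suc m)" by (simp add: cyc_def)
    moreover have "R ?v s" unfolding R_def
      by (rule exI[of _ 0], rule exI[of _ "- l"]) (use l(1) in \<open>simp add: lift_uminus\<close>)
    ultimately show "\<exists>v\<in>cyc X (Suc m). R v s" by blast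
  next
    fix v :: "'x \<Rightarrow>\<^sub>0 'k" and s assume v: "v \<in> cyc X (Suc m)" and s: "s \<in> scyc m" and "R v s"
    then obtain y l where y: "Poly_Mapping.keys y \<subseteq> simplices X (Suc (Suc m))" and l: "Poly_Mapping.keys l \<subseteq> simplices S0 (Suc m)"
      and eq: "v = lift (Pr m) s + ?b y + nuc (Suc m) l" unfolding R_def by blast
    show "v \<in> levX (Suc m) \<longleftrightarrow> s \<in> sbnd m"
    proof
      assume "v \<in> levX (Suc m)"
      then obtain l' y' where l': "l' \<in> cyc S0 (Suc m)" and y': "Poly_Mapping.keys y' \<subseteq> simplices X (Suc (Suc m))"
        and eq': "v = nuc (Suc m) l' + ?b y'" unfolding levX_def by blast
      \<comment> \<open>Two expressions for \<open>v\<close> are compared. Level chains vanish under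
        \<open>relX\<close>, so the prism of \<open>s\<close> is a relative boundary and
        \<open>prism_inj\<close> applies.\<close>
      have "lift (Pr m) s = ?b (y' - y) + nuc (Suc m) l' - nuc (Suc m) l"
        using eq eq' by (simp add: lift_diff algebra_simps)
      then have "relX (Suc m) (lift (Pr m) s) = relX (Suc m) (?b (y' - y) + nuc (Suc m) l' - nuc (Suc m) l)" by simp
      then have "lift (Pr m) s = relX (Suc m) (?b (y' - y))"
        unfolding relX_Prc[OF S(1)[OF s]] lift_add lift_diff[of "\<lambda>x. if mixedX (Suc m) x then sing x else 0" _ "nuc (Suc m) l"]
          relX_nuc[OF l] relX_nuc[OF cyc_chain[OF l']] by simp
      then show "s \<in> sbnd m"
      proof (rule prism_inj[OF S(1,3)[OF s] keys_diff_subset[OF y' y]])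
        fix t assume "Poly_Mapping.keys t \<subseteq> SS (Suc m)" "s = lift (bds S1 (Suc m)) t"
        then show "s \<in> sbnd m" unfolding sbnd_def by blast
      qed
    next
      assume "s \<in> sbnd m"
      then obtain t where t: "Poly_Mapping.keys t \<subseteq> SS (Suc m)" "s = lift (bds S1 (Suc m)) t" unfolding sbnd_def by blast
      have t1: "Poly_Mapping.keys t \<subseteq> simplices S1 (Suc m)" using t(1) SS_S1 by blast
      \<comment> \<open>By the prism identity for \<open>t\<close>, the prism of the boundary of
        \<open>t\<close> is a level chain up to a boundary.\<close>
      have "lift (Pr m) s = nuc (Suc m) (DD (Suc m) t) - ?b (lift (Pr (Suc m)) t)"
        using prism_X[OF t1] unfolding t(2) by (simp add: algebra_simps)
      then have e: "v = nuc (Suc m) (DD (Suc m) t + l) + ?b (y - lift (Pr (Suc m)) t)"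
        unfolding eq by (simp add: lift_add lift_diff)
      have ky: "Poly_Mapping.keys (y - lift (Pr (Suc m)) t) \<subseteq> simplices X (Suc (Suc m))"
        by (intro keys_diff_subset y keys_Prc[OF t1])
      have kl: "Poly_Mapping.keys (DD (Suc m) t + l) \<subseteq> simplices S0 (Suc m)"
        by (intro keys_add_subset keys_DD[OF t1] l)
      have "lift (bds X (Suc m)) v = 0" using v by (simp add: cyc_def)
      then have "nuc m (lift (bds S0 (Suc m)) (DD (Suc m) t + l)) = 0"
        unfolding e lift_add[of "bds X (Suc m)"] bb[OF ky] bds_nuc[OF kl] by simp
      then have "lift (bds S0 (Suc m)) (DD (Suc m) t + l) = 0"
        by (rule nuc_inj[OF keys_lift_bds[OF simplicial_set_sections kl]])
      then have "DD (Suc m) t + l \<in> cyc S0 (Suc m)" using kl by (simp add: cyc_def)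
      then show "v \<in> levX (Suc m)" unfolding levX_def using ky e by blast
    qed
  qed (rule that)
qed


text \<open>A vertex has one height, so every 0-chain is a level chain.\<close>

lemma levX_0: "levX 0 = (cyc X 0 :: ('x \<Rightarrow>\<^sub>0 'k::field) set)"
proof (intro equalityI subsetI)
  fix v :: "'x \<Rightarrow>\<^sub>0 'k" assume "v \<in> cyc X 0"
  note k = cyc_chain[OF this]
  have "relX 0 v = 0" by (simp add: mixedX_def)
  then obtain l where l: "Poly_Mapping.keys l \<subseteq> simplices S0 0" "nuc 0 l = v" using nuc_surj[OF k] by blast
  then have "l \<in> cyc S0 0" "v = nuc 0 l + lift (bds X (Suc 0)) 0" by (simp_all add: cyc_def)
  then show "v \<in> levX 0" unfolding levX_def by (intro CollectI exI[of _ l] exI[of _ 0]) simp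
next
  fix v :: "'x \<Rightarrow>\<^sub>0 'k" assume "v \<in> levX 0"
  then obtain l y where "l \<in> cyc S0 0" "Poly_Mapping.keys y \<subseteq> simplices X (Suc 0)" "v = nuc 0 l + lift (bds X (Suc 0)) y"
    unfolding levX_def by blast
  moreover from this have "lift (bds X (Suc 0)) y \<in> cyc X 0" using X_subspace(3) unfolding bnd_def by blast
  ultimately show "v \<in> cyc X 0" using pm.subspace_add[OF X_subspace(1) nuc_cyc] by blast
qed


text \<open>The subspace \<open>levX n\<close> modulo boundaries gives the summand
  \<open>(0, n)\<close>, the quotient by \<open>levX n\<close> the summand \<open>(1, n - 1)\<close>
  when \<open>n > 0\<close>, and the others are zero. With a projection onto \<open>levX n\<close>
  the map is \<open>g0 (\<pi> v)\<close> in the first and \<open>g1 v\<close> in the second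
  component.\<close>

lemma homology_iso:
  "mod_iso (class_ring :: 'k::field ring) (sset_homology X n)
    (dir_sum {(p, q). p + q = n} (\<lambda>(p, q). homology (reeb_complex X h q) p))"
proof -
  let ?I = "{(p, q). p + q = n}" and ?M = "\<lambda>(p, q). homology (reeb_complex X h q :: ('k, _) ch_complex) p"
  have fin: "finite ?I" by (rule finite_subset[of _ "{..n} \<times> {..n}"]) auto
  note V = X_subspace(1)
  obtain g0 where P0: "presents (levX n) g0 (?M (0, n)) (bnd X n)" using presents_levX by auto
  note P0' = presentsD[OF P0]
  have zero_mod: "carrier (?M i) = {\<zero>\<^bsub>?M i\<^esub>}" "\<zero>\<^bsub>?M i\<^esub> \<oplus>\<^bsub>?M i\<^esub> \<zero>\<^bsub>?M i\<^esub> = \<zero>\<^bsub>?M i\<^esub>"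
    "r \<odot>\<^bsub>?M i\<^esub> \<zero>\<^bsub>?M i\<^esub> = \<zero>\<^bsub>?M i\<^esub>" if i: "i \<in> ?I" "fst i \<noteq> 0" "fst i \<noteq> Suc 0" for i r
  proof -
    obtain a q where aq: "i = (a, q)" by (cases i)
    define p where "p = a - 2"
    have "a = Suc (Suc p)" using i(2,3) unfolding aq p_def by simp
    then have pq: "i = (Suc (Suc p), q)" using aq by simp
    obtain f and K :: "(real list \<times> 'x prism \<Rightarrow>\<^sub>0 'k) set"
      where "presents K f (homology (reeb_complex X h q) (Suc (Suc p))) K"
      by (rule presents_reeb_ge2)
    then have P: "presents K f (?M i) K" unfolding pq by simp
    note P' = presentsD[OF P]
    have 0: "0 \<in> K" by (rule pm.subspace_0[OF P'(1)])
    show "carrier (?M i) = {\<zero>\<^bsub>?M i\<^esub>}" unfolding P'(2)[symmetric] using P'(6) 0 by (auto simp: image_iff)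
    show "\<zero>\<^bsub>?M i\<^esub> \<oplus>\<^bsub>?M i\<^esub> \<zero>\<^bsub>?M i\<^esub> = \<zero>\<^bsub>?M i\<^esub>" using P'(3)[OF 0 0] unfolding P'(5)[symmetric] by simp
    show "r \<odot>\<^bsub>?M i\<^esub> \<zero>\<^bsub>?M i\<^esub> = \<zero>\<^bsub>?M i\<^esub>" using P'(4)[OF 0, of r] unfolding P'(5)[symmetric] by simp
  qed
  have "\<exists>g. presents (cyc X n) g (dir_sum ?I ?M) (bnd X n)"
  proof (cases n)
    case 0
    then have I: "?I = {(0, 0)}" by auto
    note P = P0[unfolded 0 levX_0]
    note P' = presentsD[OF P]
    have "presents (cyc X 0) (\<lambda>v. \<lambda>i\<in>?I. g0 v) (dir_sum ?I ?M) (bnd X 0)"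
    proof (rule presents_dir_sum[OF fin V])
      show "\<exists>v\<in>cyc X 0. \<forall>i\<in>?I. g0 v = m i" if "\<And>i. i \<in> ?I \<Longrightarrow> m i \<in> carrier (?M i)" for m
      proof -
        have "m (0, 0) \<in> g0 ` cyc X 0" using that[of "(0, 0)"] unfolding I P'(2) 0 by simp
        then obtain v where "v \<in> cyc X 0" "m (0, 0) = g0 v" by blast
        then show ?thesis unfolding I by (intro bexI[of _ v]) simp_all
      qed
      show "bnd X 0 = {v \<in> cyc X 0. \<forall>i\<in>?I. g0 v = \<zero>\<^bsub>?M i\<^esub>}" unfolding I using P'(6) by auto
    qed (unfold I, use P'(2-5) in auto)
    then show ?thesis unfolding 0 by blast
  next
    case (Suc m)
    obtain g1 where P1: "presents (cyc X n) g1 (?M (Suc 0, m)) (levX n)" using presents_cyc_levX[of m] unfolding Suc by auto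
    note P1' = presentsD[OF P1]
    note U = presents_kernel_subspace[OF P1]
    obtain \<pi> where \<pi>: "Vector_Spaces.linear pscale pscale \<pi>" "range \<pi> \<subseteq> (levX n :: ('x \<Rightarrow>\<^sub>0 'k) set)" "\<And>u. u \<in> levX n \<Longrightarrow> \<pi> u = u"
      using subspace_projection[OF U(1)] by blast
    interpret \<pi>: Vector_Spaces.linear pscale pscale \<pi> by (rule \<pi>(1))
    have \<pi>U: "\<pi> v \<in> levX n" for v using \<pi>(2) by auto
    define g where "g i = (if fst i = 0 then g0 \<circ> \<pi> else if fst i = Suc 0 then g1 else (\<lambda>_. \<zero>\<^bsub>?M i\<^esub>))" for i
    have cases: "i = (0, n) \<or> i = (Suc 0, m) \<or> fst i \<noteq> 0 \<and> fst i \<noteq> Suc 0" if "i \<in> ?I" for i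
      using that Suc by (cases i) auto
    have g0: "g (0, n) = g0 \<circ> \<pi>" and g1: "g (Suc 0, m) = g1" and g2: "fst i \<noteq> 0 \<Longrightarrow> fst i \<noteq> Suc 0 \<Longrightarrow> g i = (\<lambda>_. \<zero>\<^bsub>?M i\<^esub>)" for i
      by (simp_all add: g_def)
    have "presents (cyc X n) (\<lambda>v. \<lambda>i\<in>?I. g i v) (dir_sum ?I ?M) (bnd X n)"
    proof (rule presents_dir_sum[OF fin V])
      fix i assume i: "i \<in> ?I"
      note z = zero_mod[OF i]
      show "g i 0 = \<zero>\<^bsub>?M i\<^esub>" using cases[OF i] P0'(5) P1'(5) g0 g1 g2[of i] by (auto simp: \<pi>.zero)
      fix v :: "'x \<Rightarrow>\<^sub>0 'k" assume v: "v \<in> cyc X n"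
      have c0: "g0 (\<pi> v) \<in> carrier (?M (0, n))" unfolding P0'(2)[symmetric] by (rule imageI[OF \<pi>U])
      have c1: "g1 v \<in> carrier (?M (Suc 0, m))" unfolding P1'(2)[symmetric] by (rule imageI[OF v])
      show "g i v \<in> carrier (?M i)" using cases[OF i]
      proof (elim disjE conjE)
        assume a: "fst i \<noteq> 0" "fst i \<noteq> Suc 0"
        show ?thesis unfolding g2[OF a] z(1)[OF a] by simp
      qed (use c0 c1 g0 g1 in simp_all)
      show "g i (pscale r v) = r \<odot>\<^bsub>?M i\<^esub> g i v" for r using cases[OF i]
      proof (elim disjE conjE)
        assume a: "fst i \<noteq> 0" "fst i \<noteq> Suc 0"
        show ?thesis unfolding g2[OF a] z(3)[OF a] ..
      qed (use P0'(4)[OF \<pi>U] P1'(4)[OF v] g0 g1 in \<open>simp_all add: \<pi>.scale\<close>)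
      fix w :: "'x \<Rightarrow>\<^sub>0 'k" assume w: "w \<in> cyc X n"
      show "g i (v + w) = g i v \<oplus>\<^bsub>?M i\<^esub> g i w" using cases[OF i]
      proof (elim disjE conjE)
        assume a: "fst i \<noteq> 0" "fst i \<noteq> Suc 0"
        show ?thesis unfolding g2[OF a] z(2)[OF a] ..
      qed (use P0'(3)[OF \<pi>U \<pi>U] P1'(3)[OF v w] g0 g1 in \<open>simp_all add: \<pi>.add\<close>)
    next
      have I: "(0, n) \<in> ?I" "(Suc 0, m) \<in> ?I" using Suc by auto
      show "bnd X n = {v \<in> cyc X n. \<forall>i\<in>?I. g i v = \<zero>\<^bsub>?M i\<^esub>}"
      proof (intro equalityI subsetI)
        fix v :: "'x \<Rightarrow>\<^sub>0 'k" assume b: "v \<in> bnd X n"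
        then have v: "v \<in> cyc X n" "v \<in> levX n" using P0'(6) U(2) by auto
        have "g0 (\<pi> v) = \<zero>\<^bsub>?M (0, n)\<^esub>" unfolding \<pi>(3)[OF v(2)] using b P0'(6) by blast
        moreover have "g1 v = \<zero>\<^bsub>?M (Suc 0, m)\<^esub>" using v(2) P1'(6) by blast
        ultimately have "g i v = \<zero>\<^bsub>?M i\<^esub>" if "i \<in> ?I" for i
          using cases[OF that]
        proof (elim disjE conjE)
          assume a: "fst i \<noteq> 0" "fst i \<noteq> Suc 0"
          show ?thesis unfolding g2[OF a] ..
        qed (simp_all only: g0 g1 comp_apply)
        then show "v \<in> {v \<in> cyc X n. \<forall>i\<in>?I. g i v = \<zero>\<^bsub>?M i\<^esub>}" using v by blast
      next
        fix v assume "v \<in> {v \<in> cyc X n. \<forall>i\<in>?I. g i v = \<zero>\<^bsub>?M i\<^esub>}"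
        then have v: "v \<in> cyc X n" "g (0, n) v = \<zero>\<^bsub>?M (0, n)\<^esub>" "g (Suc 0, m) v = \<zero>\<^bsub>?M (Suc 0, m)\<^esub>"
          using I by auto
        \<comment> \<open>Vanishing of \<open>g1 v\<close> puts \<open>v\<close> into
          \<open>levX n\<close>, where the projection is the identity, so that \<open>g0\<close>
          detects boundaries.\<close>
        then have u: "v \<in> levX n" using P1'(6) unfolding g1 by blast
        then show "v \<in> bnd X n" using v(2) P0'(6) unfolding g0 by (simp add: \<pi>(3))
      qed
      fix k assume k: "\<And>i. i \<in> ?I \<Longrightarrow> k i \<in> carrier (?M i)"
      obtain u where u: "u \<in> levX n" "k (0, n) = g0 u" using k[OF I(1)] unfolding P0'(2)[symmetric] by blast
      obtain v where v: "v \<in> cyc X n" "k (Suc 0, m) = g1 v" using k[OF I(2)] unfolding P1'(2)[symmetric] by blast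
      \<comment> \<open>Subtracting the projection of \<open>v\<close> clears the first component
        without changing the class modulo \<open>levX n\<close>; adding \<open>u\<close> sets the
        first component as prescribed.\<close>
      let ?w = "v - \<pi> v + u"
      have w: "?w \<in> cyc X n" using v(1) u(1) \<pi>U U(2) pm.subspace_add[OF V] pm.subspace_diff[OF V] by blast
      have "\<pi> ?w = u" by (simp add: \<pi>.add \<pi>.diff \<pi>(3)[OF \<pi>U] \<pi>(3)[OF u(1)])
      then have "g (0, n) ?w = k (0, n)" unfolding g0 u(2) by simp
      moreover have "?w - v \<in> levX n"
      proof -
        have "?w - v = u - \<pi> v" by simp
        then show ?thesis using pm.subspace_diff[OF U(1) u(1) \<pi>U] by simp
      qed
      then have "g (Suc 0, m) ?w = k (Suc 0, m)" unfolding g1 v(2) using presents_eq_iff[OF P1 w v(1)] by blast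
      moreover have "g i ?w = k i" if i: "i \<in> ?I" and a: "fst i \<noteq> 0" "fst i \<noteq> Suc 0" for i
        using k[OF i] unfolding g2[OF a] zero_mod(1)[OF i a] by simp
      ultimately have "g i ?w = k i" if "i \<in> ?I" for i
        using cases[OF that] that by (elim disjE conjE) simp_all
      then have "\<forall>i\<in>?I. g i ?w = k i" by (rule ballI)
      then show "\<exists>v\<in>cyc X n. \<forall>i\<in>?I. g i v = k i" using w by blast
    qed
    then show ?thesis by blast
  qed
  then show ?thesis using presents_mod_iso[OF presents_sset_homology(1)[OF X]] by blast
qed

end

theorem mainTheorem4:
  fixes X :: "'x sset" and h :: "nat \<Rightarrow> 'x \<Rightarrow> real list" and n :: nat
  assumes "simplicial_set X"
    and "height_function X h"
    and "subdivided X h"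
  shows "mod_iso (class_ring :: 'k::field ring)
    (sset_homology X n)
    (dir_sum {(p, q). p + q = n} (\<lambda>(p, q). homology (reeb_complex X h q) p))"
proof -
  interpret subdivided_height X h using assms by unfold_locales
  show ?thesis by (rule homology_iso)
qed

end
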